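(* The decision problems $\mathrm{FEASIBLE}$ and $\mathrm{INEQ}$ are $\exists\mathbb{R}$-complete. In particular, solving a single polynomial equation in many variables over $\mathbb{R}$ is, up to a polynomial-time reduction, as hard as solving a system of polynomial equations and inequalities over $\mathbb{R}$ (that is, $\mathrm{INEQ}$ reduces to $\mathrm{FEASIBLE}$ by a polynomial-time many-to-one reduction).
   Context: **Formulas.** A formula of the first-order theory of the reals is built from the constants $0,1$, the binary operation symbols $+,-,\times$, the relation symbols $\le,<,\ge,>,=,\ne$, the logical connectives $\wedge,\vee,\neg,\Leftrightarrow$, the quantifiers $\forall,\exists$, symbols for variables, and parentheses, with the usual syntax; variables range over $\mathbb{R}$ and the symbols have their usual meaning. A sentence is a formula without free variables. The size of a formula is its length, i.e., the number of symbols in it. (Consequently an integer constant $k$ can be written with $O(\log k)$ symbols through its binary expansion, whereas a power $X^k$ is an abbreviation for the $k$-fold product $X\times\cdots\times X$ and counts as such.) **ETR.** $\mathrm{ETR}$ is the decision problem whose input is an existential sentence $(\exists X_1 X_2\ldots X_k)\Phi$ with $\Phi$ quantifier-free, and whose output is the truth value of the sentence. **The class $\exists\mathbb{R}$.** $\exists\mathbb{R}$ is the class of decision problems that reduce to $\mathrm{ETR}$ by a polynomial-time many-to-one reduction: a decision problem $A$ reduces to a decision problem $B$ if there is a polynomial-time computable mapping $f$ such that $x$ is a YES-instance of $A$ if and only if $f(x)$ is a YES-instance of $B$. A problem is $\exists\mathbb{R}$-complete if it belongs to $\exists\mathbb{R}$ and every problem in $\exists\mathbb{R}$ reduces to it in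 this sense. **INEQ and FEASIBLE.** Both problems ask for the truth value of an existential sentence $(\exists X_1\ldots X_n)\Phi$ with $\Phi$ quantifier-free of a special form. For $\mathrm{INEQ}$, $\Phi$ is a conjunction of polynomial equations and inequalities, where the polynomials are required to be written in the standard form, as sums of monomials with integer coefficients (so, e.g., $(1+X_1)(1+X_2)\cdots(1+X_n)$ is not allowed in unexpanded form). $\mathrm{FEASIBLE}$ is the special case of $\mathrm{INEQ}$ in which $\Phi$ is a single polynomial equation $p(X_1,\ldots,X_n)=0$. *)

theory Defs
  imports Complex_Main "HOL-Computational_Algebra.Polynomial"
begin

section \<open>First-order formulas over the reals\<close>

text \<open>The supply of variable symbols is \<open>X\<^sub>w\<close>, where \<open>w\<close> ranges over all bit strings.\<close>

type_synonym var = "bool list"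

datatype trm =
    Var var
  | Zero
  | One
  | Plus trm trm
  | Minus trm trm
  | Times trm trm

datatype rel = Le | Lt | Ge | Gt | Eq | Ne

datatype fm =
    Rel rel trm trm
  | Conj fm fm
  | Disj fm fm
  | Neg fm
  | Equiv fm fm
  | All var fm
  | Ex var fm

primrec eval :: "(var \<Rightarrow> real) \<Rightarrow> trm \<Rightarrow> real" where
  "eval e (Var x) = e x"
| "eval e Zero = 0"
| "eval e One = 1"
| "eval e (Plus s t) = eval e s + eval e t"
| "eval e (Minus s t) = eval e s - eval e t"
| "eval e (Times s t) = eval e s * eval e t"

primrec rel_holds :: "rel \<Rightarrow> real \<Rightarrow> real \<Rightarrow> bool" where
  "rel_holds Le a b \<longleftrightarrow> a \<le> b"
| "rel_holds Lt a b \<longleftrightarrow> a < b"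
| "rel_holds Ge a b \<longleftrightarrow> a \<ge> b"
| "rel_holds Gt a b \<longleftrightarrow> a > b"
| "rel_holds Eq a b \<longleftrightarrow> a = b"
| "rel_holds Ne a b \<longleftrightarrow> a \<noteq> b"

primrec holds :: "(var \<Rightarrow> real) \<Rightarrow> fm \<Rightarrow> bool" where
  "holds e (Rel r s t) \<longleftrightarrow> rel_holds r (eval e s) (eval e t)"
| "holds e (Conj \<phi> \<psi>) \<longleftrightarrow> holds e \<phi> \<and> holds e \<psi>"
| "holds e (Disj \<phi> \<psi>) \<longleftrightarrow> holds e \<phi> \<or> holds e \<psi>"
| "holds e (Neg \<phi>) \<longleftrightarrow> \<not> holds e \<phi>"
| "holds e (Equiv \<phi> \<psi>) \<longleftrightarrow> (holds e \<phi> \<longleftrightarrow> holds e \<psi>)"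
| "holds e (All x \<phi>) \<longleftrightarrow> (\<forall>a. holds (e(x := a)) \<phi>)"
| "holds e (Ex x \<phi>) \<longleftrightarrow> (\<exists>a. holds (e(x := a)) \<phi>)"

primrec trm_vars :: "trm \<Rightarrow> var set" where
  "trm_vars (Var x) = {x}"
| "trm_vars Zero = {}"
| "trm_vars One = {}"
| "trm_vars (Plus s t) = trm_vars s \<union> trm_vars t"
| "trm_vars (Minus s t) = trm_vars s \<union> trm_vars t"
| "trm_vars (Times s t) = trm_vars s \<union> trm_vars t"

primrec free_vars :: "fm \<Rightarrow> var set" where
  "free_vars (Rel r s t) = trm_vars s \<union> trm_vars t"
| "free_vars (Conj \<phi> \<psi>) = free_vars \<phi> \<union> free_vars \<psi>"
| "free_vars (Disj \<phi> \<psi>) = free_vars \<phi> \<union> free_vars \<psi>"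
| "free_vars (Neg \<phi>) = free_vars \<phi>"
| "free_vars (Equiv \<phi> \<psi>) = free_vars \<phi> \<union> free_vars \<psi>"
| "free_vars (All x \<phi>) = free_vars \<phi> - {x}"
| "free_vars (Ex x \<phi>) = free_vars \<phi> - {x}"

primrec quantifier_free :: "fm \<Rightarrow> bool" where
  "quantifier_free (Rel r s t) \<longleftrightarrow> True"
| "quantifier_free (Conj \<phi> \<psi>) \<longleftrightarrow> quantifier_free \<phi> \<and> quantifier_free \<psi>"
| "quantifier_free (Disj \<phi> \<psi>) \<longleftrightarrow> quantifier_free \<phi> \<and> quantifier_free \<psi>"
| "quantifier_free (Neg \<phi>) \<longleftrightarrow> quantifier_free \<phi>"
| "quantifier_free (Equiv \<phi> \<psi>) \<longleftrightarrow> quantifier_free \<phi> \<and> quantifier_free \<psi>"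
| "quantifier_free (All x \<phi>) \<longleftrightarrow> False"
| "quantifier_free (Ex x \<phi>) \<longleftrightarrow> False"

definition sentence :: "fm \<Rightarrow> bool" where
  "sentence \<phi> \<longleftrightarrow> free_vars \<phi> = {}"

definition true_sentence :: "fm \<Rightarrow> bool" where
  "true_sentence \<phi> \<longleftrightarrow> sentence \<phi> \<and> (\<forall>e. holds e \<phi>)"

abbreviation ex_prefix :: "var list \<Rightarrow> fm \<Rightarrow> fm" where
  "ex_prefix xs \<Phi> \<equiv> foldr Ex xs \<Phi>"


section \<open>Formulas as words\<close>

text \<open>
  Formulas are written in infix notation with all parentheses. A variable \<open>X\<^sub>w\<close> is the symbol
  \<open>SVar\<close> followed by the bits of \<open>w\<close> as subscript symbols, so that the
  alphabet is finite; subscripts are distinct from the constants \<open>0\<close> and \<open>1\<close>.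
\<close>

datatype sym =
    SZero | SOne | SPlus | SMinus | STimes
  | SRel rel
  | SConj | SDisj | SNeg | SEquiv | SAll | SEx
  | SVar | SSub bool
  | SOpen | SClose

definition var_word :: "var \<Rightarrow> sym list" where
  "var_word x = SVar # map SSub x"

primrec trm_word :: "trm \<Rightarrow> sym list" where
  "trm_word (Var x) = var_word x"
| "trm_word Zero = [SZero]"
| "trm_word One = [SOne]"
| "trm_word (Plus s t) = SOpen # trm_word s @ SPlus # trm_word t @ [SClose]"
| "trm_word (Minus s t) = SOpen # trm_word s @ SMinus # trm_word t @ [SClose]"
| "trm_word (Times s t) = SOpen # trm_word s @ STimes # trm_word t @ [SClose]"

primrec fm_word :: "fm \<Rightarrow> sym list" where
  "fm_word (Rel r s t) = SOpen # trm_word s @ SRel r # trm_word t @ [SClose]"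
| "fm_word (Conj \<phi> \<psi>) = SOpen # fm_word \<phi> @ SConj # fm_word \<psi> @ [SClose]"
| "fm_word (Disj \<phi> \<psi>) = SOpen # fm_word \<phi> @ SDisj # fm_word \<psi> @ [SClose]"
| "fm_word (Neg \<phi>) = SNeg # fm_word \<phi>"
| "fm_word (Equiv \<phi> \<psi>) = SOpen # fm_word \<phi> @ SEquiv # fm_word \<psi> @ [SClose]"
| "fm_word (All x \<phi>) = SAll # var_word x @ fm_word \<phi>"
| "fm_word (Ex x \<phi>) = SEx # var_word x @ fm_word \<phi>"

primrec rel_number :: "rel \<Rightarrow> nat" where
  "rel_number Le = 0"
| "rel_number Lt = 1"
| "rel_number Ge = 2"
| "rel_number Gt = 3"
| "rel_number Eq = 4"
| "rel_number Ne = 5"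

primrec sym_number :: "sym \<Rightarrow> nat" where
  "sym_number SZero = 0"
| "sym_number SOne = 1"
| "sym_number SPlus = 2"
| "sym_number SMinus = 3"
| "sym_number STimes = 4"
| "sym_number SConj = 5"
| "sym_number SDisj = 6"
| "sym_number SNeg = 7"
| "sym_number SEquiv = 8"
| "sym_number SAll = 9"
| "sym_number SEx = 10"
| "sym_number SVar = 11"
| "sym_number (SSub b) = (if b then 13 else 12)"
| "sym_number SOpen = 14"
| "sym_number SClose = 15"
| "sym_number (SRel r) = 16 + rel_number r"

text \<open>Every symbol becomes a block of five bits, least significant bit first.\<close>

definition sym_bits :: "sym \<Rightarrow> bool list" where
  "sym_bits s = map (\<lambda>i. odd (sym_number s div 2 ^ i)) [0..<5]"

definition encode :: "fm \<Rightarrow> bool list" where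
  "encode \<phi> = concat (map sym_bits (fm_word \<phi>))"


section \<open>The decision problems\<close>

text \<open>
  A decision problem is the set of its YES-instances, as a set of bit strings; a bit string that
  does not encode a sentence of the required form is a NO-instance.
\<close>

type_synonym problem = "bool list set"

definition ETR :: problem where
  "ETR = {encode (ex_prefix xs \<Phi>) | xs \<Phi>.
     quantifier_free \<Phi> \<and> true_sentence (ex_prefix xs \<Phi>)}"

text \<open>Natural numbers in binary, by Horner's rule, with \<open>O(log n)\<close> symbols.\<close>

fun numeral_trm :: "nat \<Rightarrow> trm" where
  "numeral_trm n =
     (if n = 0 then Zero
      else if n = 1 then One
      else if even n then Times (Plus One One) (numeral_trm (n div 2))
      else Plus One (Times (Plus One One) (numeral_trm (n div 2))))"

declare numeral_trm.simps [simp del]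

text \<open>
  Monomials \<open>c \<times> X \<times> \<dots> \<times> Y\<close>, bracketed to the left; the coefficient \<open>c\<close> may be omitted if it is
  \<open>1\<close>. Coefficients are nonnegative here, and negative ones are obtained by subtracting the
  monomial. The term \<open>Zero\<close> is itself a monomial, so a sum can start with \<open>0 - m\<close>.
\<close>

inductive monomial :: "trm \<Rightarrow> bool" where
  "monomial (numeral_trm c)"
| "monomial (Var x)"
| "monomial m \<Longrightarrow> monomial (Times m (Var x))"

inductive standard_poly :: "trm \<Rightarrow> bool" where
  "monomial m \<Longrightarrow> standard_poly m"
| "standard_poly p \<Longrightarrow> monomial m \<Longrightarrow> standard_poly (Plus p m)"
| "standard_poly p \<Longrightarrow> monomial m \<Longrightarrow> standard_poly (Minus p m)"

inductive poly_system :: "fm \<Rightarrow> bool" where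
  "standard_poly p \<Longrightarrow> standard_poly q \<Longrightarrow> r \<in> {Eq, Le, Lt, Ge, Gt} \<Longrightarrow> poly_system (Rel r p q)"
| "poly_system \<phi> \<Longrightarrow> poly_system \<psi> \<Longrightarrow> poly_system (Conj \<phi> \<psi>)"

definition INEQ :: problem where
  "INEQ = {encode (ex_prefix xs \<Phi>) | xs \<Phi>.
     poly_system \<Phi> \<and> true_sentence (ex_prefix xs \<Phi>)}"

definition FEASIBLE :: problem where
  "FEASIBLE = {encode (ex_prefix xs (Rel Eq p Zero)) | xs p.
     standard_poly p \<and> true_sentence (ex_prefix xs (Rel Eq p Zero))}"


section \<open>Polynomial-time computable functions\<close>

text \<open>
  Deterministic Turing machines with finitely many two-way infinite tapes. A tape is given as
  seen from its head: \<open>t i\<close> is the symbol \<open>i\<close> cells to the right of the head, and moving the head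
  shifts the tape. The symbol \<open>0\<close> is the blank; \<open>1\<close> and \<open>2\<close> stand for the input bits.
\<close>

type_synonym tape = "int \<Rightarrow> nat"

datatype move = MLeft | MStay | MRight

record tm =
  tapes :: nat
  symbols :: "nat set"
  states :: "nat set"
  start :: nat
  halt :: nat
  delta :: "nat \<Rightarrow> nat list \<Rightarrow> nat \<times> (nat \<times> move) list"

definition turing_machine :: "tm \<Rightarrow> bool" where
  "turing_machine M \<longleftrightarrow>
     tapes M \<ge> 1 \<and>
     finite (symbols M) \<and> {0, 1, 2} \<subseteq> symbols M \<and>
     finite (states M) \<and> start M \<in> states M \<and> halt M \<in> states M \<and>
     (\<forall>q \<in> states M. \<forall>as. length as = tapes M \<and> set as \<subseteq> symbols M \<longrightarrow>
        (case delta M q as of (q', acts) \<Rightarrow>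
           q' \<in> states M \<and> length acts = tapes M \<and> fst ` set acts \<subseteq> symbols M))"

primrec offset :: "move \<Rightarrow> int" where
  "offset MLeft = -1"
| "offset MStay = 0"
| "offset MRight = 1"

definition act :: "nat \<times> move \<Rightarrow> tape \<Rightarrow> tape" where
  "act a t = (\<lambda>i. (t(0 := fst a)) (i + offset (snd a)))"

definition step :: "tm \<Rightarrow> nat \<times> tape list \<Rightarrow> nat \<times> tape list" where
  "step M = (\<lambda>(q, ts).
     if q = halt M then (q, ts)
     else case delta M q (map (\<lambda>t. t 0) ts) of (q', acts) \<Rightarrow> (q', map2 act acts ts))"

definition blank_tape :: tape where
  "blank_tape = (\<lambda>_. 0)"

definition word_tape :: "bool list \<Rightarrow> tape" where
  "word_tape w = (\<lambda>i. if 0 \<le> i \<and> i < int (length w) then (if w ! nat i then 2 else 1) else 0)"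

definition init_config :: "tm \<Rightarrow> bool list \<Rightarrow> nat \<times> tape list" where
  "init_config M w = (start M, word_tape w # replicate (tapes M - 1) blank_tape)"

text \<open>
  The first tape holds the input and, on halting, exactly the output, with the head on its first
  symbol; the other tapes may contain anything then.
\<close>

definition computes_within :: "tm \<Rightarrow> nat \<Rightarrow> bool list \<Rightarrow> bool list \<Rightarrow> bool" where
  "computes_within M T w v \<longleftrightarrow>
     (\<exists>t \<le> T. case (step M ^^ t) (init_config M w) of (q, ts) \<Rightarrow>
        q = halt M \<and> hd ts = word_tape v)"

definition polytime :: "(bool list \<Rightarrow> bool list) \<Rightarrow> bool" where
  "polytime f \<longleftrightarrow>
     (\<exists>M (p :: nat poly). turing_machine M \<and>
        (\<forall>w. computes_within M (poly p (length w)) w (f w)))"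


section \<open>The existential theory of the reals as a complexity class\<close>

definition reduces :: "problem \<Rightarrow> problem \<Rightarrow> bool" (infix "\<le>\<^sub>p" 50) where
  "A \<le>\<^sub>p B \<longleftrightarrow> (\<exists>f. polytime f \<and> (\<forall>x. x \<in> A \<longleftrightarrow> f x \<in> B))"

definition ER :: "problem set" where
  "ER = {A. A \<le>\<^sub>p ETR}"

definition ER_complete :: "problem \<Rightarrow> bool" where
  "ER_complete A \<longleftrightarrow> A \<in> ER \<and> (\<forall>B \<in> ER. B \<le>\<^sub>p A)"

end

theory Submission
  imports Defs
begin

text \<open>
  Every node of the syntax tree of a quantifier-free formula gets an existentially quantified
  variable for its value, truth values being 0 and 1. The connectives become polynomials, and the
  truth value of a comparison of \<open>a\<close> and \<open>b\<close> is a polynomial in the sign \<open>c\<close> of \<open>b - a\<close>, which is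
  determined by \<open>b - a = c u\<^sup>2\<close>, \<open>u v = 1\<close> and \<open>c\<^sup>3 = c\<close>. Each of these constraints has boundedly many
  monomials, so its square can be expanded, and the sum of all squares is one polynomial in standard
  form that vanishes iff all constraints hold. The original prefix is kept, so that an unbound
  variable remains unbound and free variables need not be looked for.

  Conversely, \<open>INEQ\<close> and \<open>FEASIBLE\<close> are syntactic restrictions of \<open>ETR\<close>, which a shift-reduce
  parser recognizes by computing one of finitely many classes for every subterm and subformula.

  Both reductions are programs on finitely many stacks, and a stack is a tape with the head on the
  top element: input and output tapes in the sense of the machine model are exactly such stacks.
\<close>

section \<open>Stack programs\<close>

text \<open>Completeness quantifies over every problem of the class, so an arbitrary machine has to
  be composed with the concrete reduction; hence composition is proved for machines as well as for
  stack programs. The concrete reductions make no test for the end of a computation: a unary counter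
  loaded from the input fixes the number of passes in advance, and a finished computation idles. So
  malformed input needs no termination argument. Exponential growth threatens in two places.
  Expanding nested products of sums is avoided by naming every node; a loop whose body may enlarge
  its own input is controlled by bounding the stacks that feed the output apart from the output
  itself. A formula with a free variable is a NO-instance, so apart from auxiliary variables the
  polynomial must mention exactly the free variables of the formula. Occurrence is a syntactic
  matter, and in an uncollected expansion nothing cancels.\<close>

definition stack_tape :: "nat list \<Rightarrow> tape" where
  "stack_tape xs = (\<lambda>i. if 0 \<le> i \<and> i < int (length xs) then xs ! nat i else 0)"

definition peek :: "nat list \<Rightarrow> nat" where
  "peek xs = (case xs of [] \<Rightarrow> 0 | a # _ \<Rightarrow> a)"

lemma peek_simps [simp]: "peek [] = 0" "peek (a # xs) = a"
  by (auto simp: peek_def)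

lemma stack_tape_0 [simp]: "stack_tape xs 0 = peek xs"
  by (cases xs) (auto simp: stack_tape_def)

lemma stack_tape_Nil: "stack_tape [] = blank_tape"
  by (auto simp: stack_tape_def blank_tape_def)

text \<open>Blanking the top before moving right leaves only blanks to the left of the head; on an
  empty stack the head moves over blanks and nothing changes.\<close>

lemma act_pop: "act (0, MRight) (stack_tape xs) = stack_tape (tl xs)"
proof
  fix i
  show "act (0, MRight) (stack_tape xs) i = stack_tape (tl xs) i"
    by (cases xs) (auto simp: stack_tape_def act_def nat_add_distrib nth_Cons')
qed

text \<open>An action writes before it moves, so the new letter cannot be written in the step in
  which the head reaches the free cell on the left; the first action therefore rewrites the old
  top.\<close>

lemma act_push: "act (a, MStay) (act (peek xs, MLeft) (stack_tape xs)) = stack_tape (a # xs)"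
proof
  fix i
  show "act (a, MStay) (act (peek xs, MLeft) (stack_tape xs)) i = stack_tape (a # xs) i"
    by (cases xs) (auto simp: stack_tape_def act_def nth_Cons' nat_diff_distrib)
qed

lemma act_stay [simp]: "act (t 0, MStay) t = t"
  by (auto simp: act_def)

lemma act_stay_peek [simp]: "act (peek xs, MStay) (stack_tape xs) = stack_tape xs"
  using act_stay[of "stack_tape xs"] by simp

section \<open>Stack programs, their cost and their machines\<close>

type_synonym store = "nat \<Rightarrow> nat list"

text \<open>\<open>Put\<close> only occurs as the second half of a \<open>Push\<close>, which needs two machine steps.\<close>

datatype com =
    Push nat nat
  | Put nat nat
  | Pop nat
  | Seq com com
  | Switch nat "nat \<Rightarrow> com"
  | While nat "nat set" com

text \<open>Letters are 1 to \<open>N\<close>, with 0 the blank below every stack; \<open>N\<close>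
  is at least 2 because 1 and 2 are the letters of the input bits.\<close>

locale stacks =
  fixes K N :: nat
  assumes K_pos: "K > 0" and N_ge: "N \<ge> 2"
begin

text \<open>The blank is never pushed, since a blank top has to mean an empty stack. Only branches
  up to \<open>N\<close> are constrained, which keeps the control finite although branches are given
  by a function on all numbers.\<close>

primrec wf_com :: "com \<Rightarrow> bool" where
  "wf_com (Push k a) \<longleftrightarrow> k < K \<and> 1 \<le> a \<and> a \<le> N"
| "wf_com (Put k a) \<longleftrightarrow> k < K \<and> 1 \<le> a \<and> a \<le> N"
| "wf_com (Pop k) \<longleftrightarrow> k < K"
| "wf_com (Seq c d) \<longleftrightarrow> wf_com c \<and> wf_com d"
| "wf_com (Switch k f) \<longleftrightarrow> k < K \<and> (\<forall>a\<le>N. wf_com (f a))"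
| "wf_com (While k A c) \<longleftrightarrow> k < K \<and> wf_com c"

text \<open>The number counts machine steps exactly, a \<open>Push\<close> taking two. With
  \<open>min N\<close> the chosen branch is always one that \<open>wf_com\<close> and
  \<open>conts\<close> cover.\<close>

inductive run :: "com \<Rightarrow> store \<Rightarrow> nat \<Rightarrow> store \<Rightarrow> bool" where
  run_Push: "run (Push k a) s 2 (s(k := a # s k))"
| run_Pop: "run (Pop k) s 1 (s(k := tl (s k)))"
| run_Seq: "run c s m t \<Longrightarrow> run d t n u \<Longrightarrow> run (Seq c d) s (Suc (m + n)) u"
| run_Switch: "run (f (min N (peek (s k)))) s n t \<Longrightarrow> run (Switch k f) s (Suc n) t"
| run_WhileF: "peek (s k) \<notin> A \<Longrightarrow> run (While k A c) s 1 s"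
| run_WhileT: "peek (s k) \<in> A \<Longrightarrow> run c s m t \<Longrightarrow> run (While k A c) t n u \<Longrightarrow>
    run (While k A c) s (Suc (m + n)) u"

text \<open>The control states of the machine for a program are its continuations.\<close>

fun nxt :: "nat list \<Rightarrow> com list \<Rightarrow> com list" where
  "nxt as [] = []"
| "nxt as (Push k a # l) = Put k a # l"
| "nxt as (Put k a # l) = l"
| "nxt as (Pop k # l) = l"
| "nxt as (Seq c d # l) = c # d # l"
| "nxt as (Switch k f # l) = f (min N (as ! k)) # l"
| "nxt as (While k A c # l) = (if as ! k \<in> A then c # While k A c # l else l)"

fun com_act :: "com \<Rightarrow> nat \<Rightarrow> nat \<Rightarrow> nat \<times> move" where
  "com_act (Push k a) i b = (b, if i = k then MLeft else MStay)"
| "com_act (Put k a) i b = (if i = k then a else b, MStay)"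
| "com_act (Pop k) i b = (if i = k then (0, MRight) else (b, MStay))"
| "com_act _ i b = (b, MStay)"

definition acts :: "nat list \<Rightarrow> com list \<Rightarrow> (nat \<times> move) list" where
  "acts as l = map (\<lambda>i. com_act (hd l) i (as ! i)) [0..<K]"

definition cstep :: "com list \<times> tape list \<Rightarrow> com list \<times> tape list" where
  "cstep = (\<lambda>(l, ts). if l = [] then (l, ts)
     else let as = map (\<lambda>t. t 0) ts in (nxt as l, map2 act (acts as l) ts))"

definition store_tapes :: "store \<Rightarrow> tape list" where
  "store_tapes s = map (\<lambda>k. stack_tape (s k)) [0..<K]"

lemma length_store_tapes [simp]: "length (store_tapes s) = K"
  by (simp add: store_tapes_def)

lemma heads_store_tapes: "map (\<lambda>t. t 0) (store_tapes s) = map (\<lambda>k. peek (s k)) [0..<K]"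
  by (simp add: store_tapes_def)

lemma map2_acts:
  assumes "\<And>i. i < K \<Longrightarrow> act (com_act (hd l) i ((ts ! i) 0)) (ts ! i) = us ! i"
    and "length ts = K" "length us = K"
  shows "map2 act (acts (map (\<lambda>t. t 0) ts) l) ts = us"
  using assms by (auto simp: acts_def intro!: nth_equalityI)

lemma cstep_idle:
  assumes "length ts = K" "l \<noteq> []" "\<And>i b. com_act (hd l) i b = (b, MStay)"
  shows "cstep (l, ts) = (nxt (map (\<lambda>t. t 0) ts) l, ts)"
  using assms by (simp add: cstep_def Let_def map2_acts)

lemma cstep_Pop:
  assumes "k < K"
  shows "cstep (Pop k # l, store_tapes s) = (l, store_tapes (s(k := tl (s k))))"
proof -
  have "map2 act (acts (map (\<lambda>t. t 0) (store_tapes s)) (Pop k # l)) (store_tapes s)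
      = store_tapes (s(k := tl (s k)))"
    by (rule map2_acts) (auto simp: store_tapes_def act_pop)
  then show ?thesis by (simp add: cstep_def Let_def)
qed

lemma cstep_Push:
  assumes "k < K"
  shows "cstep (cstep (Push k a # l, store_tapes s)) = (l, store_tapes (s(k := a # s k)))"
proof -
  define ts where "ts = (store_tapes s)[k := act (peek (s k), MLeft) (stack_tape (s k))]"
  have 1: "map2 act (acts (map (\<lambda>t. t 0) (store_tapes s)) (Push k a # l)) (store_tapes s) = ts"
    by (rule map2_acts)
      (use assms in \<open>auto simp: store_tapes_def ts_def nth_list_update\<close>)
  have 2: "map2 act (acts (map (\<lambda>t. t 0) ts) (Put k a # l)) ts = store_tapes (s(k := a # s k))"
    by (rule map2_acts)
      (use assms in \<open>auto simp: store_tapes_def ts_def nth_list_update act_push\<close>)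
  show ?thesis
    using 1 2 by (simp add: cstep_def Let_def)
qed

text \<open>The continuation \<open>l\<close> is arbitrary because a body is executed in front of
  what remains of its sequence or loop.\<close>

lemma run_cstep:
  assumes "run c s n t" "wf_com c"
  shows "(cstep ^^ n) (c # l, store_tapes s) = (l, store_tapes t)"
  using assms
proof (induction arbitrary: l rule: run.induct)
  case (run_Push k a s)
  then show ?case by (simp add: numeral_2_eq_2 cstep_Push fun_upd_def)
next
  case (run_Pop k s)
  then show ?case by (simp add: cstep_Pop fun_upd_def)
next
  case (run_Seq c s m t d n u)
  have "(cstep ^^ Suc (m + n)) (Seq c d # l, store_tapes s)
      = (cstep ^^ n) ((cstep ^^ m) (c # d # l, store_tapes s))"
    by (subst add.commute) (simp add: cstep_idle funpow_add funpow_swap1)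
  with run_Seq show ?case by simp
next
  case (run_Switch f s k n t)
  then have "cstep (Switch k f # l, store_tapes s) = (f (min N (peek (s k))) # l, store_tapes s)"
    by (simp add: cstep_idle heads_store_tapes)
  with run_Switch show ?case by (simp add: funpow_swap1)
next
  case (run_WhileF s k A c)
  then show ?case by (simp add: cstep_idle heads_store_tapes)
next
  case (run_WhileT s k A c m t n u)
  then have "cstep (While k A c # l, store_tapes s) = (c # While k A c # l, store_tapes s)"
    by (simp add: cstep_idle heads_store_tapes)
  then have "(cstep ^^ Suc (m + n)) (While k A c # l, store_tapes s)
      = (cstep ^^ n) ((cstep ^^ m) (c # While k A c # l, store_tapes s))"
    by (subst add.commute) (simp add: funpow_add funpow_swap1)
  with run_WhileT show ?case by simp
qed

section \<open>Finiteness of the control: the continuations of a program\<close>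

primrec conts :: "com \<Rightarrow> com list set" where
  "conts (Push k a) = {[Push k a], [Put k a]}"
| "conts (Put k a) = {[Put k a]}"
| "conts (Pop k) = {[Pop k]}"
| "conts (Seq c d) = {[Seq c d]} \<union> (\<lambda>l. l @ [d]) ` conts c \<union> conts d"
| "conts (Switch k f) = {[Switch k f]} \<union> (\<Union>a\<in>{..N}. conts (f a))"
| "conts (While k A c) = {[While k A c]} \<union> (\<lambda>l. l @ [While k A c]) ` conts c"

lemma finite_conts: "finite (conts c)"
  by (induction c) auto

lemma conts_start: "[c] \<in> conts c"
  by (cases c) auto

lemma Nil_notin_conts: "[] \<notin> conts c"
  by (induction c) auto

lemma nxt_append: "l \<noteq> [] \<Longrightarrow> nxt as (l @ ks) = nxt as l @ ks"
  by (cases "(as, l)" rule: nxt.cases) auto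

text \<open>A continuation of a compound program is one of a part, followed by what remains of the
  compound; when the part is used up, \<open>[d]\<close> or the loop itself is left, which
  \<open>conts_start\<close> puts into the set.\<close>

lemma nxt_conts: "l \<in> conts c \<Longrightarrow> nxt as l \<in> insert [] (conts c)"
proof (induction c arbitrary: l)
  case (Seq c d)
  consider "l = [Seq c d]" | m where "m \<in> conts c" "l = m @ [d]" | "l \<in> conts d"
    using Seq.prems by auto
  then show ?case
  proof cases
    case 1
    then show ?thesis using conts_start[of c] by auto
  next
    case (2 m)
    then have "m \<noteq> []" using Nil_notin_conts by metis
    with 2 Seq.IH(1)[of m] show ?thesis using conts_start[of d] by (auto simp: nxt_append)
  next
    case 3
    then show ?thesis using Seq.IH(2) by auto
  qed
next
  case (Switch k f)
  show ?case
  proof (cases "l = [Switch k f]")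
    case True
    then have "nxt as l \<in> conts (f (min N (as ! k)))"
      using conts_start by simp
    then show ?thesis by (auto intro!: bexI[of _ "min N (as ! k)"])
  next
    case False
    then obtain a where "a \<le> N" "l \<in> conts (f a)" using Switch.prems by auto
    then show ?thesis using Switch.IH[of "f a" l] by auto
  qed
next
  case (While k A c)
  show ?case
  proof (cases "l = [While k A c]")
    case True
    then show ?thesis using conts_start[of c] by auto
  next
    case False
    then obtain m where m: "m \<in> conts c" "l = m @ [While k A c]" using While.prems by auto
    then have "m \<noteq> []" using Nil_notin_conts by metis
    with m While.IH[of m] show ?thesis by (auto simp: nxt_append)
  qed
qed auto

lemma conts_wf: "wf_com c \<Longrightarrow> l \<in> conts c \<Longrightarrow> d \<in> set l \<Longrightarrow> wf_com d"
proof (induction c arbitrary: l)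
  case (Seq c1 c2)
  consider "l = [Seq c1 c2]" | m where "m \<in> conts c1" "l = m @ [c2]" | "l \<in> conts c2"
    using Seq.prems by auto
  then show ?case
    using Seq by cases auto
next
  case (Switch k f)
  then consider "l = [Switch k f]" | a where "a \<le> N" "l \<in> conts (f a)"
    by auto
  then show ?case
    using Switch by cases auto
next
  case (While k A c)
  then consider "l = [While k A c]" | m where "m \<in> conts c" "l = m @ [While k A c]"
    by auto
  then show ?case
    using While by cases auto
qed auto

lemma com_act_symbols:
  "wf_com c \<Longrightarrow> b \<le> N \<Longrightarrow> fst (com_act c i b) \<le> N"
  by (cases c) auto

text \<open>Any numbering \<open>g\<close> of the finitely many continuations will do. The branch
  for \<open>l = []\<close> gives legal actions in the halting state as well, because
  \<open>turing_machine\<close> constrains \<open>delta\<close> in every state.\<close>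

definition com_tm :: "(com list \<Rightarrow> nat) \<Rightarrow> com \<Rightarrow> tm" where
  "com_tm g c = \<lparr>tapes = K, symbols = {..N}, states = g ` insert [] (conts c),
     start = g [c], halt = g [],
     delta = (\<lambda>q as. let l = the_inv_into (insert [] (conts c)) g q in
       (g (nxt as l), if l = [] then map (\<lambda>a. (a, MStay)) as else acts as l))\<rparr>"

lemma com_tm_wf:
  assumes g: "inj_on g (insert [] (conts c))" and c: "wf_com c"
  shows "turing_machine (com_tm g c)"
proof -
  have *: "nxt as l \<in> insert [] (conts c)"
      "length as = K \<Longrightarrow> length (if l = [] then map (\<lambda>a. (a, MStay)) as else acts as l) = K"
      "length as = K \<Longrightarrow> set as \<subseteq> {..N} \<Longrightarrow>
       fst ` set (if l = [] then map (\<lambda>a. (a, MStay)) as else acts as l) \<subseteq> {..N}"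
    if l: "l \<in> insert [] (conts c)" for l as
  proof -
    show "nxt as l \<in> insert [] (conts c)"
      using l nxt_conts[of l c as] by auto
    show "length (if l = [] then map (\<lambda>a. (a, MStay)) as else acts as l) = K" if "length as = K"
      using that by (auto simp: acts_def)
    show "fst ` set (if l = [] then map (\<lambda>a. (a, MStay)) as else acts as l) \<subseteq> {..N}"
      if "length as = K" "set as \<subseteq> {..N}"
    proof (cases "l = []")
      case True
      then show ?thesis using that by auto
    next
      case False
      then have "l \<in> conts c" using l by auto
      then have "wf_com (hd l)" using conts_wf[OF c] False by (meson hd_in_set)
      moreover have "as ! i \<le> N" if "i < K" for i
        using that \<open>length as = K\<close> \<open>set as \<subseteq> {..N}\<close> nth_mem[of i as] by blast
      ultimately show ?thesis using False by (auto simp: acts_def intro!: com_act_symbols)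
    qed
  qed
  have D: "case delta (com_tm g c) q as of (q', bs) \<Rightarrow> q' \<in> states (com_tm g c) \<and>
      length bs = tapes (com_tm g c) \<and> fst ` set bs \<subseteq> symbols (com_tm g c)"
    if "q \<in> states (com_tm g c)" "length as = tapes (com_tm g c)" "set as \<subseteq> symbols (com_tm g c)"
    for q as
  proof -
    have "q \<in> g ` insert [] (conts c)"
      using that(1) by (simp only: com_tm_def tm.simps)
    then obtain l where l: "l \<in> insert [] (conts c)" "q = g l" by blast
    have as: "length as = K" "set as \<subseteq> {..N}"
      using that(2,3) by (simp_all add: com_tm_def)
    have "g (nxt as l) \<in> g ` insert [] (conts c)"
      by (rule imageI) (rule *(1)[OF l(1)])
    with *(2)[OF l(1) as(1)] *(3)[OF l(1) as] show ?thesis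
      unfolding com_tm_def l(2)
      by (simp only: tm.simps Let_def the_inv_into_f_f[OF g l(1)] prod.case)
  qed
  have "tapes (com_tm g c) \<ge> 1" "finite (symbols (com_tm g c))"
      "{0, 1, 2} \<subseteq> symbols (com_tm g c)" "finite (states (com_tm g c))"
      "start (com_tm g c) \<in> states (com_tm g c)" "halt (com_tm g c) \<in> states (com_tm g c)"
    using K_pos N_ge conts_start[of c] finite_conts[of c] by (auto simp: com_tm_def)
  then show ?thesis
    unfolding turing_machine_def using D by (intro conjI ballI allI impI; (elim conjE)?)
qed

lemma com_tm_step:
  assumes g: "inj_on g (insert [] (conts c))" and l: "l \<in> insert [] (conts c)"
  shows "step (com_tm g c) (g l, ts) = map_prod g id (cstep (l, ts))"
    and "fst (cstep (l, ts)) \<in> insert [] (conts c)"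
proof -
  have "g l = g [] \<longleftrightarrow> l = []"
    using g l by (auto simp: inj_on_def)
  then show "step (com_tm g c) (g l, ts) = map_prod g id (cstep (l, ts))"
    by (auto simp: step_def com_tm_def cstep_def Let_def the_inv_into_f_f[OF g l])
  show "fst (cstep (l, ts)) \<in> insert [] (conts c)"
    using l nxt_conts[of l c] by (auto simp: cstep_def Let_def)
qed

lemma com_tm_steps:
  assumes g: "inj_on g (insert [] (conts c))" and l: "l \<in> insert [] (conts c)"
  shows "(step (com_tm g c) ^^ n) (g l, ts) = map_prod g id ((cstep ^^ n) (l, ts)) \<and>
    fst ((cstep ^^ n) (l, ts)) \<in> insert [] (conts c)"
proof (induction n)
  case (Suc n)
  obtain l' ts' where *: "(cstep ^^ n) (l, ts) = (l', ts')" by fastforce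
  with Suc have "l' \<in> insert [] (conts c)" by simp
  with Suc * com_tm_step[OF g this, of ts'] show ?case by (simp add: id_def)
qed (use l in auto)

section \<open>Polynomial time for transformers of stores\<close>

definition valid :: "store \<Rightarrow> bool" where
  "valid s \<longleftrightarrow> (\<forall>k. set (s k) \<subseteq> {1..N})"

definition store_size :: "store \<Rightarrow> nat" where
  "store_size s = (\<Sum>k<K. length (s k))"

text \<open>The bound refers to the size of the whole store, so that it applies to the intermediate
  stores of a composition and not only to inputs.\<close>

definition ptime :: "(store \<Rightarrow> store) \<Rightarrow> bool" where
  "ptime f \<longleftrightarrow> (\<exists>c p. wf_com c \<and>
     (\<forall>s. valid s \<longrightarrow> (\<exists>n \<le> poly p (store_size s). run c s n (f s))))"

end

definition bit_letter :: "bool \<Rightarrow> nat" where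
  "bit_letter b = (if b then 2 else 1)"

definition word_store :: "bool list \<Rightarrow> store" where
  "word_store w = (\<lambda>_. [])(0 := map bit_letter w)"

lemma stack_tape_bits: "stack_tape (map bit_letter w) = word_tape w"
  by (auto simp: stack_tape_def word_tape_def bit_letter_def fun_eq_iff)

context stacks
begin

lemma store_tapes_word_store: "store_tapes (word_store w) = word_tape w # replicate (K - 1) blank_tape"
proof -
  have "[0..<K] = 0 # map Suc [0..<K - 1]"
    using K_pos upt_conv_Cons[of 0 K] by (simp add: map_Suc_upt)
  then show ?thesis
    by (simp add: store_tapes_def word_store_def stack_tape_bits stack_tape_Nil map_replicate_const o_def)
qed

lemma store_size_word_store [simp]: "store_size (word_store w) = length w"
proof -
  have "store_size (word_store w) = (\<Sum>k<K. if k = 0 then length w else 0)"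
    unfolding store_size_def by (rule sum.cong) (auto simp: word_store_def)
  then show ?thesis using K_pos by simp
qed

lemma valid_word_store [simp]: "valid (word_store w)"
  using N_ge by (auto simp: valid_def word_store_def bit_letter_def)

text \<open>The machine starts on the tapes of \<open>word_store w\<close> and halts on those of its
  image; only stack 0 of the image is prescribed, as \<open>computes_within\<close> leaves the other
  tapes free.\<close>

lemma ptime_polytime:
  assumes "ptime F" and F: "\<And>w. F (word_store w) 0 = map bit_letter (f w)"
  shows "polytime f"
proof -
  from assms(1) obtain c p where c: "wf_com c"
    and run: "\<And>s. valid s \<Longrightarrow> \<exists>n \<le> poly p (store_size s). run c s n (F s)"
    unfolding ptime_def by blast
  obtain g :: "com list \<Rightarrow> nat" where g: "inj_on g (insert [] (conts c))"
    using finite_imp_inj_to_nat_seg finite_conts by (metis finite_insert)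
  have "computes_within (com_tm g c) (poly p (length w)) w (f w)" for w
  proof -
    obtain n where n: "n \<le> poly p (length w)" "run c (word_store w) n (F (word_store w))"
      using run[of "word_store w"] by auto
    have "init_config (com_tm g c) w = (g [c], store_tapes (word_store w))"
      by (simp add: init_config_def com_tm_def store_tapes_word_store)
    then have "(step (com_tm g c) ^^ n) (init_config (com_tm g c) w)
        = (g [], store_tapes (F (word_store w)))"
      using com_tm_steps[OF g, of "[c]" n] conts_start[of c] run_cstep[OF n(2) c, of "[]"] by simp
    moreover have "hd (store_tapes (F (word_store w))) = word_tape (f w)"
      using K_pos by (simp add: store_tapes_def hd_map F stack_tape_bits)
    ultimately show ?thesis
      using n(1) by (auto simp: computes_within_def com_tm_def)
  qed
  with com_tm_wf[OF g c] show ?thesis unfolding polytime_def by blast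
qed

end

section \<open>Closure properties of polynomial-time transformers\<close>

lemma poly_nat_mono: "x \<le> y \<Longrightarrow> poly p x \<le> poly p y" for p :: "nat poly"
  by (induction p) (auto intro!: add_mono mult_mono)

lemma peek_eq_0 [simp]: "0 \<notin> set xs \<Longrightarrow> peek xs = 0 \<longleftrightarrow> xs = []"
  by (cases xs) auto

context stacks
begin

lemma valid_upd: "valid s \<Longrightarrow> set x \<subseteq> {1..N} \<Longrightarrow> valid (s(k := x))"
  by (auto simp: valid_def)

lemma valid_letters: "valid s \<Longrightarrow> a \<in> set (s k) \<Longrightarrow> 1 \<le> a \<and> a \<le> N"
  unfolding valid_def by (metis atLeastAtMost_iff subsetD)

lemma valid_peek: "valid s \<Longrightarrow> peek (s k) \<le> N"
  by (cases "s k") (auto dest: valid_letters[of s _ k])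

lemma valid_peek_eq_0: "valid s \<Longrightarrow> peek (s k) = 0 \<longleftrightarrow> s k = []"
  using valid_letters[of s 0 k] by (intro peek_eq_0) auto

lemma store_size_upd:
  assumes "k < K"
  shows "store_size (s(k := x)) + length (s k) = store_size s + length x"
proof -
  have "store_size t = length (t k) + (\<Sum>i\<in>{..<K} - {k}. length (t i))" for t
    unfolding store_size_def using assms by (intro sum.remove) auto
  from this[of s] this[of "s(k := x)"] show ?thesis by simp
qed

lemma length_le_store_size: "k < K \<Longrightarrow> length (s k) \<le> store_size s"
  unfolding store_size_def by (rule member_le_sum) auto

lemma run_valid: "run c s n t \<Longrightarrow> wf_com c \<Longrightarrow> valid s \<Longrightarrow> valid t"
proof (induction rule: run.induct)
  case (run_Pop k s)
  then show ?case by (auto simp: valid_def dest: list.set_sel(2)[rotated])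
     (metis atLeastAtMost_iff list.set_sel(2) subsetD tl_Nil)+
qed (auto simp: valid_def)

text \<open>A step adds at most one letter, so every time bound is also a bound on growth.\<close>

lemma run_size: "run c s n t \<Longrightarrow> wf_com c \<Longrightarrow> store_size t \<le> store_size s + n"
proof (induction rule: run.induct)
  case (run_Push k a s)
  then show ?case using store_size_upd[of k s "a # s k"] by (simp add: fun_upd_def)
next
  case (run_Pop k s)
  then show ?case using store_size_upd[of k s "tl (s k)"] by (simp add: fun_upd_def)
qed auto

lemma ptimeE:
  assumes "ptime f"
  obtains c p where "wf_com c"
    "\<And>s. valid s \<Longrightarrow> \<exists>n \<le> poly p (store_size s). run c s n (f s)"
    "\<And>s. valid s \<Longrightarrow> store_size (f s) \<le> store_size s + poly p (store_size s)"
proof -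
  from assms obtain c p where *: "wf_com c"
    "\<And>s. valid s \<Longrightarrow> \<exists>n \<le> poly p (store_size s). run c s n (f s)"
    unfolding ptime_def by blast
  have "store_size (f s) \<le> store_size s + poly p (store_size s)" if "valid s" for s
    using *(2)[OF that] run_size[OF _ *(1), of s] by (meson add_left_mono le_trans)
  with * that show thesis by blast
qed

lemma ptime_valid: "ptime f \<Longrightarrow> valid s \<Longrightarrow> valid (f s)"
  unfolding ptime_def using run_valid by blast

lemma ptime_cong: "ptime f \<Longrightarrow> (\<And>s. valid s \<Longrightarrow> f s = g s) \<Longrightarrow> ptime g"
  unfolding ptime_def by metis

lemma ptime_push: "k < K \<Longrightarrow> 1 \<le> a \<Longrightarrow> a \<le> N \<Longrightarrow> ptime (\<lambda>s. s(k := a # s k))"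
  unfolding ptime_def
  by (rule exI[of _ "Push k a"], rule exI[of _ "[:2:]"]) (auto intro: run_Push)

lemma ptime_pop: "k < K \<Longrightarrow> ptime (\<lambda>s. s(k := tl (s k)))"
  unfolding ptime_def
  by (rule exI[of _ "Pop k"], rule exI[of _ "[:1:]"]) (auto intro: run_Pop[unfolded One_nat_def])

lemma ptime_id: "ptime (\<lambda>s. s)"
  unfolding ptime_def
  by (rule exI[of _ "While 0 {} (Pop 0)"], rule exI[of _ "[:1:]"])
    (use K_pos in \<open>auto intro: run_WhileF[unfolded One_nat_def]\<close>)

lemma ptime_comp:
  assumes "ptime f" "ptime g"
  shows "ptime (\<lambda>s. g (f s))"
proof -
  obtain c p where f: "wf_com c"
    "\<And>s. valid s \<Longrightarrow> \<exists>n \<le> poly p (store_size s). run c s n (f s)"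
    "\<And>s. valid s \<Longrightarrow> store_size (f s) \<le> store_size s + poly p (store_size s)"
    using ptimeE[OF assms(1)] by metis
  obtain d q where g: "wf_com d"
    "\<And>s. valid s \<Longrightarrow> \<exists>n \<le> poly q (store_size s). run d s n (g s)"
    using ptimeE[OF assms(2)] by metis
  \<comment> \<open>The second program starts on a store of size at most x + p(x); the 1 pays for
    the step that unfolds \<open>Seq\<close>.\<close>
  define r where "r = 1 + p + pcompose q ([:0, 1:] + p)"
  have "\<exists>n \<le> poly r (store_size s). run (Seq c d) s n (g (f s))" if s: "valid s" for s
  proof -
    obtain m where m: "m \<le> poly p (store_size s)" "run c s m (f s)"
      using f(2)[OF s] by blast
    obtain n where n: "n \<le> poly q (store_size (f s))" "run d (f s) n (g (f s))"
      using g(2) ptime_valid[OF assms(1) s] by blast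
    have "n \<le> poly q (store_size s + poly p (store_size s))"
      using n(1) poly_nat_mono[OF f(3)[OF s]] by (rule le_trans)
    with m(1) have "Suc (m + n) \<le> poly r (store_size s)"
      by (simp add: r_def poly_pcompose)
    with run_Seq[OF m(2) n(2)] show ?thesis by blast
  qed
  with f(1) g(1) show ?thesis unfolding ptime_def
    by (intro exI[of _ "Seq c d"] exI[of _ r]) auto
qed

lemma ptime_switch:
  assumes "k < K" and f: "\<And>a. a \<le> N \<Longrightarrow> ptime (f a)"
  shows "ptime (\<lambda>s. f (peek (s k)) s)"
proof -
  have "\<forall>a\<in>{..N}. \<exists>c p. wf_com c \<and> (\<forall>s. valid s \<longrightarrow> (\<exists>n \<le> poly p (store_size s). run c s n (f a s)))"
    using f unfolding ptime_def by auto
  then obtain c p where *: "\<And>a. a \<le> N \<Longrightarrow> wf_com (c a)"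
    "\<And>a s. a \<le> N \<Longrightarrow> valid s \<Longrightarrow> \<exists>n \<le> poly (p a) (store_size s). run (c a) s n (f a s)"
    by (metis atMost_iff)
  define q where "q = 1 + (\<Sum>a\<le>N. p a)"
  have "\<exists>n \<le> poly q (store_size s). run (Switch k c) s n (f (peek (s k)) s)" if s: "valid s" for s
  proof -
    define a where "a = peek (s k)"
    have a: "a \<le> N" using valid_peek[OF s] by (simp add: a_def)
    obtain n where n: "n \<le> poly (p a) (store_size s)" "run (c a) s n (f a s)"
      using *(2)[OF a s] by blast
    have "poly (p a) (store_size s) \<le> (\<Sum>a\<le>N. poly (p a) (store_size s))"
      using a by (intro member_le_sum) auto
    with n(1) have "Suc n \<le> poly q (store_size s)" by (simp add: q_def poly_sum)
    moreover have "run (Switch k c) s (Suc n) (f (peek (s k)) s)"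
      using n(2) a by (intro run_Switch) (simp add: a_def)
    ultimately show ?thesis by blast
  qed
  with * assms(1) show ?thesis unfolding ptime_def
    by (intro exI[of _ "Switch k c"] exI[of _ q]) auto
qed

lemma ptime_if:
  assumes "k < K" "ptime f" "ptime g"
  shows "ptime (\<lambda>s. if peek (s k) \<in> A then f s else g s)"
proof (rule ptime_switch[where f = "\<lambda>a s. if a \<in> A then f s else g s"])
  show "ptime (\<lambda>s. if a \<in> A then f s else g s)" for a
    using assms by (cases "a \<in> A") auto
qed fact

text \<open>Polynomial time per pass and polynomially many passes do not suffice: a body that
  doubles its store would reach exponential size. Hence \<open>size\<close> bounds every store met
  on the way in terms of the initial one, through the invariant \<open>I\<close>. The result is
  given by a function \<open>g\<close> that is constant along the loop and the identity at its
  exit.\<close>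

lemma ptime_while:
  assumes f: "ptime f" and k: "k < K"
    and start: "\<And>s. valid s \<Longrightarrow> I s s"
    and step: "\<And>s0 s. I s0 s \<Longrightarrow> valid s \<Longrightarrow> peek (s k) \<in> A \<Longrightarrow>
      I s0 (f s) \<and> \<mu> (f s) < \<mu> s \<and> g (f s) = g s"
    and exit: "\<And>s. valid s \<Longrightarrow> peek (s k) \<notin> A \<Longrightarrow> g s = s"
    and size: "\<And>s0 s. valid s0 \<Longrightarrow> valid s \<Longrightarrow> I s0 s \<Longrightarrow> store_size s \<le> poly q (store_size s0)"
    and measure: "\<And>s. \<mu> s \<le> poly r (store_size s)"
  shows "ptime g"
proof -
  obtain c p where c: "wf_com c"
    "\<And>s. valid s \<Longrightarrow> \<exists>n \<le> poly p (store_size s). run c s n (f s)"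
    using ptimeE[OF f] by metis
  have loop: "\<exists>n \<le> 1 + \<mu> s * (1 + poly p (poly q (store_size s0))). run (While k A c) s n (g s)"
    if "valid s0" "valid s" "I s0 s" for s s0
    using that(2,3)
  proof (induction "\<mu> s" arbitrary: s rule: less_induct)
    case less
    show ?case
    proof (cases "peek (s k) \<in> A")
      case False
      then have "run (While k A c) s 1 (g s)"
        using exit[OF less.prems(1)] by (simp add: run_WhileF[unfolded One_nat_def])
      then show ?thesis by (intro exI[of _ 1]) auto
    next
      case True
      note st = step[OF less.prems(2,1) True]
      obtain m where m: "m \<le> poly p (store_size s)" "run c s m (f s)"
        using c(2)[OF less.prems(1)] by blast
      obtain n where n: "n \<le> 1 + \<mu> (f s) * (1 + poly p (poly q (store_size s0)))"
          "run (While k A c) (f s) n (g (f s))"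
        using less.hyps[of "f s"] st ptime_valid[OF f less.prems(1)] by blast
      have "m \<le> poly p (poly q (store_size s0))"
        using m(1) poly_nat_mono[OF size[OF that(1) less.prems]] by (rule le_trans)
      with n(1) have "Suc (m + n) \<le> 1 + (1 + \<mu> (f s)) * (1 + poly p (poly q (store_size s0)))"
        by simp
      also have "\<dots> \<le> 1 + \<mu> s * (1 + poly p (poly q (store_size s0)))"
        using st by (intro add_mono mult_mono) auto
      finally show ?thesis
        using run_WhileT[OF True m(2) n(2)] st by auto
    qed
  qed
  define b where "b = 1 + r * (1 + pcompose p q)"
  have "\<exists>n \<le> poly b (store_size s). run (While k A c) s n (g s)" if s: "valid s" for s
  proof -
    obtain n where n: "n \<le> 1 + \<mu> s * (1 + poly p (poly q (store_size s)))" "run (While k A c) s n (g s)"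
      using loop[OF s s start[OF s]] by blast
    have "\<mu> s * (1 + poly p (poly q (store_size s)))
        \<le> poly r (store_size s) * (1 + poly p (poly q (store_size s)))"
      using measure by (rule mult_right_mono) simp
    with n(1) have "n \<le> poly b (store_size s)"
      by (simp add: b_def poly_pcompose)
    with n(2) show ?thesis by blast
  qed
  with c(1) k show ?thesis unfolding ptime_def
    by (intro exI[of _ "While k A c"] exI[of _ b]) auto
qed

text \<open>The letters of stack \<open>k\<close> serve as a unary counter. By \<open>indep\<close>
  the body neither reads nor changes it, so the pop before each pass commutes with the body.\<close>

lemma ptime_for:
  assumes f: "ptime f" and k: "k < K"
    and indep: "\<And>s x. f (s(k := x)) = (f s)(k := x)"
    and size: "\<And>s i. valid s \<Longrightarrow> i \<le> length (s k) \<Longrightarrow>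
      store_size ((f ^^ i) s) \<le> poly q (store_size s)"
  shows "ptime (\<lambda>s. ((f ^^ length (s k)) s)(k := []))"
proof -
  have indep': "(f ^^ i) (s(k := x)) = ((f ^^ i) s)(k := x)" for i s x
  proof (induction i)
    case (Suc i)
    then show ?case by (simp only: funpow.simps comp_apply indep)
  qed simp
  have keep: "(f ^^ i) s k = s k" for i s
    using fun_cong[OF indep'[of i s "s k"], of k] by simp
  define h where "h = (\<lambda>s. f (s(k := tl (s k))))"
  \<comment> \<open>After \<open>i\<close> passes the counter has lost \<open>i\<close> letters and
    everything else is the \<open>i\<close>-fold iterate.\<close>
  define I where "I s0 s \<longleftrightarrow> (\<exists>i \<le> length (s0 k). s = ((f ^^ i) s0)(k := drop i (s0 k)))" for s0 s
  show ?thesis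
  proof (rule ptime_while[where f = h and k = k and A = "- {0}" and I = I and
        \<mu> = "\<lambda>s. length (s k)" and q = q and r = "[:0, 1:]"])
    show "ptime h"
      unfolding h_def by (rule ptime_comp[OF ptime_pop[OF k] f])
    show "I s s" for s
      by (auto simp: I_def intro!: exI[of _ 0])
    show "I s0 (h s) \<and> length (h s k) < length (s k) \<and>
        ((f ^^ length (h s k)) (h s))(k := []) = ((f ^^ length (s k)) s)(k := [])"
      if I: "I s0 s" and "valid s" and p: "peek (s k) \<in> - {0}" for s0 s
    proof -
      have ne: "s k \<noteq> []" using p by auto
      have h: "h s = (f s)(k := tl (s k))" by (simp add: h_def indep)
      obtain i where i: "i \<le> length (s0 k)" "s = ((f ^^ i) s0)(k := drop i (s0 k))"
        using I unfolding I_def by blast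
      have "i < length (s0 k)" using ne i by auto
      moreover have "h s = ((f ^^ Suc i) s0)(k := drop (Suc i) (s0 k))"
        unfolding h by (simp add: i(2) indep drop_Suc tl_drop)
      ultimately have "I s0 (h s)" unfolding I_def by (intro exI[of _ "Suc i"]) auto
      moreover obtain n where n: "length (s k) = Suc n" using ne by (cases "s k") auto
      then have "((f ^^ length (h s k)) (h s))(k := []) = ((f ^^ length (s k)) s)(k := [])"
        by (simp add: h indep' funpow_swap1 del: funpow.simps)
          (simp add: funpow_swap1)
      ultimately show ?thesis using n by (simp add: h)
    qed
    show "((f ^^ length (s k)) s)(k := []) = s" if "valid s" "peek (s k) \<notin> - {0}" for s
      using that by (auto simp: valid_peek_eq_0)
    show "store_size s \<le> poly q (store_size s0)" if "valid s0" and I: "I s0 s" for s0 s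
    proof -
      obtain i where i: "i \<le> length (s0 k)" "s = ((f ^^ i) s0)(k := drop i (s0 k))"
        using I unfolding I_def by blast
      have "store_size s \<le> store_size ((f ^^ i) s0)"
        using store_size_upd[OF k, of "(f ^^ i) s0" "drop i (s0 k)"] by (simp add: i(2) keep)
      with size[OF that(1) i(1)] show ?thesis by simp
    qed
    show "length (s k) \<le> poly [:0, 1:] (store_size s)" for s
      using length_le_store_size[OF k] by simp
  qed (rule k)
qed

lemma ptime_fold:
  assumes k: "k < K" and A: "0 \<notin> A"
    and f: "\<And>a. 1 \<le> a \<Longrightarrow> a \<le> N \<Longrightarrow> ptime (f a)"
    and indep: "\<And>a s x. f a (s(k := x)) = (f a s)(k := x)"
    and size: "\<And>a s. valid s \<Longrightarrow> 1 \<le> a \<Longrightarrow> a \<le> N \<Longrightarrow> store_size (f a s) \<le> store_size s + c"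
  shows "ptime (\<lambda>s. fold f (takeWhile (\<lambda>a. a \<in> A) (s k)) (s(k := dropWhile (\<lambda>a. a \<in> A) (s k))))"
proof -
  have keep: "f a s k = s k" for a s
    using fun_cong[OF indep[of a s "s k"], of k] by simp
  define h where "h = (\<lambda>s. (if peek (s k) = 0 then s else f (peek (s k)) (s(k := tl (s k)))))"
  \<comment> \<open>Every letter still on stack \<open>k\<close> carries a credit of
    \<open>c\<close>, which pays for the growth in its pass; the sum of size and credits never
    increases, which gives a linear bound.\<close>
  show ?thesis
  proof (rule ptime_while[where f = h and k = k and A = A and \<mu> = "\<lambda>s. length (s k)" and
        I = "\<lambda>s0 s. store_size s + c * length (s k) \<le> store_size s0 + c * length (s0 k)" and
        q = "[:0, 1 + c:]" and r = "[:0, 1:]"])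
    show "ptime h"
      unfolding h_def
    proof (rule ptime_switch[where f = "\<lambda>a s. if a = 0 then s else f a (s(k := tl (s k)))"])
      show "ptime (\<lambda>s. if a = 0 then s else f a (s(k := tl (s k))))" if "a \<le> N" for a
        using that ptime_id ptime_comp[OF ptime_pop[OF k] f[of a]] by (cases "a = 0") auto
    qed (rule k)
    show "store_size (h s) + c * length (h s k) \<le> store_size s0 + c * length (s0 k) \<and>
        length (h s k) < length (s k) \<and>
        fold f (takeWhile (\<lambda>a. a \<in> A) (h s k)) ((h s)(k := dropWhile (\<lambda>a. a \<in> A) (h s k))) =
        fold f (takeWhile (\<lambda>a. a \<in> A) (s k)) (s(k := dropWhile (\<lambda>a. a \<in> A) (s k)))"
      if I: "store_size s + c * length (s k) \<le> store_size s0 + c * length (s0 k)"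
        and s: "valid s" and p: "peek (s k) \<in> A" for s0 s
    proof -
      obtain a x where sk: "s k = a # x" using p A by (cases "s k") auto
      have a: "1 \<le> a" "a \<le> N" using valid_letters[OF s, of a k] sk by auto
      have v: "valid (s(k := x))"
        using s sk by (intro valid_upd) (auto dest: valid_letters[of s _ k])
      have h: "h s = (f a s)(k := x)" using a by (simp add: h_def sk indep)
      have "store_size (h s) \<le> store_size (s(k := x)) + c"
        using size[OF v a] by (simp add: h indep)
      then have "store_size (h s) + 1 \<le> store_size s + c"
        using store_size_upd[OF k, of s x] by (simp add: sk)
      then show ?thesis using I p by (simp add: h sk indep)
    qed
    show "fold f (takeWhile (\<lambda>a. a \<in> A) (s k)) (s(k := dropWhile (\<lambda>a. a \<in> A) (s k))) = s"
      if "peek (s k) \<notin> A" for s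
      using that by (cases "s k") (auto simp: fun_upd_idem_iff)
    show "store_size s \<le> poly [:0, 1 + c:] (store_size s0)"
      if "store_size s + c * length (s k) \<le> store_size s0 + c * length (s0 k)" for s0 s
    proof -
      have "c * length (s0 k) \<le> c * store_size s0"
        using length_le_store_size[OF k, of s0] by (rule mult_le_mono2)
      with that have "store_size s \<le> store_size s0 + c * store_size s0" by linarith
      then show ?thesis by (simp add: mult.commute)
    qed
    show "length (s k) \<le> poly [:0, 1:] (store_size s)" for s
      using length_le_store_size[OF k] by simp
  qed (use k in auto)
qed

lemma ptime_push_list:
  assumes "k < K" "set u \<subseteq> {1..N}"
  shows "ptime (\<lambda>s. s(k := u @ s k))"
  using assms(2)
proof (induction u)
  case Nil
  then show ?case by (simp add: ptime_id)
next
  case (Cons a u)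
  have a: "1 \<le> a" "a \<le> N" and "set u \<subseteq> {1..N}"
    using Cons.prems by auto
  then have "ptime (\<lambda>s. s(k := u @ s k))"
    by (intro Cons.IH)
  from ptime_comp[OF this ptime_push[OF assms(1) a]] show ?case
    by (simp only: append_Cons fun_upd_same fun_upd_upd)
qed

text \<open>The top \<open>n\<close> letters are read into the finite control, one
  \<open>Switch\<close> per letter; there are finitely many words \<open>u\<close>, and one shorter
  than \<open>n\<close> reports that the stack ended.\<close>

lemma ptime_lookahead:
  assumes "k < K" and "\<And>u. length u \<le> n \<Longrightarrow> set u \<subseteq> {1..N} \<Longrightarrow> ptime (f u)"
  shows "ptime (\<lambda>s. f (take n (s k)) (s(k := drop n (s k))))"
  using assms(2)
proof (induction n arbitrary: f)
  case 0
  then show ?case by simp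
next
  case (Suc n)
  define g where "g = (\<lambda>a s. if a = 0 then f [] s
    else f (a # take n (tl (s k))) (s(k := drop n (tl (s k)))))"
  have "ptime (\<lambda>s. g (peek (s k)) s)"
  proof (rule ptime_switch[OF assms(1)])
    fix a assume a: "a \<le> N"
    show "ptime (g a)"
    proof (cases "a = 0")
      case True
      then show ?thesis using Suc.prems[of "[]"] by (simp add: g_def)
    next
      case False
      have "ptime (\<lambda>s. f (a # take n (s k)) (s(k := drop n (s k))))"
        by (rule Suc.IH) (use Suc.prems a False in auto)
      from ptime_comp[OF ptime_pop[OF assms(1)] this] False
      show ?thesis by (simp add: g_def)
    qed
  qed
  then show ?case
  proof (rule ptime_cong)
    fix s assume "valid s"
    then show "g (peek (s k)) s = f (take (Suc n) (s k)) (s(k := drop (Suc n) (s k)))"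
      using valid_peek_eq_0[of s k] by (cases "s k") (auto simp: g_def fun_upd_idem)
  qed
qed

lemma fold_push:
  "j \<noteq> k \<Longrightarrow> fold (\<lambda>a s. s(j := h a @ s j)) u s = s(j := concat (map h (rev u)) @ s j)"
  by (induction u arbitrary: s) auto

text \<open>Letters leave stack \<open>k\<close> from the top and are stacked in turn, which
  reverses their order but not that inside each image \<open>h a\<close>.\<close>

lemma ptime_drain:
  assumes "k < K" "j < K" "j \<noteq> k" "0 \<notin> A" and h: "\<And>a. 1 \<le> a \<Longrightarrow> a \<le> N \<Longrightarrow> set (h a) \<subseteq> {1..N}"
  shows "ptime (\<lambda>s. s(k := dropWhile (\<lambda>a. a \<in> A) (s k),
    j := concat (map h (rev (takeWhile (\<lambda>a. a \<in> A) (s k)))) @ s j))"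
proof -
  define c where "c = (\<Sum>a\<le>N. length (h a))"
  have c: "length (h a) \<le> c" if "a \<le> N" for a
    unfolding c_def using that by (intro member_le_sum) auto
  have "ptime (\<lambda>s. fold (\<lambda>a s. s(j := h a @ s j)) (takeWhile (\<lambda>a. a \<in> A) (s k))
      (s(k := dropWhile (\<lambda>a. a \<in> A) (s k))))"
  proof (rule ptime_fold[where c = c])
    show "store_size (s(j := h a @ s j)) \<le> store_size s + c" if "a \<le> N" for a s
      using store_size_upd[OF assms(2), of s "h a @ s j"] c[OF that] by simp
    show "ptime (\<lambda>s. s(j := h a @ s j))" if "1 \<le> a" "a \<le> N" for a
      using ptime_push_list[OF assms(2) h[OF that]] .
  qed (use assms in \<open>auto simp: fun_upd_twist\<close>)
  then show ?thesis using assms by (simp add: fold_push[of j k] fun_upd_twist)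
qed

lemma concat_map_singleton: "concat (map (\<lambda>a. [a]) u) = u"
  by (induction u) auto

lemma ptime_pour:
  assumes "k < K" "j < K" "j \<noteq> k" "0 \<notin> A"
  shows "ptime (\<lambda>s. s(k := dropWhile (\<lambda>a. a \<in> A) (s k),
    j := rev (takeWhile (\<lambda>a. a \<in> A) (s k)) @ s j))"
  using ptime_drain[OF assms, of "\<lambda>a. [a]"] by (simp add: concat_map_singleton)

lemma valid_takeWhile: "valid s \<Longrightarrow> takeWhile (\<lambda>a. 0 < a) (s k) = s k"
  and valid_dropWhile: "valid s \<Longrightarrow> dropWhile (\<lambda>a. 0 < a) (s k) = []"
  by (auto simp: takeWhile_eq_all_conv dropWhile_eq_Nil_conv dest: valid_letters)

lemma ptime_drain_all:
  assumes "k < K" "j < K" "j \<noteq> k" and h: "\<And>a. 1 \<le> a \<Longrightarrow> a \<le> N \<Longrightarrow> set (h a) \<subseteq> {1..N}"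
  shows "ptime (\<lambda>s. s(k := [], j := concat (map h (rev (s k))) @ s j))"
  by (rule ptime_cong[OF ptime_drain[OF assms(1-3), of "- {0}" h]])
    (use h in \<open>auto simp: valid_takeWhile valid_dropWhile\<close>)

lemma ptime_pour_all:
  assumes "k < K" "j < K" "j \<noteq> k"
  shows "ptime (\<lambda>s. s(k := [], j := rev (s k) @ s j))"
  using ptime_drain_all[OF assms, of "\<lambda>a. [a]"] by (simp add: concat_map_singleton)

lemma ptime_clear:
  assumes "k < K"
  shows "ptime (\<lambda>s. s(k := []))"
proof -
  have "fold (\<lambda>a s. s) u s = s" for u :: "nat list" and s :: store
    by (induction u) auto
  with ptime_fold[OF assms, of "- {0}" "\<lambda>a s. s" 0] ptime_id
  have "ptime (\<lambda>s. s(k := dropWhile (\<lambda>a. a \<in> - {0}) (s k)))" by simp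
  then show ?thesis
    by (rule ptime_cong) (auto simp: valid_dropWhile)
qed

lemma fold_push2:
  "i \<noteq> j \<Longrightarrow> fold (\<lambda>a s. s(i := a # s i, j := a # s j)) u s = s(i := rev u @ s i, j := rev u @ s j)"
  by (induction u arbitrary: s) (auto simp: fun_upd_twist)

text \<open>The copy passes through the scratch stack \<open>t\<close>: the first move reverses the
  letters, the second puts each of them on both stacks in the original order. Clearing
  \<open>t\<close> first keeps its former contents out.\<close>

lemma ptime_copy:
  assumes "i < K" "j < K" "t < K" "i \<noteq> j" "t \<noteq> i" "t \<noteq> j"
  shows "ptime (\<lambda>s. s(t := [], j := s i @ s j))"
proof -
  have pour2: "ptime (\<lambda>s. s(t := [], i := rev (s t) @ s i, j := rev (s t) @ s j))"
  proof -
    have "ptime (\<lambda>s. fold (\<lambda>a s. s(i := a # s i, j := a # s j)) (takeWhile (\<lambda>a. a \<in> - {0}) (s t))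
        (s(t := dropWhile (\<lambda>a. a \<in> - {0}) (s t))))"
    proof (rule ptime_fold[where c = 2])
      show "ptime (\<lambda>s. s(i := a # s i, j := a # s j))" if "1 \<le> a" "a \<le> N" for a
        using ptime_comp[OF ptime_push[OF assms(1) that] ptime_push[OF assms(2) that]] assms by simp
      show "store_size (s(i := a # s i, j := a # s j)) \<le> store_size s + 2" for a s
        using store_size_upd[OF assms(1), of s "a # s i"]
          store_size_upd[OF assms(2), of "s(i := a # s i)" "a # s j"] assms by simp
    qed (use assms in \<open>auto simp: fun_upd_twist\<close>)
    then show ?thesis
      by (rule ptime_cong) (use assms in \<open>auto simp: valid_takeWhile valid_dropWhile fold_push2\<close>)
  qed
  show ?thesis
    by (rule ptime_cong[OF ptime_comp[OF ptime_clear[OF assms(3)]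
      ptime_comp[OF ptime_pour_all[of i t] pour2]]]) (use assms in \<open>auto simp: fun_eq_iff\<close>)
qed

end

section \<open>Composition of polynomial-time functions\<close>

text \<open>\<open>turing_machine\<close> speaks about \<open>delta\<close> on the states and
  symbols of the machine only, so legal actions are guaranteed just in these configurations.\<close>

definition good_config :: "tm \<Rightarrow> nat \<times> tape list \<Rightarrow> bool" where
  "good_config M c \<longleftrightarrow> fst c \<in> states M \<and> length (snd c) = tapes M \<and>
     (\<forall>t \<in> set (snd c). range t \<subseteq> symbols M)"

lemma range_act: "range t \<subseteq> S \<Longrightarrow> fst a \<in> S \<Longrightarrow> range (act a t) \<subseteq> S"
  by (auto simp: act_def)

lemma turing_machine_delta:
  assumes M: "turing_machine M" and q: "q \<in> states M"
    and as: "length as = tapes M" "set as \<subseteq> symbols M"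
    and d: "delta M q as = (q', bs)"
  shows "q' \<in> states M" "length bs = tapes M" "fst ` set bs \<subseteq> symbols M"
proof -
  have "\<forall>q \<in> states M. \<forall>as. length as = tapes M \<and> set as \<subseteq> symbols M \<longrightarrow>
      (case delta M q as of (q', acts) \<Rightarrow>
        q' \<in> states M \<and> length acts = tapes M \<and> fst ` set acts \<subseteq> symbols M)"
    using M unfolding turing_machine_def by (elim conjE)
  from this[rule_format, OF q, of as] as d
  show "q' \<in> states M" "length bs = tapes M" "fst ` set bs \<subseteq> symbols M" by simp_all
qed

lemma good_config_delta:
  assumes M: "turing_machine M" and c: "good_config M (q, ts)"
    and d: "delta M q (map (\<lambda>t. t 0) ts) = (q', bs)"
  shows "q' \<in> states M" "length bs = tapes M" "fst ` set bs \<subseteq> symbols M"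
proof -
  have "set (map (\<lambda>t. t 0) ts) \<subseteq> symbols M" "length (map (\<lambda>t. t 0) ts) = tapes M" "q \<in> states M"
    using c by (auto simp: good_config_def)
  from turing_machine_delta[OF M this(3,2,1) d]
  show "q' \<in> states M" "length bs = tapes M" "fst ` set bs \<subseteq> symbols M" .
qed

lemma good_config_step:
  assumes M: "turing_machine M" and c: "good_config M c"
  shows "good_config M (step M c)"
proof -
  obtain q ts where [simp]: "c = (q, ts)" by fastforce
  obtain q' bs where d: "delta M q (map (\<lambda>t. t 0) ts) = (q', bs)" by fastforce
  have *: "good_config M (q, ts)" using c by simp
  note dl = good_config_delta[OF M * d]
  have "range t \<subseteq> symbols M" if "t \<in> set (map2 act bs ts)" for t
  proof -
    obtain b u where "t = act b u" "b \<in> set bs" "u \<in> set ts"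
      using \<open>t \<in> set (map2 act bs ts)\<close> by (auto dest: set_zip_leftD set_zip_rightD)
    with dl(3) * show ?thesis
      using range_act[of u "symbols M" b] by (auto simp: good_config_def)
  qed
  with dl * show ?thesis by (auto simp: step_def d good_config_def)
qed

lemma good_config_init: "turing_machine M \<Longrightarrow> good_config M (init_config M w)"
  by (auto simp: turing_machine_def good_config_def init_config_def word_tape_def blank_tape_def)

lemma good_config_steps:
  "turing_machine M \<Longrightarrow> good_config M ((step M ^^ n) (init_config M w))"
  by (induction n) (auto intro: good_config_step good_config_init)

section \<open>Length of the output in terms of the running time\<close>

definition nonblanks :: "tape \<Rightarrow> int set" where
  "nonblanks t = {i. t i \<noteq> 0}"

lemma nonblanks_act:
  assumes "finite (nonblanks t)"
  shows "finite (nonblanks (act a t)) \<and> card (nonblanks (act a t)) \<le> Suc (card (nonblanks t))"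
proof -
  have sub: "nonblanks (act a t) \<subseteq> (\<lambda>i. i - offset (snd a)) ` insert 0 (nonblanks t)"
  proof
    fix i assume "i \<in> nonblanks (act a t)"
    then have "i + offset (snd a) \<in> insert 0 (nonblanks t)"
      by (auto simp: nonblanks_def act_def split: if_splits)
    then show "i \<in> (\<lambda>i. i - offset (snd a)) ` insert 0 (nonblanks t)"
      by (intro image_eqI[of _ _ "i + offset (snd a)"]) auto
  qed
  have "card (nonblanks (act a t)) \<le> card (insert 0 (nonblanks t))"
    using surj_card_le[OF _ sub] assms by auto
  then show ?thesis
    using finite_subset[OF sub] assms card_insert_le_m1 by (auto simp: card_insert_if split: if_splits)
qed

lemma nonblanks_word_tape: "nonblanks (word_tape w) = {0..<int (length w)}"
  by (auto simp: nonblanks_def word_tape_def)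

text \<open>Each step fills at most one cell of the first tape. This bounds the word between two
  machines, on which the running time of the second depends.\<close>

lemma output_length:
  assumes M: "turing_machine M"
  shows "finite (nonblanks (hd (snd ((step M ^^ n) (init_config M w))))) \<and>
    card (nonblanks (hd (snd ((step M ^^ n) (init_config M w))))) \<le> length w + n"
proof (induction n)
  case 0
  then show ?case by (simp add: init_config_def nonblanks_word_tape)
next
  case (Suc n)
  obtain q ts where c: "(step M ^^ n) (init_config M w) = (q, ts)" by fastforce
  obtain q' bs where d: "delta M q (map (\<lambda>t. t 0) ts) = (q', bs)" by fastforce
  have good: "good_config M (q, ts)" using good_config_steps[OF M, of n w] c by simp
  then have "length ts \<ge> 1" "length bs = length ts"
    using good_config_delta(2)[OF M good d] M by (auto simp: good_config_def turing_machine_def)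
  then obtain b bs' t ts' where "bs = b # bs'" "ts = t # ts'"
    by (cases bs; cases ts) auto
  then have "hd (snd (step M (q, ts))) \<in> {t, act b t}" "hd ts = t"
    using d by (auto simp: step_def)
  with Suc nonblanks_act[of t b] show ?case by (auto simp: c)
qed

section \<open>Running two machines in succession\<close>

definition stay :: "nat \<Rightarrow> nat \<times> move" where
  "stay a = (a, MStay)"

lemma map2_act_stay [simp]: "map2 act (map (stay \<circ> (\<lambda>t. t 0)) ts) ts = ts"
  by (induction ts) (auto simp: stay_def)

text \<open>Even states are those of the first machine, odd ones those of the second, and the
  halting state of the first leads to the start of the second. The tapes are the shared one, the
  private ones of the first machine, then those of the second. On symbols foreign to the active
  machine the composite stands still, since its actions must be legal on the union of both
  alphabets.\<close>

definition comp_delta :: "tm \<Rightarrow> tm \<Rightarrow> nat \<Rightarrow> nat list \<Rightarrow> nat \<times> (nat \<times> move) list" where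
  "comp_delta M1 M2 q as =
     (if even q then
        (if q div 2 = halt M1 then (2 * start M2 + 1, map stay as)
         else if set (take (tapes M1) as) \<subseteq> symbols M1 then
           (case delta M1 (q div 2) (take (tapes M1) as) of (q', bs) \<Rightarrow>
             (2 * q', bs @ map stay (drop (tapes M1) as)))
         else (q, map stay as))
      else
        (if set (hd as # drop (tapes M1) as) \<subseteq> symbols M2 then
           (case delta M2 (q div 2) (hd as # drop (tapes M1) as) of (q', bs) \<Rightarrow>
             (2 * q' + 1, hd bs # map stay (tl (take (tapes M1) as)) @ tl bs))
         else (q, map stay as)))"

text \<open>The machines share the first tape; the remaining tapes are used by one of them each.\<close>

definition comp_tm :: "tm \<Rightarrow> tm \<Rightarrow> tm" where
  "comp_tm M1 M2 = \<lparr>tapes = tapes M1 + tapes M2 - 1, symbols = symbols M1 \<union> symbols M2,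
     states = (\<lambda>q. 2 * q) ` states M1 \<union> (\<lambda>q. 2 * q + 1) ` states M2,
     start = 2 * start M1, halt = 2 * halt M2 + 1, delta = comp_delta M1 M2\<rparr>"

lemma turing_machine_comp:
  assumes M1: "turing_machine M1" and M2: "turing_machine M2"
  shows "turing_machine (comp_tm M1 M2)"
proof -
  have k: "tapes M1 \<ge> 1" "tapes M2 \<ge> 1"
    using M1 M2 by (auto simp: turing_machine_def)
  have D: "case delta (comp_tm M1 M2) q as of (q', bs) \<Rightarrow> q' \<in> states (comp_tm M1 M2) \<and>
      length bs = tapes (comp_tm M1 M2) \<and> fst ` set bs \<subseteq> symbols (comp_tm M1 M2)"
    if q: "q \<in> states (comp_tm M1 M2)" and l: "length as = tapes (comp_tm M1 M2)"
      and as: "set as \<subseteq> symbols (comp_tm M1 M2)" for q as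
  proof -
    have len: "length as = tapes M1 + tapes M2 - 1" and sy: "set as \<subseteq> symbols M1 \<union> symbols M2"
      using l as by (auto simp: comp_tm_def)
    have stay: "fst ` set (map stay as) \<subseteq> symbols M1 \<union> symbols M2"
      using sy by (auto simp: stay_def)
    consider q1 where "q = 2 * q1" "q1 \<in> states M1" | q2 where "q = 2 * q2 + 1" "q2 \<in> states M2"
      using q by (auto simp: comp_tm_def)
    then show ?thesis
    proof cases
      case (1 q1)
      show ?thesis
      proof (cases "q1 \<noteq> halt M1 \<and> set (take (tapes M1) as) \<subseteq> symbols M1")
        case True
        obtain q' bs where d: "delta M1 q1 (take (tapes M1) as) = (q', bs)" by fastforce
        have "length (take (tapes M1) as) = tapes M1" using len k by simp
        from turing_machine_delta[OF M1 1(2) this _ d] True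
        have "q' \<in> states M1" "length bs = tapes M1" "fst ` set bs \<subseteq> symbols M1" by auto
        with True 1 k len sy show ?thesis
          by (auto simp: comp_tm_def comp_delta_def d stay_def dest: in_set_dropD)
      next
        case False
        with 1 stay len M2 show ?thesis
          by (auto simp: comp_tm_def comp_delta_def turing_machine_def)
      qed
    next
      case (2 q2)
      show ?thesis
      proof (cases "set (hd as # drop (tapes M1) as) \<subseteq> symbols M2")
        case True
        obtain q' bs where d: "delta M2 q2 (hd as # drop (tapes M1) as) = (q', bs)" by fastforce
        have "length (hd as # drop (tapes M1) as) = tapes M2" using len k by simp
        from turing_machine_delta[OF M2 2(2) this _ d] True
        have *: "q' \<in> states M2" "length bs = tapes M2" "fst ` set bs \<subseteq> symbols M2" by auto
        then obtain b bs' where "bs = b # bs'" using k by (cases bs) auto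
        moreover have "set (tl (take (tapes M1) as)) \<subseteq> set as"
          using set_take_subset[of "tapes M1" as] by (cases "take (tapes M1) as") auto
        ultimately show ?thesis
          using True 2 k len sy * by (auto simp: comp_tm_def comp_delta_def d stay_def)
      next
        case False
        with 2 stay len show ?thesis
          by (auto simp: comp_tm_def comp_delta_def)
      qed
    qed
  qed
  have "tapes (comp_tm M1 M2) \<ge> 1" "finite (symbols (comp_tm M1 M2))"
      "{0, 1, 2} \<subseteq> symbols (comp_tm M1 M2)" "finite (states (comp_tm M1 M2))"
      "start (comp_tm M1 M2) \<in> states (comp_tm M1 M2)" "halt (comp_tm M1 M2) \<in> states (comp_tm M1 M2)"
    using M1 M2 by (auto simp: turing_machine_def comp_tm_def)
  then show ?thesis
    unfolding turing_machine_def using D by (intro conjI ballI allI impI; (elim conjE)?)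
qed

lemma comp_step1:
  assumes M1: "turing_machine M1" and good: "good_config M1 (q, ts)" and q: "q \<noteq> halt M1"
  shows "step (comp_tm M1 M2) (2 * q, ts @ us)
    = (case step M1 (q, ts) of (q', ts') \<Rightarrow> (2 * q', ts' @ us))"
proof -
  obtain q' bs where d: "delta M1 q (map (\<lambda>t. t 0) ts) = (q', bs)" by fastforce
  have l: "length ts = tapes M1" "(\<lambda>t. t 0) ` set ts \<subseteq> symbols M1"
    using good by (auto simp: good_config_def)
  have "2 * q \<noteq> 2 * halt M2 + 1" by presburger
  moreover have "length bs = length ts"
    using good_config_delta(2)[OF M1 good d] l(1) by simp
  ultimately show ?thesis
    using l(2) q d by (simp add: step_def comp_tm_def comp_delta_def flip: l(1))
qed

lemma comp_step2:
  assumes M2: "turing_machine M2" and good: "good_config M2 (q, t # us)"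
    and l: "Suc (length ts) = tapes M1"
  shows "step (comp_tm M1 M2) (2 * q + 1, t # ts @ us)
    = (case step M2 (q, t # us) of (q', us') \<Rightarrow> (2 * q' + 1, hd us' # ts @ tl us'))"
proof (cases "q = halt M2")
  case True
  then show ?thesis by (simp add: step_def comp_tm_def)
next
  case False
  obtain q' bs where d: "delta M2 q (map (\<lambda>t. t 0) (t # us)) = (q', bs)" by fastforce
  have sy: "(\<lambda>t. t 0) ` set (t # us) \<subseteq> symbols M2"
    using good unfolding good_config_def by fastforce
  have "length bs = length (t # us)"
    using good_config_delta(2)[OF M2 good d] good by (simp add: good_config_def)
  then obtain b bs' where "bs = b # bs'" by (cases bs) auto
  then show ?thesis
    using False sy d by (simp add: step_def comp_tm_def comp_delta_def flip: l)
qed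

lemma comp_steps2:
  assumes M2: "turing_machine M2" and l: "Suc (length ts) = tapes M1"
  shows "good_config M2 (q, t # us) \<Longrightarrow> (step (comp_tm M1 M2) ^^ n) (2 * q + 1, t # ts @ us)
    = (case (step M2 ^^ n) (q, t # us) of (q', us') \<Rightarrow> (2 * q' + 1, hd us' # ts @ tl us'))"
proof (induction n arbitrary: q t us)
  case (Suc n)
  obtain q' us' where s: "step M2 (q, t # us) = (q', us')" by fastforce
  have good: "good_config M2 (q', us')"
    using good_config_step[OF M2 Suc.prems] s by simp
  then obtain t' vs where [simp]: "us' = t' # vs"
    using M2 by (cases us') (auto simp: good_config_def turing_machine_def)
  show ?case
    using comp_step2[OF M2 Suc.prems l] Suc.IH[of q' t' vs] good
    by (simp add: funpow_swap1 s)
qed simp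

text \<open>A halted machine idles, whereas the composite moves on as soon as the first machine
  halts; the simulation therefore needs the first halting time, at which the configuration is
  already the final one.\<close>

lemma first_halt:
  assumes "fst ((step M ^^ n) c) = halt M"
  obtains m where "m \<le> n" "(step M ^^ m) c = (step M ^^ n) c" "\<And>i. i < m \<Longrightarrow> fst ((step M ^^ i) c) \<noteq> halt M"
proof -
  define m where "m = (LEAST m. fst ((step M ^^ m) c) = halt M)"
  have m: "fst ((step M ^^ m) c) = halt M" and le: "m \<le> n"
    unfolding m_def using assms by (auto intro: LeastI Least_le)
  have "(step M ^^ (i + m)) c = (step M ^^ m) c" for i
    using m by (induction i) (auto simp: step_def split: prod.splits)
  from this[of "n - m"] le have "(step M ^^ m) c = (step M ^^ n) c" by simp
  moreover have "fst ((step M ^^ i) c) \<noteq> halt M" if "i < m" for i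
    using that not_less_Least unfolding m_def by blast
  ultimately show thesis using le that by blast
qed

lemma polytime_comp:
  assumes "polytime f" "polytime g"
  shows "polytime (\<lambda>w. g (f w))"
proof -
  obtain M1 p1 where M1: "turing_machine M1"
    and p1: "\<And>w. computes_within M1 (poly p1 (length w)) w (f w)"
    using assms(1) unfolding polytime_def by blast
  obtain M2 p2 where M2: "turing_machine M2"
    and p2: "\<And>w. computes_within M2 (poly p2 (length w)) w (g w)"
    using assms(2) unfolding polytime_def by blast
  have k: "tapes M1 \<ge> 1" "tapes M2 \<ge> 1"
    using M1 M2 by (auto simp: turing_machine_def)
  \<comment> \<open>First machine, one step for the change of state, second machine on a word of
    length at most x + p1(x).\<close>
  define p where "p = p1 + 1 + pcompose p2 ([:0, 1:] + p1)"
  let ?C = "comp_tm M1 M2"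
  have "computes_within ?C (poly p (length w)) w (g (f w))" for w
  proof -
    obtain n where n: "n \<le> poly p1 (length w)"
      "fst ((step M1 ^^ n) (init_config M1 w)) = halt M1"
      "hd (snd ((step M1 ^^ n) (init_config M1 w))) = word_tape (f w)"
      using p1[of w] by (auto simp: computes_within_def)
    obtain m where m: "m \<le> n" "(step M1 ^^ m) (init_config M1 w) = (step M1 ^^ n) (init_config M1 w)"
      "\<And>i. i < m \<Longrightarrow> fst ((step M1 ^^ i) (init_config M1 w)) \<noteq> halt M1"
      using first_halt[OF n(2)] by blast
    define bl where "bl = replicate (tapes M2 - 1) blank_tape"
    have "replicate (tapes M1 + tapes M2 - 2) blank_tape = replicate (tapes M1 - 1) blank_tape @ bl"
      using k by (simp add: bl_def flip: replicate_add)
    then have init: "init_config ?C w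
        = (case init_config M1 w of (q, ts) \<Rightarrow> (2 * q, ts @ bl))"
      by (simp add: init_config_def comp_tm_def numeral_2_eq_2)
    have phase1: "(step ?C ^^ i) (init_config ?C w)
        = (case (step M1 ^^ i) (init_config M1 w) of (q, ts) \<Rightarrow> (2 * q, ts @ bl))" if "i \<le> m" for i
      using that
    proof (induction i)
      case (Suc i)
      obtain q ts where c: "(step M1 ^^ i) (init_config M1 w) = (q, ts)" by fastforce
      have "good_config M1 (q, ts)" using good_config_steps[OF M1, of i w] c by simp
      moreover have "q \<noteq> halt M1" using m(3)[of i] Suc.prems c by simp
      ultimately show ?case using Suc comp_step1[OF M1, of q ts M2 bl] by (simp add: c)
    qed (simp add: init)
    obtain ts where c: "(step M1 ^^ m) (init_config M1 w) = (halt M1, word_tape (f w) # ts)"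
      and lts: "Suc (length ts) = tapes M1"
    proof -
      obtain q us where c: "(step M1 ^^ m) (init_config M1 w) = (q, us)" by fastforce
      moreover have "length us = tapes M1"
        using good_config_steps[OF M1, of m w] c by (simp add: good_config_def)
      then obtain t ts where "us = t # ts" using k by (cases us) auto
      ultimately show thesis
        using n m(2) \<open>length us = tapes M1\<close> by (intro that[of ts]) auto
    qed
    have "2 * halt M1 \<noteq> 2 * halt M2 + 1" by presburger
    then have "step ?C (2 * halt M1, word_tape (f w) # ts @ bl)
        = (2 * start M2 + 1, word_tape (f w) # ts @ bl)"
      using map2_act_stay[of "word_tape (f w) # ts @ bl"]
      by (simp add: step_def comp_tm_def comp_delta_def del: map2_act_stay)
    then have switch: "(step ?C ^^ Suc m) (init_config ?C w)
        = (2 * start M2 + 1, word_tape (f w) # ts @ bl)"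
      using phase1[of m] by (simp add: c)
    have "length (f w) \<le> length w + n"
      using output_length[OF M1, of n w] n(3) by (simp add: nonblanks_word_tape)
    then have "length (f w) \<le> length w + poly p1 (length w)" using n(1) by simp
    obtain n2 where n2: "n2 \<le> poly p2 (length (f w))"
      "fst ((step M2 ^^ n2) (init_config M2 (f w))) = halt M2"
      "hd (snd ((step M2 ^^ n2) (init_config M2 (f w)))) = word_tape (g (f w))"
      using p2[of "f w"] by (auto simp: computes_within_def)
    have i2: "init_config M2 (f w) = (start M2, word_tape (f w) # bl)"
      by (simp add: init_config_def bl_def)
    then have "(step ?C ^^ n2) (2 * start M2 + 1, word_tape (f w) # ts @ bl)
        = (case (step M2 ^^ n2) (init_config M2 (f w)) of (q', us') \<Rightarrow> (2 * q' + 1, hd us' # ts @ tl us'))"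
      using comp_steps2[OF M2 lts, of "start M2" "word_tape (f w)" bl n2] good_config_init[OF M2, of "f w"]
      by simp
    then have "(step ?C ^^ (n2 + Suc m)) (init_config ?C w)
        = (case (step M2 ^^ n2) (init_config M2 (f w)) of (q', us') \<Rightarrow> (2 * q' + 1, hd us' # ts @ tl us'))"
      using switch by (simp only: funpow_add comp_apply)
    moreover have "n2 + Suc m \<le> poly p (length w)"
    proof -
      have "n2 \<le> poly p2 (length w + poly p1 (length w))"
        using n2(1) poly_nat_mono[OF \<open>length (f w) \<le> length w + poly p1 (length w)\<close>] by (rule le_trans)
      with n(1) m(1) show ?thesis by (simp add: p_def poly_pcompose)
    qed
    ultimately show ?thesis
      using n2 unfolding computes_within_def
      by (intro exI[of _ "n2 + Suc m"]) (auto simp: comp_tm_def split: prod.splits)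
  qed
  with turing_machine_comp[OF M1 M2] show ?thesis
    unfolding polytime_def by blast
qed

lemma reduces_trans: "A \<le>\<^sub>p B \<Longrightarrow> B \<le>\<^sub>p C \<Longrightarrow> A \<le>\<^sub>p C"
  unfolding reduces_def
proof (elim exE conjE)
  fix f g
  assume "polytime f" "\<forall>x. (x \<in> A) = (f x \<in> B)" "polytime g" "\<forall>x. (x \<in> B) = (g x \<in> C)"
  then show "\<exists>f. polytime f \<and> (\<forall>x. (x \<in> A) = (f x \<in> C))"
    by (intro exI[of _ "\<lambda>x. g (f x)"]) (auto intro: polytime_comp)
qed

section \<open>Unique readability\<close>

text \<open>A variable is the only item whose end is not marked: it stops where no subscript symbol
  follows. Unique readability of terms thus depends on the next symbol.\<close>

definition no_sub :: "sym list \<Rightarrow> bool" where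
  "no_sub u \<longleftrightarrow> (\<forall>b u'. u \<noteq> SSub b # u')"

lemma no_sub_simps [simp]:
  "no_sub []" "no_sub (s # u) \<longleftrightarrow> (\<forall>b. s \<noteq> SSub b)"
  by (auto simp: no_sub_def)

lemma no_sub_trm_word [simp]: "no_sub (trm_word t @ u)"
  by (cases t) (auto simp: var_word_def)

lemma no_sub_fm_word [simp]: "no_sub (fm_word \<phi> @ u)"
  by (cases \<phi>) auto

lemma map_SSub_append_eq:
  "map SSub x @ u = map SSub y @ v \<Longrightarrow> no_sub u \<Longrightarrow> no_sub v \<Longrightarrow> x = y \<and> u = v"
proof (induction x arbitrary: y)
  case Nil
  then show ?case by (cases y) auto
next
  case (Cons b x)
  then show ?case by (cases y) auto
qed

lemma trm_word_append_eq:
  "trm_word s @ u = trm_word t @ v \<Longrightarrow> no_sub u \<Longrightarrow> no_sub v \<Longrightarrow> s = t \<and> u = v"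
proof (induction s arbitrary: t u v)
  case (Var x)
  then show ?case by (cases t) (auto simp: var_word_def dest: map_SSub_append_eq)
next
  case Zero
  then show ?case by (cases t) (auto simp: var_word_def)
next
  case One
  then show ?case by (cases t) (auto simp: var_word_def)
next
  case (Plus s1 s2)
  from Plus.prems show ?case
    by (cases t) (auto simp: var_word_def dest!: Plus.IH)
next
  case (Minus s1 s2)
  from Minus.prems show ?case
    by (cases t) (auto simp: var_word_def dest!: Minus.IH)
next
  case (Times s1 s2)
  from Times.prems show ?case
    by (cases t) (auto simp: var_word_def dest!: Times.IH)
qed

text \<open>A term and a formula may both start with an opening parenthesis; reading off the first
  operand exposes the operator, and no operator belongs to both kinds.\<close>

lemma trm_word_neq_fm_word: "trm_word s @ u \<noteq> fm_word \<phi> @ v"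
proof (induction s arbitrary: \<phi> u v)
  case (Plus s1 s2)
  then show ?case by (cases \<phi>) (auto dest: trm_word_append_eq)
next
  case (Minus s1 s2)
  then show ?case by (cases \<phi>) (auto dest: trm_word_append_eq)
next
  case (Times s1 s2)
  then show ?case by (cases \<phi>) (auto dest: trm_word_append_eq)
next
  case (Var x)
  then show ?case by (cases \<phi>) (auto simp: var_word_def)
next
  case Zero
  then show ?case by (cases \<phi>) auto
next
  case One
  then show ?case by (cases \<phi>) auto
qed

text \<open>Every formula ends in \<open>SClose\<close>, so unlike a term it needs no condition on
  what follows.\<close>

lemma fm_word_append_eq: "fm_word \<phi> @ u = fm_word \<psi> @ v \<Longrightarrow> \<phi> = \<psi> \<and> u = v"
proof (induction \<phi> arbitrary: \<psi> u v)
  case (Rel r s t)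
  then show ?case
    by (cases \<psi>) (auto dest!: trm_word_append_eq simp: trm_word_neq_fm_word)
next
  case (Conj \<phi>1 \<phi>2)
  from Conj.prems show ?case
    by (cases \<psi>) (auto simp: trm_word_neq_fm_word[symmetric] dest!: Conj.IH)
next
  case (Disj \<phi>1 \<phi>2)
  from Disj.prems show ?case
    by (cases \<psi>) (auto simp: trm_word_neq_fm_word[symmetric] dest!: Disj.IH)
next
  case (Neg \<phi>)
  then show ?case by (cases \<psi>) auto
next
  case (Equiv \<phi>1 \<phi>2)
  from Equiv.prems show ?case
    by (cases \<psi>) (auto simp: trm_word_neq_fm_word[symmetric] dest!: Equiv.IH)
next
  case (All x \<phi>)
  then show ?case
    by (cases \<psi>) (auto simp: var_word_def dest!: map_SSub_append_eq)
next
  case (Ex x \<phi>)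
  then show ?case
    by (cases \<psi>) (auto simp: var_word_def dest!: map_SSub_append_eq)
qed

lemma fm_word_inj: "fm_word \<phi> = fm_word \<psi> \<Longrightarrow> \<phi> = \<psi>"
  using fm_word_append_eq[of \<phi> "[]" \<psi> "[]"] by simp

lemma fm_word_ex_prefix:
  "fm_word (ex_prefix xs \<phi>) = concat (map (\<lambda>x. SEx # var_word x) xs) @ fm_word \<phi>"
  by (induction xs) auto

section \<open>A bottom-up classification of terms and formulas\<close>

text \<open>The classes are fine enough that the class of a compound depends on those of its parts
  alone. \<open>CTwo\<close> is the term 1 + 1, a standard polynomial but no numeral, as
  \<open>numeral_trm 2\<close> is 1 + 1 times 1. Even and odd numerals above 1 are kept apart
  because 1 + t is a numeral only for an even numeral t. \<open>CEqZ\<close> marks the systems that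
  are a single equation p = 0; the classes of quantified formulas admit no connective on
  top.\<close>

datatype cls =
    CVar | CZero | COne | CTwo | CEven | COdd | CMono | CPoly | CTrm
  | CEqZ | CSys | CQf | CExEqZ | CExSys | CExQf | CBad

definition is_trm :: "cls \<Rightarrow> bool" where
  "is_trm c \<longleftrightarrow> c \<in> {CVar, CZero, COne, CTwo, CEven, COdd, CMono, CPoly, CTrm}"

definition is_num :: "cls \<Rightarrow> bool" where
  "is_num c \<longleftrightarrow> c \<in> {COne, CEven, COdd}"

definition is_mono :: "cls \<Rightarrow> bool" where
  "is_mono c \<longleftrightarrow> c \<in> {CVar, CZero, COne, CEven, COdd, CMono}"

definition is_poly :: "cls \<Rightarrow> bool" where
  "is_poly c \<longleftrightarrow> c \<in> {CVar, CZero, COne, CTwo, CEven, COdd, CMono, CPoly}"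

definition is_sys :: "cls \<Rightarrow> bool" where
  "is_sys c \<longleftrightarrow> c \<in> {CEqZ, CSys}"

definition is_qf :: "cls \<Rightarrow> bool" where
  "is_qf c \<longleftrightarrow> c \<in> {CEqZ, CSys, CQf}"

definition neg_cls :: "cls \<Rightarrow> cls" where
  "neg_cls c = (if is_qf c then CQf else CBad)"

definition ex_cls :: "cls \<Rightarrow> cls" where
  "ex_cls c = (if c \<in> {CEqZ, CExEqZ} then CExEqZ else if c \<in> {CSys, CExSys} then CExSys
     else if c \<in> {CQf, CExQf} then CExQf else CBad)"

fun trm_op_cls :: "sym \<Rightarrow> cls \<Rightarrow> cls \<Rightarrow> cls" where
  "trm_op_cls SPlus a b = (if a = COne \<and> b = COne then CTwo else if a = COne \<and> b = CEven then COdd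
     else if is_poly a \<and> is_mono b then CPoly else CTrm)"
| "trm_op_cls SMinus a b = (if is_poly a \<and> is_mono b then CPoly else CTrm)"
| "trm_op_cls STimes a b = (if a = CTwo \<and> is_num b then CEven else if is_mono a \<and> b = CVar then CMono
     else CTrm)"
| "trm_op_cls (SRel r) a b = (if is_poly a \<and> is_poly b \<and> r \<noteq> Ne then
     (if r = Eq \<and> b = CZero then CEqZ else CSys) else CQf)"
| "trm_op_cls _ a b = CBad"

definition op_cls :: "sym \<Rightarrow> cls \<Rightarrow> cls \<Rightarrow> cls" where
  "op_cls s a b = (if is_trm a \<and> is_trm b then trm_op_cls s a b
     else if is_sys a \<and> is_sys b \<and> s = SConj then CSys
     else if is_qf a \<and> is_qf b \<and> s \<in> {SConj, SDisj, SEquiv} then CQf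
     else CBad)"

primrec cls_trm :: "trm \<Rightarrow> cls" where
  "cls_trm (Var x) = CVar"
| "cls_trm Zero = CZero"
| "cls_trm One = COne"
| "cls_trm (Plus s t) = op_cls SPlus (cls_trm s) (cls_trm t)"
| "cls_trm (Minus s t) = op_cls SMinus (cls_trm s) (cls_trm t)"
| "cls_trm (Times s t) = op_cls STimes (cls_trm s) (cls_trm t)"

primrec cls_fm :: "fm \<Rightarrow> cls" where
  "cls_fm (Rel r s t) = op_cls (SRel r) (cls_trm s) (cls_trm t)"
| "cls_fm (Conj \<phi> \<psi>) = op_cls SConj (cls_fm \<phi>) (cls_fm \<psi>)"
| "cls_fm (Disj \<phi> \<psi>) = op_cls SDisj (cls_fm \<phi>) (cls_fm \<psi>)"
| "cls_fm (Neg \<phi>) = neg_cls (cls_fm \<phi>)"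
| "cls_fm (Equiv \<phi> \<psi>) = op_cls SEquiv (cls_fm \<phi>) (cls_fm \<psi>)"
| "cls_fm (All x \<phi>) = CBad"
| "cls_fm (Ex x \<phi>) = ex_cls (cls_fm \<phi>)"

section \<open>Agreement of classes with syntactic forms\<close>

lemmas is_cls_defs = is_trm_def is_num_def is_mono_def is_poly_def is_sys_def is_qf_def

lemma is_trm_op_cls:
  "is_trm a \<Longrightarrow> is_trm b \<Longrightarrow> s \<in> {SPlus, SMinus, STimes} \<Longrightarrow> is_trm (op_cls s a b)"
  by (auto simp: op_cls_def) (auto simp: is_cls_defs)

lemma is_trm_cls_trm [simp]: "is_trm (cls_trm t)"
  by (induction t) (auto intro!: is_trm_op_cls, auto simp: is_trm_def)

lemma not_is_trm_cls_fm [simp]: "\<not> is_trm (cls_fm \<phi>)"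
proof (induction \<phi>)
  case (Rel r s t)
  then show ?case by (simp add: op_cls_def) (auto simp: is_trm_def)
qed (auto simp: op_cls_def neg_cls_def ex_cls_def is_trm_def)

lemma cls_trm_eq:
  "cls_trm t = CVar \<longleftrightarrow> (\<exists>x. t = Var x)" "cls_trm t = CZero \<longleftrightarrow> t = Zero" "cls_trm t = COne \<longleftrightarrow> t = One"
  by (cases t; auto simp: op_cls_def)+

lemma cls_trm_eq_Two: "cls_trm t = CTwo \<longleftrightarrow> t = Plus One One"
proof (cases t)
  case (Plus s1 s2)
  then show ?thesis
    using cls_trm_eq(3)[of s1] cls_trm_eq(3)[of s2] by (auto simp: op_cls_def)
qed (auto simp: op_cls_def)

lemma numeral_trm_simps:
  "numeral_trm 0 = Zero" "numeral_trm (Suc 0) = One"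
  "c \<ge> 1 \<Longrightarrow> numeral_trm (2 * c) = Times (Plus One One) (numeral_trm c)"
  "c \<ge> 1 \<Longrightarrow> numeral_trm (Suc (2 * c)) = Plus One (Times (Plus One One) (numeral_trm c))"
  by (subst numeral_trm.simps; simp)+

lemma numeral_trm_cases:
  obtains "c = 0" | "c = 1" | d where "d \<ge> 1" "d < c" "c = 2 * d" | d where "d \<ge> 1" "d < c" "c = Suc (2 * d)"
proof -
  have "c = 0 \<or> c = 1 \<or> (\<exists>d. d \<ge> 1 \<and> d < c \<and> c = 2 * d) \<or> (\<exists>d. d \<ge> 1 \<and> d < c \<and> c = Suc (2 * d))"
    by presburger
  with that show thesis by blast
qed

lemma cls_numeral: "c \<ge> 1 \<Longrightarrow> is_num (cls_trm (numeral_trm c))"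
proof (induction c rule: less_induct)
  case (less c)
  show ?case
  proof (cases c rule: numeral_trm_cases)
    case (3 d)
    with less.IH[of d] show ?thesis by (auto simp: numeral_trm_simps op_cls_def is_cls_defs)
  next
    case (4 d)
    with less.IH[of d] show ?thesis by (auto simp: numeral_trm_simps op_cls_def is_cls_defs)
  qed (use less in \<open>auto simp: numeral_trm_simps is_num_def\<close>)
qed

text \<open>The clause on \<open>CEven\<close> strengthens the induction: for a sum 1 + t it is not
  enough that t is a numeral, its Horner form has to be known so that the sum is
  \<open>numeral_trm\<close> of an odd number.\<close>

lemma num_cls_numeral:
  "is_num (cls_trm t) \<Longrightarrow> \<exists>c\<ge>1. t = numeral_trm c \<and> (cls_trm t = CEven \<longrightarrow>
     (\<exists>d\<ge>1. t = Times (Plus One One) (numeral_trm d)))"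
proof (induction t)
  case One
  then show ?case by (auto simp: numeral_trm_simps intro!: exI[of _ 1])
next
  case (Plus s t)
  then have "s = One" "cls_trm t = CEven"
    by (auto simp: op_cls_def is_num_def cls_trm_eq split: if_splits)
  with Plus.IH(2) obtain d where "d \<ge> 1" "t = Times (Plus One One) (numeral_trm d)"
    by (auto simp: is_num_def)
  with \<open>s = One\<close> have "Plus s t = numeral_trm (Suc (2 * d))"
    by (simp add: numeral_trm_simps)
  moreover have "cls_trm (Plus s t) = COdd"
    using \<open>s = One\<close> \<open>cls_trm t = CEven\<close> by (simp add: op_cls_def is_trm_def)
  ultimately show ?case by (intro exI[of _ "Suc (2 * d)"]) auto
next
  case (Times s t)
  then have "s = Plus One One" "is_num (cls_trm t)"
    by (auto simp: op_cls_def cls_trm_eq_Two is_num_def[of CMono] is_num_def[of CTrm] split: if_splits)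
  with Times.IH(2) obtain d where "d \<ge> 1" "t = numeral_trm d" by blast
  with \<open>s = Plus One One\<close> have "Times s t = numeral_trm (2 * d)"
    by (simp add: numeral_trm_simps)
  then show ?case
    using \<open>d \<ge> 1\<close> \<open>t = numeral_trm d\<close> \<open>s = Plus One One\<close> by (intro exI[of _ "2 * d"]) auto
qed (auto simp: is_num_def op_cls_def split: if_splits)

lemma cls_monomial: "monomial t \<Longrightarrow> is_mono (cls_trm t)"
proof (induction rule: monomial.induct)
  case (1 c)
  then show ?case
    using cls_numeral[of c] by (cases "c = 0") (auto simp: numeral_trm_simps is_num_def is_mono_def)
qed (auto simp: op_cls_def is_cls_defs)

lemma cls_standard_poly: "standard_poly t \<Longrightarrow> is_poly (cls_trm t)"
  by (induction rule: standard_poly.induct)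
    (use cls_monomial in \<open>auto simp: op_cls_def is_poly_def is_mono_def\<close>)

lemma mono_cls_monomial: "is_mono (cls_trm t) \<Longrightarrow> monomial t"
proof (induction t)
  case (Var x)
  then show ?case by (simp add: monomial.intros)
next
  case Zero
  then show ?case using monomial.intros(1)[of 0] by (simp add: numeral_trm_simps)
next
  case One
  then show ?case using monomial.intros(1)[of 1] by (simp add: numeral_trm_simps)
next
  case (Plus s t)
  then have "is_num (cls_trm (Plus s t))"
    by (auto simp: op_cls_def is_mono_def is_num_def split: if_splits)
  then show ?case using num_cls_numeral monomial.intros(1) by metis
next
  case (Minus s t)
  then show ?case by (auto simp: op_cls_def is_mono_def split: if_splits)
next
  case (Times s t)
  show ?case
  proof (cases "cls_trm s = CTwo \<and> is_num (cls_trm t)")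
    case True
    then have "is_num (cls_trm (Times s t))" by (auto simp: op_cls_def is_num_def is_trm_def)
    then show ?thesis using num_cls_numeral monomial.intros(1) by metis
  next
    case False
    then have "is_mono (cls_trm s)" "cls_trm t = CVar"
      using Times.prems by (auto simp: op_cls_def is_mono_def[of CTrm] split: if_splits)
    then show ?thesis using Times.IH monomial.intros(3) by (auto simp: cls_trm_eq)
  qed
qed

lemma poly_cls_standard_poly: "is_poly (cls_trm t) \<Longrightarrow> standard_poly t"
proof (induction t)
  case (Plus s t)
  show ?case
  proof (cases "is_mono (cls_trm (Plus s t))")
    case True
    then show ?thesis by (intro standard_poly.intros(1) mono_cls_monomial)
  next
    case False
    then have "is_poly (cls_trm s)" "is_mono (cls_trm t)"
      using Plus.prems by (auto simp: op_cls_def is_poly_def is_mono_def split: if_splits)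
    then show ?thesis using Plus.IH mono_cls_monomial standard_poly.intros(2) by blast
  qed
next
  case (Minus s t)
  then have "is_poly (cls_trm s)" "is_mono (cls_trm t)"
    by (auto simp: op_cls_def is_poly_def[of CTrm] split: if_splits)
  then show ?case using Minus.IH mono_cls_monomial standard_poly.intros(3) by blast
next
  case (Times s t)
  then have "is_mono (cls_trm (Times s t))"
    by (auto simp: op_cls_def is_poly_def is_mono_def split: if_splits)
  then show ?case by (intro standard_poly.intros(1) mono_cls_monomial)
qed (auto intro!: standard_poly.intros(1) mono_cls_monomial simp: is_mono_def)

lemma cls_poly_system: "poly_system \<phi> \<Longrightarrow> is_sys (cls_fm \<phi>)"
proof (induction rule: poly_system.induct)
  case (1 p q r)
  then show ?case using cls_standard_poly[of p] cls_standard_poly[of q]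
    by (auto simp: op_cls_def is_sys_def)
next
  case (2 \<phi> \<psi>)
  then show ?case using not_is_trm_cls_fm[of \<phi>] by (auto simp: op_cls_def is_sys_def)
qed

lemma cls_eqz: "standard_poly p \<Longrightarrow> cls_fm (Rel Eq p Zero) = CEqZ"
  using cls_standard_poly[of p] by (auto simp: op_cls_def is_poly_def is_trm_def)

lemma cls_quantifier_free: "quantifier_free \<phi> \<Longrightarrow> is_qf (cls_fm \<phi>)"
proof (induction \<phi>)
  case (Rel r s t)
  then show ?case by (auto simp: op_cls_def is_qf_def)
qed (use not_is_trm_cls_fm in \<open>auto simp: op_cls_def neg_cls_def is_sys_def is_qf_def[of CQf] is_qf_def[of CSys]\<close>)

lemma qf_cls: "is_qf (cls_fm \<phi>) \<Longrightarrow> quantifier_free \<phi>"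
  by (induction \<phi>) (auto simp: op_cls_def neg_cls_def ex_cls_def is_qf_def is_sys_def split: if_splits)

lemma sys_cls: "is_sys (cls_fm \<phi>) \<Longrightarrow> poly_system \<phi>"
proof (induction \<phi>)
  case (Rel r s t)
  then have "is_poly (cls_trm s)" "is_poly (cls_trm t)" "r \<noteq> Ne"
    by (auto simp: op_cls_def is_sys_def split: if_splits)
  then show ?case
    by (cases r) (auto intro!: poly_system.intros poly_cls_standard_poly)
next
  case (Conj \<phi> \<psi>)
  then have "is_sys (cls_fm \<phi>)" "is_sys (cls_fm \<psi>)"
    by (auto simp: op_cls_def is_sys_def split: if_splits)
  with Conj show ?case by (auto intro: poly_system.intros)
qed (auto simp: op_cls_def neg_cls_def ex_cls_def is_sys_def split: if_splits)

lemma eqz_cls: "cls_fm \<phi> = CEqZ \<Longrightarrow> \<exists>p. standard_poly p \<and> \<phi> = Rel Eq p Zero"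
proof (cases \<phi>)
  case (Rel r s t)
  moreover assume "cls_fm \<phi> = CEqZ"
  ultimately have "is_poly (cls_trm s)" "t = Zero" "r = Eq"
    by (auto simp: op_cls_def cls_trm_eq split: if_splits)
  with Rel show ?thesis using poly_cls_standard_poly by blast
qed (auto simp: op_cls_def neg_cls_def ex_cls_def split: if_splits)

text \<open>\<open>ex_cls\<close> fixes the quantified version of \<open>c\<close>, and only
  quantifiers lead to that class, so peeling them off ends at class \<open>c\<close>
  exactly.\<close>

lemma ex_cls_cases:
  assumes "cls_fm \<phi> \<in> {c, ex_cls c}" "c \<in> {CEqZ, CSys, CQf}"
  shows "\<exists>xs \<psi>. \<phi> = ex_prefix xs \<psi> \<and> cls_fm \<psi> = c"
proof (cases "cls_fm \<phi> = c")
  case True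
  then show ?thesis by (intro exI[of _ "[]"] exI[of _ \<phi>]) simp
next
  case False
  then have "cls_fm \<phi> = ex_cls c" using assms(1) by simp
  then show ?thesis
  proof (induction \<phi>)
    case (Ex x \<phi>)
    then have "cls_fm \<phi> = c \<or> cls_fm \<phi> = ex_cls c"
      using assms(2) by (auto simp: ex_cls_def split: if_splits)
    then show ?case
    proof
      assume "cls_fm \<phi> = c"
      then show ?thesis by (intro exI[of _ "[x]"] exI[of _ \<phi>]) simp
    next
      assume "cls_fm \<phi> = ex_cls c"
      with Ex.IH obtain xs \<psi> where "\<phi> = ex_prefix xs \<psi>" "cls_fm \<psi> = c" by blast
      then show ?thesis by (intro exI[of _ "x # xs"] exI[of _ \<psi>]) simp
    qed
  qed (use assms(2) in \<open>auto simp: op_cls_def neg_cls_def ex_cls_def split: if_splits\<close>)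
qed

lemma cls_ex_prefix:
  assumes "cls_fm \<phi> = c" "c \<in> {CEqZ, CSys, CQf}"
  shows "cls_fm (ex_prefix xs \<phi>) \<in> {c, ex_cls c}"
  using assms by (induction xs) (auto simp: ex_cls_def)

lemma feasible_cls:
  "cls_fm \<phi> \<in> {CEqZ, CExEqZ} \<longleftrightarrow> (\<exists>xs p. \<phi> = ex_prefix xs (Rel Eq p Zero) \<and> standard_poly p)"
    (is "?l \<longleftrightarrow> ?r")
proof
  assume ?l
  then have "\<exists>xs \<psi>. \<phi> = ex_prefix xs \<psi> \<and> cls_fm \<psi> = CEqZ"
    using ex_cls_cases[of \<phi> CEqZ] by (simp add: ex_cls_def)
  then show ?r using eqz_cls by blast
next
  assume ?r
  then show ?l using cls_ex_prefix[OF cls_eqz] by (fastforce simp: ex_cls_def)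
qed

lemma ineq_cls:
  "cls_fm \<phi> \<in> {CEqZ, CExEqZ, CSys, CExSys} \<longleftrightarrow> (\<exists>xs \<psi>. \<phi> = ex_prefix xs \<psi> \<and> poly_system \<psi>)"
    (is "?l \<longleftrightarrow> ?r")
proof
  assume ?l
  then have "\<exists>xs \<psi>. \<phi> = ex_prefix xs \<psi> \<and> is_sys (cls_fm \<psi>)"
    using ex_cls_cases[of \<phi> CEqZ] ex_cls_cases[of \<phi> CSys] by (fastforce simp: ex_cls_def is_sys_def)
  then show ?r using sys_cls by blast
next
  assume ?r
  then obtain xs \<psi> where "\<phi> = ex_prefix xs \<psi>" "is_sys (cls_fm \<psi>)" using cls_poly_system by blast
  then show ?l
    using cls_ex_prefix[of \<psi> _ xs] by (auto simp: ex_cls_def is_sys_def)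
qed

lemma etr_cls:
  "cls_fm \<phi> \<in> {CEqZ, CExEqZ, CSys, CExSys, CQf, CExQf} \<longleftrightarrow>
     (\<exists>xs \<psi>. \<phi> = ex_prefix xs \<psi> \<and> quantifier_free \<psi>)"
    (is "?l \<longleftrightarrow> ?r")
proof
  assume ?l
  then have "\<exists>xs \<psi>. \<phi> = ex_prefix xs \<psi> \<and> is_qf (cls_fm \<psi>)"
    using ex_cls_cases[of \<phi> CEqZ] ex_cls_cases[of \<phi> CSys] ex_cls_cases[of \<phi> CQf]
    by (fastforce simp: ex_cls_def is_qf_def)
  then show ?r using qf_cls by blast
next
  assume ?r
  then obtain xs \<psi> where "\<phi> = ex_prefix xs \<psi>" "is_qf (cls_fm \<psi>)" using cls_quantifier_free by blast
  then show ?l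
    using cls_ex_prefix[of \<psi> _ xs] by (auto simp: ex_cls_def is_qf_def)
qed

section \<open>Recognizing classes of formulas in polynomial time\<close>

text \<open>\<open>Cl\<close> letters are the nonterminals on the stack of the parser,
  \<open>Err\<close> stands for bits that encode no symbol, and \<open>Done\<close> belongs to the
  translation.\<close>

datatype token = Sy sym | Cl cls | Err | Done

primrec cls_number :: "cls \<Rightarrow> nat" where
  "cls_number CVar = 0"
| "cls_number CZero = 1"
| "cls_number COne = 2"
| "cls_number CTwo = 3"
| "cls_number CEven = 4"
| "cls_number COdd = 5"
| "cls_number CMono = 6"
| "cls_number CPoly = 7"
| "cls_number CTrm = 8"
| "cls_number CEqZ = 9"
| "cls_number CSys = 10"
| "cls_number CQf = 11"
| "cls_number CExEqZ = 12"
| "cls_number CExSys = 13"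
| "cls_number CExQf = 14"
| "cls_number CBad = 15"

text \<open>The 22 symbols get 1 to 22 and the 16 classes 23 to 38; 0 remains the blank.\<close>

primrec token_letter :: "token \<Rightarrow> nat" where
  "token_letter (Sy s) = Suc (sym_number s)"
| "token_letter (Cl c) = 23 + cls_number c"
| "token_letter Err = 39"
| "token_letter Done = 40"

definition letter_token :: "nat \<Rightarrow> token" where
  "letter_token = inv token_letter"

lemma rel_number_le: "rel_number r \<le> 5"
  by (cases r) auto

lemma rel_number_inj: "rel_number r = rel_number r' \<Longrightarrow> r = r'"
  by (cases r; cases r') auto

lemma sym_number_le: "sym_number s \<le> 21"
  using rel_number_le by (cases s) (auto simp: le_Suc_eq)

lemma sym_number_inj: "sym_number s = sym_number s' \<Longrightarrow> s = s'"
proof -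
  have "\<exists>r. s = SRel r" if "sym_number s \<ge> 16" for s
    using that by (cases s) (auto split: if_splits)
  moreover assume "sym_number s = sym_number s'"
  ultimately show ?thesis
    by (cases "sym_number s \<ge> 16"; cases s; cases s') (auto dest: rel_number_inj split: if_splits)
qed

lemma cls_number_le: "cls_number c \<le> 15"
  by (cases c) auto

lemma cls_number_inj: "cls_number c = cls_number c' \<Longrightarrow> c = c'"
  by (cases c; cases c'; simp)

lemma inj_token_letter: "inj token_letter"
proof (rule injI)
  have *: "Suc (sym_number s) \<noteq> 23 + cls_number c" "sym_number s \<noteq> 38" "sym_number s \<noteq> 39"
    "cls_number c \<noteq> 16" "cls_number c \<noteq> 17" for s c
    using sym_number_le[of s] cls_number_le[of c] by linarith+
  fix x y assume "token_letter x = token_letter y"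
  then show "x = y"
    using * *(1)[symmetric]
    by (cases x; cases y) (auto dest: sym_number_inj cls_number_inj)
qed

lemma letter_token [simp]: "letter_token (token_letter x) = x"
  unfolding letter_token_def using inj_token_letter by (rule inv_f_f)

lemma map_letter_token [simp]: "map letter_token (map token_letter u) = u"
  by (induction u) auto

lemma token_letter_range: "token_letter x \<in> {1..40}"
proof (cases x)
  case (Sy s)
  then show ?thesis using sym_number_le[of s] by simp
next
  case (Cl c)
  then show ?thesis using cls_number_le[of c] by simp
qed auto

lemma token_letter_pos [simp]: "token_letter x \<noteq> 0" "token_letter x > 0"
  using token_letter_range[of x] by auto

text \<open>The forty letters are those of \<open>token_letter\<close>, among them the bit letters 1
  and 2; ten stacks are what the translation uses.\<close>

interpretation stacks 10 40
  by unfold_locales auto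

definition blank_store :: store where
  "blank_store = (\<lambda>_. [])"

lemma blank_store_apply [simp]: "blank_store k = []"
  by (simp add: blank_store_def)

lemma word_store_eq: "word_store w = blank_store(0 := map bit_letter w)"
  by (simp add: word_store_def blank_store_def)

text \<open>There are at most \<open>store_size s\<close> passes, so constant growth per pass keeps
  the store linear in the initial one.\<close>

lemma ptime_for_growth:
  assumes "ptime f" "k < 10" "\<And>s x. f (s(k := x)) = (f s)(k := x)"
    and size: "\<And>s. valid s \<Longrightarrow> store_size (f s) \<le> store_size s + c"
  shows "ptime (\<lambda>s. ((f ^^ length (s k)) s)(k := []))"
proof (rule ptime_for[OF assms(1-3)])
  fix s i assume s: "valid s" and i: "i \<le> length (s k)"
  have "valid ((f ^^ i) s) \<and> store_size ((f ^^ i) s) \<le> store_size s + i * c"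
  proof (induction i)
    case (Suc i)
    with ptime_valid[OF assms(1)] size[of "(f ^^ i) s"] show ?case by auto
  qed (use s in auto)
  moreover have "i * c \<le> store_size s * c"
    using i length_le_store_size[OF assms(2), of s] by (intro mult_right_mono) auto
  ultimately have "store_size ((f ^^ i) s) \<le> store_size s + store_size s * c" by linarith
  then show "store_size ((f ^^ i) s) \<le> poly [:0, 1 + c:] (store_size s)" by simp
qed

subsection \<open>Decoding bit strings\<close>

definition chunk :: "bool list \<Rightarrow> token" where
  "chunk u = (if \<exists>s. sym_bits s = u then Sy (inv sym_bits u) else Err)"

lemma length_sym_bits [simp]: "length (sym_bits s) = 5"
  by (simp add: sym_bits_def)

lemma inj_sym_bits: "inj sym_bits"
proof (rule injI)
  fix s s' assume "sym_bits s = sym_bits s'"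
  then have bits: "bit (sym_number s) i = bit (sym_number s') i" if "i < 5" for i
    using that by (simp add: sym_bits_def bit_iff_odd)
  have "take_bit 5 (sym_number s) = take_bit 5 (sym_number s')"
    by (rule bit_eqI) (use bits in \<open>auto simp: bit_take_bit_iff\<close>)
  moreover have "take_bit 5 (sym_number t) = sym_number t" for t
    using sym_number_le[of t] by (simp add: take_bit_nat_eq_self_iff)
  ultimately have "sym_number s = sym_number s'" by metis
  then show "s = s'" by (rule sym_number_inj)
qed

lemma chunk_sym_bits [simp]: "chunk (sym_bits s) = Sy s"
  using inj_sym_bits by (auto simp: chunk_def)

lemma chunk_eq_Sy: "chunk u = Sy s \<longleftrightarrow> u = sym_bits s"
  using inj_sym_bits by (auto simp: chunk_def)

fun decode :: "bool list \<Rightarrow> token list" where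
  "decode (a # b # c # d # e # w) = chunk [a, b, c, d, e] # decode w"
| "decode [] = []"
| "decode w = [Err]"

lemma list_length_5:
  assumes "length u = 5"
  obtains a b c d e where "u = [a, b, c, d, e]"
  using assms by (auto simp: numeral_eq_Suc length_Suc_conv)

lemma decode_sym_bits: "decode (concat (map sym_bits v)) = map Sy v"
proof (induction v)
  case (Cons s v)
  obtain a b c d e where "sym_bits s = [a, b, c, d, e]"
    using list_length_5[OF length_sym_bits] by metis
  with Cons chunk_sym_bits[of s] show ?case by simp
qed simp

lemma decode_eq_Sy: "decode w = map Sy v \<Longrightarrow> w = concat (map sym_bits v)"
proof (induction w arbitrary: v rule: decode.induct)
  case (1 a b c d e w)
  then obtain s v' where "v = s # v'" "chunk [a, b, c, d, e] = Sy s" "decode w = map Sy v'"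
    by (cases v) auto
  with 1(1) chunk_eq_Sy[of "[a, b, c, d, e]" s] show ?case by auto
qed (auto simp: Cons_eq_map_conv)

lemma decode_encode: "decode (encode \<phi>) = map Sy (fm_word \<phi>)"
  by (simp add: encode_def decode_sym_bits)

lemma decode_eq_fm_word: "decode w = map Sy (fm_word \<phi>) \<longleftrightarrow> w = encode \<phi>"
  using decode_eq_Sy decode_encode by (auto simp: encode_def)

lemma encode_inj: "encode \<phi> = encode \<psi> \<Longrightarrow> \<phi> = \<psi>"
  using decode_encode[of \<phi>] decode_encode[of \<psi>] fm_word_inj inj_map_eq_map[of Sy]
  by (auto simp: inj_def)

text \<open>Stack 3 buffers an incomplete block with its last bit on top, hence \<open>rev\<close>;
  five bits become one token, fewer are put back.\<close>

definition flush :: "nat list \<Rightarrow> store \<Rightarrow> store" where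
  "flush u s = (if length u = 5
     then s(1 := token_letter (chunk (map (\<lambda>a. a = 2) (rev u))) # s 1)
     else s(3 := u @ s 3))"

definition decode_bit :: "nat \<Rightarrow> store \<Rightarrow> store" where
  "decode_bit a s = (let s' = s(3 := a # s 3) in flush (take 5 (s' 3)) (s'(3 := drop 5 (s' 3))))"

lemma ptime_flush: "set u \<subseteq> {1..40} \<Longrightarrow> ptime (flush u)"
proof (cases "length u = 5")
  case True
  then show ?thesis
    using ptime_push[of 1 "token_letter x" for x] token_letter_range by (simp add: flush_def[abs_def])
next
  case False
  moreover assume "set u \<subseteq> {1..40}"
  ultimately show ?thesis
    using ptime_push_list[of 3 u] by (simp add: flush_def[abs_def])
qed

lemma ptime_decode_bit: "1 \<le> a \<Longrightarrow> a \<le> 40 \<Longrightarrow> ptime (decode_bit a)"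
  unfolding decode_bit_def[abs_def] Let_def
  by (rule ptime_comp[where f = "\<lambda>s. s(3 := a # s 3)"
        and g = "\<lambda>s. flush (take 5 (s 3)) (s(3 := drop 5 (s 3)))"])
    (auto intro!: ptime_push ptime_lookahead ptime_flush)

lemma decode_bit_growth: "store_size (decode_bit a s) \<le> store_size s + 2"
proof -
  define v where "v = take 5 (a # s 3)"
  have "length v \<le> 5" "a # s 3 = v @ drop 5 (a # s 3)" by (simp_all add: v_def)
  then have v: "length v + length (drop 5 (a # s 3)) = Suc (length (s 3))"
    by (metis length_Cons length_append)
  let ?s = "s(3 := drop 5 (a # s 3))"
  have "decode_bit a s = flush v ?s"
    by (simp add: decode_bit_def v_def)
  moreover have "store_size (flush v ?s) \<le> store_size ?s + length v + 1"
    using store_size_upd[of 3 ?s "v @ ?s 3"]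
      store_size_upd[of 1 ?s "token_letter (chunk (map (\<lambda>a. a = 2) (rev v))) # ?s 1"]
    by (simp add: flush_def)
  ultimately show ?thesis
    using v store_size_upd[of 3 s "drop 5 (a # s 3)"] by simp
qed

lemma bit_letter_eq_2 [simp]: "bit_letter b = 2 \<longleftrightarrow> b"
  by (simp add: bit_letter_def)

lemma fold_decode_bit_short:
  "length w + length (s 3) < 5 \<Longrightarrow>
    fold decode_bit (map bit_letter w) s = s(3 := rev (map bit_letter w) @ s 3)"
proof (induction w arbitrary: s)
  case (Cons a w)
  then have 1: "decode_bit (bit_letter a) s = s(3 := bit_letter a # s 3)"
    by (simp add: decode_bit_def flush_def Let_def)
  have 2: "fold decode_bit (map bit_letter w) (s(3 := bit_letter a # s 3))
      = s(3 := bit_letter a # s 3, 3 := rev (map bit_letter w) @ (s(3 := bit_letter a # s 3)) 3)"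
    by (rule Cons.IH) (use Cons.prems in simp)
  show ?case by (simp only: list.map fold_simps 1 2) simp
qed simp

lemma fold_decode_bit_Err:
  assumes "s 3 = []" "length w < 5" "w \<noteq> []" "decode w = [Err]"
  shows "\<exists>t v. fold decode_bit (map bit_letter w) s = s(1 := t, 3 := v) \<and> 0 \<notin> set v \<and>
     (if v = [] then t else token_letter Err # t) = map token_letter (rev (decode w)) @ s 1"
proof -
  have "fold decode_bit (map bit_letter w) s = s(1 := s 1, 3 := rev (map bit_letter w))"
    using fold_decode_bit_short[of w s] assms by (simp add: fun_upd_idem)
  moreover have "0 \<notin> set (rev (map bit_letter w))"
    by (auto simp: bit_letter_def)
  moreover have "(if rev (map bit_letter w) = [] then s 1 else token_letter Err # s 1)
      = map token_letter (rev (decode w)) @ s 1"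
    using assms by simp
  ultimately show ?thesis by blast
qed

text \<open>A nonempty rest \<open>v\<close> on stack 3 stands for the final \<open>Err\<close> that
  \<open>decode\<close> gives for an incomplete block; \<open>finish_decode\<close> supplies it once
  no more bits can come.\<close>

lemma fold_decode_bit:
  "s 3 = [] \<Longrightarrow> \<exists>t v. fold decode_bit (map bit_letter w) s = s(1 := t, 3 := v) \<and> 0 \<notin> set v \<and>
     (if v = [] then t else token_letter Err # t) = map token_letter (rev (decode w)) @ s 1"
proof (induction w arbitrary: s rule: decode.induct)
  case (1 a b c d e w)
  let ?s = "s(1 := token_letter (chunk [a, b, c, d, e]) # s 1)"
  have "fold decode_bit (map bit_letter (a # b # c # d # e # w)) s = fold decode_bit (map bit_letter w) ?s"
    using 1(2) by (simp add: decode_bit_def flush_def fun_upd_twist fun_upd_idem)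
  moreover have "?s 3 = []" using 1(2) by simp
  from 1(1)[of ?s, OF this] obtain t v where tv: "fold decode_bit (map bit_letter w) ?s = ?s(1 := t, 3 := v)"
    "0 \<notin> set v" "(if v = [] then t else token_letter Err # t) = map token_letter (rev (decode w)) @ ?s 1"
    by blast
  ultimately have "fold decode_bit (map bit_letter (a # b # c # d # e # w)) s = s(1 := t, 3 := v)"
    by simp
  moreover have "(if v = [] then t else token_letter Err # t)
      = map token_letter (rev (decode (a # b # c # d # e # w))) @ s 1"
    using tv(3) by (simp del: token_letter.simps)
  ultimately show ?case using tv(2) by blast
next
  case 2
  then have "s = s(1 := s 1, 3 := [])" by (simp add: fun_upd_idem)
  then show ?case
    by (metis (no_types) append_Nil decode.simps(2) empty_iff fold_simps(1) list.set(1) list.simps(8) rev.simps(1))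
qed (rule fold_decode_bit_Err; simp)+

definition finish_decode :: "store \<Rightarrow> store" where
  "finish_decode s = (if peek (s 3) \<in> {0} then s else s(1 := token_letter Err # s 1))"

definition decode_store :: "store \<Rightarrow> store" where
  "decode_store s =
     (let s1 = fold decode_bit (takeWhile (\<lambda>a. a \<in> {0<..}) (s 0)) (s(0 := dropWhile (\<lambda>a. a \<in> {0<..}) (s 0)));
          s2 = (finish_decode s1)(3 := [])
      in s2(1 := [], 0 := rev (s2 1) @ s2 0))"

lemma ptime_decode_store: "ptime decode_store"
proof -
  have 1: "ptime (\<lambda>s. fold decode_bit (takeWhile (\<lambda>a. a \<in> {0<..}) (s 0))
      (s(0 := dropWhile (\<lambda>a. a \<in> {0<..}) (s 0))))"
  proof (rule ptime_fold[where c = 2])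
    show "decode_bit a (s(0 := x)) = (decode_bit a s)(0 := x)" for a s x
      by (simp add: decode_bit_def flush_def Let_def fun_upd_twist)
    show "store_size (decode_bit a s) \<le> store_size s + 2" for a s
      by (rule decode_bit_growth)
  qed (auto intro: ptime_decode_bit)
  have 2: "ptime finish_decode"
    unfolding finish_decode_def[abs_def]
    by (rule ptime_if) (auto intro!: ptime_id ptime_push)
  show ?thesis
    unfolding decode_store_def[abs_def] Let_def
    by (rule ptime_comp[OF ptime_comp[OF ptime_comp[OF 1 2] ptime_clear[of 3]] ptime_pour_all[of 1 0]]) auto
qed

lemma decode_store: "decode_store (word_store w) = blank_store(0 := map token_letter (decode w))"
proof -
  have tw: "takeWhile (\<lambda>a. a \<in> {0<..}) (map bit_letter w) = map bit_letter w"
    and dw: "dropWhile (\<lambda>a. a \<in> {0<..}) (map bit_letter w) = []"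
    by (auto simp: takeWhile_eq_all_conv dropWhile_eq_Nil_conv bit_letter_def)
  obtain t v where tv: "fold decode_bit (map bit_letter w) blank_store = blank_store(1 := t, 3 := v)" "0 \<notin> set v"
      "(if v = [] then t else token_letter Err # t) = map token_letter (rev (decode w))"
    using fold_decode_bit[of blank_store w] by auto
  have "word_store w 0 = map bit_letter w" "(word_store w)(0 := []) = blank_store"
    by (simp_all add: word_store_eq fun_upd_idem)
  then have "decode_store (word_store w) = (let s2 = (finish_decode (blank_store(1 := t, 3 := v)))(3 := [])
      in s2(1 := [], 0 := rev (s2 1) @ s2 0))"
    by (simp only: decode_store_def tw dw tv(1) Let_def)
  also have "\<dots> = blank_store(0 := rev (if v = [] then t else token_letter Err # t))"
    using tv(2) by (auto simp: finish_decode_def fun_eq_iff simp del: token_letter.simps)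
  finally show ?thesis unfolding tv(3) by (simp add: rev_map)
qed

subsection \<open>A shift-reduce parser\<close>

text \<open>Stacks grow to the left, so the left-hand sides are written in reverse.\<close>

inductive rule :: "token list \<Rightarrow> cls \<Rightarrow> bool" where
  "rule [Sy SZero] CZero"
| "rule [Sy SOne] COne"
| "rule [Sy SVar] CVar"
| "rule [Sy (SSub b), Cl CVar] CVar"
| "\<not> is_trm c \<Longrightarrow> rule [Cl c, Sy SNeg] (neg_cls c)"
| "\<not> is_trm c \<Longrightarrow> rule [Cl c, Cl CVar, Sy SEx] (ex_cls c)"
| "rule [Sy SClose, Cl b, Sy s, Cl a, Sy SOpen] (op_cls s a b)"

text \<open>The top one or two letters already tell the left-hand sides apart, so the parser is
  deterministic and never backtracks.\<close>

lemma rule_unique: "rule u c \<Longrightarrow> rule v d \<Longrightarrow> u @ r = v @ r' \<Longrightarrow> u = v \<and> c = d"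
  by (auto elim!: rule.cases)

lemma rule_length: "rule u c \<Longrightarrow> 1 \<le> length u \<and> length u \<le> 5"
  by (auto elim!: rule.cases)

definition reduct :: "token list \<Rightarrow> (nat \<times> cls) option" where
  "reduct stk = (if \<exists>u c r. stk = u @ r \<and> rule u c
     then Some (SOME p. \<exists>u c r. stk = u @ r \<and> rule u c \<and> p = (length u, c)) else None)"

lemma reduct_Some:
  assumes "rule u c"
  shows "reduct (u @ r) = Some (length u, c)"
proof -
  have "(SOME p. \<exists>u' c' r'. u @ r = u' @ r' \<and> rule u' c' \<and> p = (length u', c')) = (length u, c)"
  proof (rule some_equality)
    show "\<exists>u' c' r'. u @ r = u' @ r' \<and> rule u' c' \<and> (length u, c) = (length u', c')"
      using assms by blast
    show "p = (length u, c)" if "\<exists>u' c' r'. u @ r = u' @ r' \<and> rule u' c' \<and> p = (length u', c')" for p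
      using that rule_unique[OF assms] by metis
  qed
  then show ?thesis using assms by (auto simp: reduct_def)
qed

lemma reduct_cases:
  obtains "reduct stk = None" "\<And>u c r. stk = u @ r \<Longrightarrow> \<not> rule u c"
  | u c r where "stk = u @ r" "rule u c" "reduct stk = Some (length u, c)"
proof (cases "\<exists>u c r. stk = u @ r \<and> rule u c")
  case True
  then show thesis using that(2) reduct_Some by blast
next
  case False
  then have "reduct stk = None" by (simp only: reduct_def if_False)
  with False show thesis using that(1) by blast
qed

text \<open>Left-hand sides have at most five letters. This makes a parser move a bounded
  lookahead.\<close>

lemma reduct_take: "reduct (take 5 stk) = reduct stk"
proof (cases stk rule: reduct_cases)
  case 1
  have "reduct (take 5 stk) = None"
  proof (cases "take 5 stk" rule: reduct_cases)
    case (2 u c r)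
    then have "stk = u @ (r @ drop 5 stk)" by (metis append.assoc append_take_drop_id)
    with 1(2) 2(2) show ?thesis by blast
  qed
  with 1(1) show ?thesis by simp
next
  case (2 u c r)
  then have "take 5 stk = u @ take (5 - length u) r" using rule_length[OF 2(2)] by simp
  with 2 reduct_Some[OF 2(2)] show ?thesis by simp
qed

lemma reduct_None:
  "is_trm c \<Longrightarrow> reduct (Cl c # stk) = None"
  "s \<notin> {SZero, SOne, SVar, SClose} \<Longrightarrow> no_sub [s] \<Longrightarrow> reduct (Sy s # stk) = None"
  "s \<noteq> SNeg \<Longrightarrow> reduct (Cl c # Sy s # stk) = None"
proof -
  show "is_trm c \<Longrightarrow> reduct (Cl c # stk) = None"
    by (cases "Cl c # stk" rule: reduct_cases) (auto elim!: rule.cases)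
  show "s \<notin> {SZero, SOne, SVar, SClose} \<Longrightarrow> no_sub [s] \<Longrightarrow> reduct (Sy s # stk) = None"
    by (cases "Sy s # stk" rule: reduct_cases) (auto elim!: rule.cases)
  show "s \<noteq> SNeg \<Longrightarrow> reduct (Cl c # Sy s # stk) = None"
    by (cases "Cl c # Sy s # stk" rule: reduct_cases) (auto elim!: rule.cases)
qed

lemma reduct_Nil [simp]: "reduct [] = None" "reduct [Cl c] = None"
proof -
  show "reduct [] = None"
    by (cases "[] :: token list" rule: reduct_cases) (auto dest: rule_length)
  show "reduct [Cl c] = None"
    by (cases "[Cl c]" rule: reduct_cases) (auto elim!: rule.cases)
qed

definition pstep :: "token list \<times> token list \<Rightarrow> token list \<times> token list" where
  "pstep = (\<lambda>(stk, inp). case reduct stk of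
     Some (n, c) \<Rightarrow> (Cl c # drop n stk, inp)
   | None \<Rightarrow> (case inp of [] \<Rightarrow> (stk, []) | x # inp' \<Rightarrow> (x # stk, inp')))"

text \<open>In a word to be accepted each symbol is shifted once and accounts for at most one
  reduction, so \<open>3 * length w\<close> moves are enough. A fixed number of moves makes the
  parser total, and nothing changes any more after success.\<close>

definition parse :: "token list \<Rightarrow> token list \<times> token list" where
  "parse w = (pstep ^^ (3 * length w)) ([], w)"

definition accepts :: "cls set \<Rightarrow> token list \<Rightarrow> bool" where
  "accepts A w \<longleftrightarrow> (\<exists>c \<in> A. parse w = ([Cl c], []))"

section \<open>Completeness of the parser\<close>

definition reach :: "nat \<Rightarrow> token list \<times> token list \<Rightarrow> token list \<times> token list \<Rightarrow> bool" where
  "reach k c d \<longleftrightarrow> (\<exists>n \<le> k. (pstep ^^ n) c = d)"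

lemma reach_trans: "reach k c d \<Longrightarrow> reach m d e \<Longrightarrow> k + m \<le> l \<Longrightarrow> reach l c e"
  unfolding reach_def
proof (elim exE conjE)
  fix n n' assume "n \<le> k" "(pstep ^^ n) c = d" "n' \<le> m" "(pstep ^^ n') d = e" "k + m \<le> l"
  then show "\<exists>n\<le>l. (pstep ^^ n) c = e"
    by (intro exI[of _ "n' + n"]) (simp add: funpow_add)
qed

lemma reach_refl: "reach 0 c c"
  by (auto simp: reach_def)

lemma reach_shift: "reduct stk = None \<Longrightarrow> reach 1 (stk, x # inp) (x # stk, inp)"
  unfolding reach_def by (intro exI[of _ 1]) (simp add: pstep_def)

lemma reach_reduce: "rule u c \<Longrightarrow> reach 1 (u @ r, inp) (Cl c # r, inp)"
  unfolding reach_def by (intro exI[of _ 1]) (simp add: pstep_def reduct_Some)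

lemma reach_subs: "reach (2 * length x) (Cl CVar # stk, map Sy (map SSub x) @ inp) (Cl CVar # stk, inp)"
proof (induction x)
  case (Cons b x)
  have "reach 1 (Cl CVar # stk, map Sy (map SSub (b # x)) @ inp)
      (Sy (SSub b) # Cl CVar # stk, map Sy (map SSub x) @ inp)"
    using reach_shift[OF reduct_None(1)] by (simp add: is_trm_def)
  moreover have "reach 1 (Sy (SSub b) # Cl CVar # stk, map Sy (map SSub x) @ inp)
      (Cl CVar # stk, map Sy (map SSub x) @ inp)"
    using reach_reduce[OF rule.intros(4)] by simp
  ultimately have "reach 2 (Cl CVar # stk, map Sy (map SSub (b # x)) @ inp)
      (Cl CVar # stk, map Sy (map SSub x) @ inp)"
    by (rule reach_trans) simp
  from reach_trans[OF this Cons] show ?case by simp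
qed (use reach_refl in simp)

lemma reach_var:
  assumes "reduct stk = None"
  shows "reach (3 * length (var_word x)) (stk, map Sy (var_word x) @ inp) (Cl CVar # stk, inp)"
proof -
  have "reach 1 (stk, map Sy (var_word x) @ inp) (Sy SVar # stk, map Sy (map SSub x) @ inp)"
    using reach_shift[OF assms] by (simp add: var_word_def)
  moreover have "reach 1 (Sy SVar # stk, map Sy (map SSub x) @ inp) (Cl CVar # stk, map Sy (map SSub x) @ inp)"
    using reach_reduce[OF rule.intros(3)] by simp
  ultimately have "reach 2 (stk, map Sy (var_word x) @ inp) (Cl CVar # stk, map Sy (map SSub x) @ inp)"
    by (rule reach_trans) simp
  from reach_trans[OF this reach_subs] show ?thesis by (simp add: var_word_def)
qed

lemma reach_op:
  assumes stk: "reduct stk = None" and s: "s \<notin> {SZero, SOne, SVar, SClose, SNeg}" "no_sub [s]"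
    and u: "reach (3 * length u) (Sy SOpen # stk, map Sy u @ Sy s # map Sy v @ Sy SClose # inp)
        (Cl a # Sy SOpen # stk, Sy s # map Sy v @ Sy SClose # inp)"
    and v: "reach (3 * length v) (Sy s # Cl a # Sy SOpen # stk, map Sy v @ Sy SClose # inp)
        (Cl b # Sy s # Cl a # Sy SOpen # stk, Sy SClose # inp)"
  shows "reach (3 * length (SOpen # u @ s # v @ [SClose])) (stk, map Sy (SOpen # u @ s # v @ [SClose]) @ inp)
    (Cl (op_cls s a b) # stk, inp)"
proof -
  have "reach 1 (stk, map Sy (SOpen # u @ s # v @ [SClose]) @ inp)
      (Sy SOpen # stk, map Sy u @ Sy s # map Sy v @ Sy SClose # inp)"
    using reach_shift[OF stk] by simp
  from reach_trans[OF this u order_refl]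
  have "reach (1 + 3 * length u) (stk, map Sy (SOpen # u @ s # v @ [SClose]) @ inp)
      (Cl a # Sy SOpen # stk, Sy s # map Sy v @ Sy SClose # inp)" .
  from reach_trans[OF this reach_shift order_refl] reduct_None(3)[of SOpen a stk]
  have "reach (1 + 3 * length u + 1) (stk, map Sy (SOpen # u @ s # v @ [SClose]) @ inp)
      (Sy s # Cl a # Sy SOpen # stk, map Sy v @ Sy SClose # inp)" by simp
  from reach_trans[OF this v order_refl]
  have "reach (1 + 3 * length u + 1 + 3 * length v) (stk, map Sy (SOpen # u @ s # v @ [SClose]) @ inp)
      (Cl b # Sy s # Cl a # Sy SOpen # stk, Sy SClose # inp)" .
  from reach_trans[OF this reach_shift order_refl] reduct_None(3)[of s b "Cl a # Sy SOpen # stk"] s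
  have "reach (1 + 3 * length u + 1 + 3 * length v + 1) (stk, map Sy (SOpen # u @ s # v @ [SClose]) @ inp)
      ([Sy SClose, Cl b, Sy s, Cl a, Sy SOpen] @ stk, inp)" by simp
  from reach_trans[OF this reach_reduce[OF rule.intros(7)]]
  show ?thesis by simp
qed

lemma reach_atom:
  assumes "reduct stk = None" "rule [Sy s] c"
  shows "reach 3 (stk, Sy s # inp) (Cl c # stk, inp)"
proof -
  have "reach 1 (Sy s # stk, inp) (Cl c # stk, inp)"
    using reach_reduce[OF assms(2), of stk inp] by simp
  from reach_trans[OF reach_shift[OF assms(1)] this] show ?thesis by simp
qed

lemma reach_trm:
  "reduct stk = None \<Longrightarrow>
    reach (3 * length (trm_word t)) (stk, map Sy (trm_word t) @ inp) (Cl (cls_trm t) # stk, inp)"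
proof (induction t arbitrary: stk inp)
  case (Var x)
  then show ?case using reach_var by simp
next
  case (Plus s t)
  from reach_op[OF Plus.prems _ _ Plus.IH(1) Plus.IH(2)] show ?case by (simp add: reduct_None)
next
  case (Minus s t)
  from reach_op[OF Minus.prems _ _ Minus.IH(1) Minus.IH(2)] show ?case by (simp add: reduct_None)
next
  case (Times s t)
  from reach_op[OF Times.prems _ _ Times.IH(1) Times.IH(2)] show ?case by (simp add: reduct_None)
qed (auto intro: reach_atom rule.intros)

lemma op_cls_Bad [simp]: "op_cls s CBad b = CBad" "op_cls s a CBad = CBad"
  by (auto simp: op_cls_def is_cls_defs)

text \<open>There is no rule for \<open>SAll\<close>, so formulas of class \<open>CBad\<close> may
  block the parser; but a class other than \<open>CBad\<close> never arises from a part of class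
  \<open>CBad\<close>, so the induction goes through.\<close>

lemma reach_fm:
  "reduct stk = None \<Longrightarrow> cls_fm \<phi> \<noteq> CBad \<Longrightarrow>
    reach (3 * length (fm_word \<phi>)) (stk, map Sy (fm_word \<phi>) @ inp) (Cl (cls_fm \<phi>) # stk, inp)"
proof (induction \<phi> arbitrary: stk inp)
  case (Rel r s t)
  from reach_op[OF Rel.prems(1) _ _ reach_trm reach_trm] show ?case by (simp add: reduct_None)
next
  case (Conj \<phi> \<psi>)
  then have "cls_fm \<phi> \<noteq> CBad" "cls_fm \<psi> \<noteq> CBad" by auto
  from reach_op[OF Conj.prems(1) _ _ Conj.IH(1)[OF _ this(1)] Conj.IH(2)[OF _ this(2)]]
  show ?case by (simp add: reduct_None)
next
  case (Disj \<phi> \<psi>)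
  then have "cls_fm \<phi> \<noteq> CBad" "cls_fm \<psi> \<noteq> CBad" by auto
  from reach_op[OF Disj.prems(1) _ _ Disj.IH(1)[OF _ this(1)] Disj.IH(2)[OF _ this(2)]]
  show ?case by (simp add: reduct_None)
next
  case (Equiv \<phi> \<psi>)
  then have "cls_fm \<phi> \<noteq> CBad" "cls_fm \<psi> \<noteq> CBad" by auto
  from reach_op[OF Equiv.prems(1) _ _ Equiv.IH(1)[OF _ this(1)] Equiv.IH(2)[OF _ this(2)]]
  show ?case by (simp add: reduct_None)
next
  case (Neg \<phi>)
  then have "cls_fm \<phi> \<noteq> CBad" by (auto simp: neg_cls_def is_qf_def)
  with Neg.IH[of "Sy SNeg # stk" inp]
  have "reach (3 * length (fm_word \<phi>)) (Sy SNeg # stk, map Sy (fm_word \<phi>) @ inp)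
      ([Cl (cls_fm \<phi>), Sy SNeg] @ stk, inp)"
    by (simp add: reduct_None)
  from reach_trans[OF reach_trans[OF reach_shift[OF Neg.prems(1)] this order_refl]
      reach_reduce[OF rule.intros(5)]]
  show ?case by simp
next
  case (Ex x \<phi>)
  then have "cls_fm \<phi> \<noteq> CBad" by (auto simp: ex_cls_def)
  with Ex.IH[of "Cl CVar # Sy SEx # stk" inp]
  have 1: "reach (3 * length (fm_word \<phi>)) (Cl CVar # Sy SEx # stk, map Sy (fm_word \<phi>) @ inp)
      ([Cl (cls_fm \<phi>), Cl CVar, Sy SEx] @ stk, inp)"
    by (simp add: reduct_None)
  have 2: "reach (3 * length (var_word x)) (Sy SEx # stk, map Sy (var_word x) @ (map Sy (fm_word \<phi>) @ inp))
      (Cl CVar # Sy SEx # stk, map Sy (fm_word \<phi>) @ inp)"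
    by (rule reach_var) (simp add: reduct_None)
  from reach_trans[OF reach_trans[OF reach_trans[OF reach_shift[OF Ex.prems(1)] 2 order_refl] 1 order_refl]
      reach_reduce[OF rule.intros(6)]]
  show ?case by simp
qed simp

lemma parse_fm_word:
  assumes "cls_fm \<phi> \<noteq> CBad"
  shows "parse (map Sy (fm_word \<phi>)) = ([Cl (cls_fm \<phi>)], [])"
proof -
  from reach_fm[of "[]" \<phi> "[]", OF _ assms] obtain n where n: "n \<le> 3 * length (fm_word \<phi>)"
    "(pstep ^^ n) ([], map Sy (fm_word \<phi>)) = ([Cl (cls_fm \<phi>)], [])"
    by (auto simp: reach_def)
  have "(pstep ^^ i) ([Cl c], []) = ([Cl c], [])" for i c
    by (induction i) (auto simp: pstep_def)
  with n have "(pstep ^^ ((3 * length (fm_word \<phi>) - n) + n)) ([], map Sy (fm_word \<phi>)) = ([Cl (cls_fm \<phi>)], [])"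
    by (simp only: funpow_add comp_apply)
  with n(1) show ?thesis by (simp add: parse_def)
qed

section \<open>Soundness of the parser\<close>

primrec expands :: "token \<Rightarrow> token list \<Rightarrow> bool" where
  "expands (Sy s) w \<longleftrightarrow> w = [Sy s]"
| "expands (Cl c) w \<longleftrightarrow> c = CBad \<or> (\<exists>t. w = map Sy (trm_word t) \<and> cls_trm t = c)
     \<or> (\<exists>\<phi>. w = map Sy (fm_word \<phi>) \<and> cls_fm \<phi> = c)"
| "expands Err w \<longleftrightarrow> w = [Err]"
| "expands Done w \<longleftrightarrow> w = [Done]"

fun stack_expands :: "token list \<Rightarrow> token list \<Rightarrow> bool" where
  "stack_expands [] w \<longleftrightarrow> w = []"
| "stack_expands (x # stk) w \<longleftrightarrow> (\<exists>u v. w = u @ v \<and> stack_expands stk u \<and> expands x v)"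

lemma expands_trm:
  "is_trm c \<Longrightarrow> expands (Cl c) w \<longleftrightarrow> (\<exists>t. w = map Sy (trm_word t) \<and> cls_trm t = c)"
  using not_is_trm_cls_fm by (auto simp: is_trm_def[of CBad])

lemma expands_fm:
  "\<not> is_trm c \<Longrightarrow> c \<noteq> CBad \<Longrightarrow> expands (Cl c) w \<longleftrightarrow> (\<exists>\<phi>. w = map Sy (fm_word \<phi>) \<and> cls_fm \<phi> = c)"
  using is_trm_cls_trm by auto

text \<open>\<open>CBad\<close> may stand for any word, as nothing is claimed about rejected input;
  so a witness is due only if the operator fits the classes of both operands.\<close>

lemma expands_op:
  assumes "expands (Cl a) u" "expands (Cl b) v"
  shows "expands (Cl (op_cls s a b)) (Sy SOpen # u @ Sy s # v @ [Sy SClose])"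
proof (cases "op_cls s a b = CBad")
  case bad: False
  then consider "is_trm a" "is_trm b" "s \<in> {SPlus, SMinus, STimes} \<union> range SRel"
    | "is_qf a" "is_qf b" "s \<in> {SConj, SDisj, SEquiv}"
    by (cases s) (auto simp: op_cls_def is_qf_def is_sys_def split: if_splits)
  then show ?thesis
  proof cases
    case 1
    then obtain t t' where t: "u = map Sy (trm_word t)" "cls_trm t = a" "v = map Sy (trm_word t')" "cls_trm t' = b"
      using assms expands_trm by metis
    consider "s = SPlus" | "s = SMinus" | "s = STimes" | r where "s = SRel r"
      using 1(3) by auto
    then show ?thesis
    proof cases
      case 1
      with t show ?thesis by (auto intro!: exI[of _ "Plus t t'"])
    next
      case 2
      with t show ?thesis by (auto intro!: exI[of _ "Minus t t'"])
    next
      case 3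
      with t show ?thesis by (auto intro!: exI[of _ "Times t t'"])
    next
      case (4 r)
      with t show ?thesis by (auto intro!: exI[of _ "Rel r t t'"])
    qed
  next
    case 2
    then have "\<not> is_trm a" "\<not> is_trm b" "a \<noteq> CBad" "b \<noteq> CBad" by (auto simp: is_qf_def is_trm_def)
    then obtain t t' where t: "u = map Sy (fm_word t)" "cls_fm t = a" "v = map Sy (fm_word t')" "cls_fm t' = b"
      using assms expands_fm by metis
    consider "s = SConj" | "s = SDisj" | "s = SEquiv"
      using 2(3) by auto
    then show ?thesis
    proof cases
      case 1
      with t show ?thesis by (auto intro!: exI[of _ "Conj t t'"])
    next
      case 2
      with t show ?thesis by (auto intro!: exI[of _ "Disj t t'"])
    next
      case 3
      with t show ?thesis by (auto intro!: exI[of _ "Equiv t t'"])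
    qed
  qed
qed simp

lemma stack_expands_reduce:
  assumes "rule u c" "stack_expands (u @ r) w"
  shows "stack_expands (Cl c # r) w"
  using assms
proof (induction rule: rule.cases)
  case 1
  then show ?case by (fastforce intro!: exI[of _ Zero])
next
  case 2
  then show ?case by (fastforce intro!: exI[of _ One])
next
  case 3
  then show ?case by (fastforce simp: var_word_def intro!: exI[of _ "Var []"])
next
  case (4 b)
  then obtain w1 w2 where w: "w = (w1 @ w2) @ [Sy (SSub b)]" "stack_expands r w1" "expands (Cl CVar) w2"
    by (simp only: append_Cons append_Nil stack_expands.simps expands.simps(1)) blast
  then obtain x where "w2 = map Sy (var_word x)"
    using expands_trm[of CVar w2] by (auto simp: is_trm_def cls_trm_eq)
  then have "expands (Cl CVar) (w2 @ [Sy (SSub b)])"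
    by (auto simp: var_word_def intro!: exI[of _ "Var (x @ [b])"])
  with w 4 show ?case by (auto simp del: expands.simps)
next
  case (5 c')
  then obtain w1 w2 where w: "w = (w1 @ [Sy SNeg]) @ w2" "stack_expands r w1" "expands (Cl c') w2"
    by (simp only: append_Cons append_Nil stack_expands.simps expands.simps(1)) blast
  have "expands (Cl (neg_cls c')) (Sy SNeg # w2)"
  proof (cases "c' = CBad")
    case False
    with 5 w(3) obtain \<phi> where "w2 = map Sy (fm_word \<phi>)" "cls_fm \<phi> = c'"
      using expands_fm by blast
    then show ?thesis by (auto intro!: exI[of _ "Neg \<phi>"])
  qed (simp add: neg_cls_def is_qf_def)
  with w 5 show ?case by (auto simp del: expands.simps)
next
  case (6 c')
  then obtain w1 w2 w3 where w: "w = ((w1 @ [Sy SEx]) @ w2) @ w3" "stack_expands r w1"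
      "expands (Cl CVar) w2" "expands (Cl c') w3"
    by (simp only: append_Cons append_Nil stack_expands.simps expands.simps(1)) blast
  then obtain x where x: "w2 = map Sy (var_word x)"
    using expands_trm[of CVar w2] by (auto simp: is_trm_def cls_trm_eq)
  have "expands (Cl (ex_cls c')) (Sy SEx # w2 @ w3)"
  proof (cases "c' = CBad")
    case False
    with 6 w(4) obtain \<phi> where "w3 = map Sy (fm_word \<phi>)" "cls_fm \<phi> = c'"
      using expands_fm by blast
    with x show ?thesis by (auto intro!: exI[of _ "Ex x \<phi>"])
  qed (simp add: ex_cls_def)
  with w 6 show ?case by (auto simp del: expands.simps)
next
  case (7 b s a)
  then obtain w1 w2 w3 where w: "w = ((((w1 @ [Sy SOpen]) @ w2) @ [Sy s]) @ w3) @ [Sy SClose]"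
      "stack_expands r w1" "expands (Cl a) w2" "expands (Cl b) w3"
    by (simp only: append_Cons append_Nil stack_expands.simps expands.simps(1)) blast
  with 7 expands_op[OF w(3,4), of s] show ?case by (auto simp del: expands.simps)
qed

text \<open>The part already read is an expansion of the stack. The unread part must not contain
  class letters, which would pass for finished subterms or subformulas.\<close>

definition consistent :: "token list \<Rightarrow> token list \<times> token list \<Rightarrow> bool" where
  "consistent w c \<longleftrightarrow> (\<exists>u. stack_expands (fst c) u \<and> u @ snd c = w) \<and> snd c \<in> lists (- range Cl)"

lemma consistent_pstep: "consistent w c \<Longrightarrow> consistent w (pstep c)"
proof -
  assume *: "consistent w c"
  obtain stk inp where c: "c = (stk, inp)" by fastforce
  then obtain v where v: "stack_expands stk v" "v @ inp = w" "inp \<in> lists (- range Cl)"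
    using * by (auto simp: consistent_def)
  show ?thesis
  proof (cases stk rule: reduct_cases)
    case 1
    show ?thesis
    proof (cases inp)
      case (Cons x inp')
      then have "expands x [x]" using v(3) by (cases x) auto
      with v Cons have "stack_expands (x # stk) (v @ [x])" by auto
      with v Cons 1 c show ?thesis
        by (auto simp: consistent_def pstep_def simp del: stack_expands.simps intro!: exI[of _ "v @ [x]"])
    qed (use * c 1 in \<open>simp add: pstep_def\<close>)
  next
    case (2 u d r)
    with v stack_expands_reduce[of u d r v] c show ?thesis
      by (auto simp: consistent_def pstep_def simp del: stack_expands.simps)
  qed
qed

lemma parse_sound:
  assumes "parse w = ([Cl c], [])" "w \<in> lists (- range Cl)" "\<not> is_trm c" "c \<noteq> CBad"
  shows "\<exists>\<phi>. w = map Sy (fm_word \<phi>) \<and> cls_fm \<phi> = c"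
proof -
  have "consistent w ((pstep ^^ n) ([], w))" for n
    by (induction n) (use assms(2) in \<open>auto simp: consistent_pstep, auto simp: consistent_def\<close>)
  then have "consistent w ([Cl c], [])"
    using assms(1) by (metis parse_def)
  then have "expands (Cl c) w" by (auto simp: consistent_def simp del: expands.simps)
  with expands_fm[OF assms(3,4)] show ?thesis by simp
qed

lemma accepts_iff:
  assumes "\<And>c. c \<in> A \<Longrightarrow> \<not> is_trm c \<and> c \<noteq> CBad" "w \<in> lists (- range Cl)"
  shows "accepts A w \<longleftrightarrow> (\<exists>\<phi>. w = map Sy (fm_word \<phi>) \<and> cls_fm \<phi> \<in> A)"
proof
  assume "accepts A w"
  then show "\<exists>\<phi>. w = map Sy (fm_word \<phi>) \<and> cls_fm \<phi> \<in> A"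
    using parse_sound assms unfolding accepts_def by blast
next
  assume "\<exists>\<phi>. w = map Sy (fm_word \<phi>) \<and> cls_fm \<phi> \<in> A"
  then show "accepts A w"
    using parse_fm_word assms(1) unfolding accepts_def by blast
qed

section \<open>The parser as a stack program\<close>

definition shift_store :: "store \<Rightarrow> store" where
  "shift_store s = (if peek (s 2) = 0 then s else s(2 := tl (s 2), 1 := peek (s 2) # s 1))"

definition pstep_top :: "nat list \<Rightarrow> store \<Rightarrow> store" where
  "pstep_top u s = (case reduct (map letter_token u) of
     Some (n, c) \<Rightarrow> s(1 := (token_letter (Cl c) # drop n u) @ s 1)
   | None \<Rightarrow> shift_store (s(1 := u @ s 1)))"

definition pstep_store :: "store \<Rightarrow> store" where
  "pstep_store s = pstep_top (take 5 (s 1)) (s(1 := drop 5 (s 1)))"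

lemma ptime_shift_store: "ptime shift_store"
proof -
  have "ptime (\<lambda>s. (\<lambda>a s. if a = 0 then s else s(2 := tl (s 2), 1 := a # s 1)) (peek (s 2)) s)"
  proof (rule ptime_switch)
    show "ptime (\<lambda>s. if a = 0 then s else s(2 := tl (s 2), 1 := a # s 1))" if "a \<le> 40" for a
    proof (cases "a = 0")
      case False
      then have "ptime (\<lambda>s. (s(2 := tl (s 2)))(1 := a # (s(2 := tl (s 2))) 1))"
        using that by (intro ptime_comp[OF ptime_pop ptime_push]) auto
      with False show ?thesis by simp
    qed (simp add: ptime_id)
  qed simp
  then show ?thesis by (simp add: shift_store_def[abs_def])
qed

lemma ptime_pstep_top: "set u \<subseteq> {1..40} \<Longrightarrow> ptime (pstep_top u)"
proof (cases "reduct (map letter_token u)")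
  case None
  moreover assume "set u \<subseteq> {1..40}"
  ultimately show ?thesis
    unfolding pstep_top_def[abs_def] using ptime_comp[OF ptime_push_list[of 1 u] ptime_shift_store] by simp
next
  case (Some p)
  assume u: "set u \<subseteq> {1..40}"
  have "set (token_letter (Cl (snd p)) # drop (fst p) u) \<subseteq> {1..40}"
    using token_letter_range[of "Cl (snd p)"] u set_drop_subset[of "fst p" u] by auto
  from ptime_push_list[OF _ this, of 1] Some show ?thesis
    unfolding pstep_top_def[abs_def] by (simp add: case_prod_beta del: token_letter.simps)
qed

lemma ptime_pstep_store: "ptime pstep_store"
  unfolding pstep_store_def[abs_def] by (rule ptime_lookahead) (simp, rule ptime_pstep_top)

lemma pstep_store_indep: "pstep_store (s(8 := x)) = (pstep_store s)(8 := x)"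
  by (simp add: pstep_store_def pstep_top_def shift_store_def fun_upd_twist split: option.split)

lemma pstep_store_growth: "store_size (pstep_store s) \<le> store_size s + 2"
proof -
  let ?u = "take 5 (s 1)" and ?s = "s(1 := drop 5 (s 1))"
  have size: "store_size (?s(1 := x @ drop 5 (s 1))) + length (s 1)
      = store_size s + length x + length (drop 5 (s 1))" for x
    using store_size_upd[of 1 s "x @ drop 5 (s 1)"] by simp
  have len: "length (s 1) = length ?u + length (drop 5 (s 1))" by simp
  have shift: "store_size (shift_store t) \<le> store_size t + 1" for t
    using store_size_upd[of 2 t "tl (t 2)"] store_size_upd[of 1 "t(2 := tl (t 2))" "peek (t 2) # t 1"]
    by (cases "t 2") (auto simp: shift_store_def)
  show ?thesis
  proof (cases "reduct (map letter_token ?u)")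
    case None
    then have "pstep_store s = shift_store (?s(1 := ?u @ drop 5 (s 1)))"
      by (simp add: pstep_store_def pstep_top_def)
    moreover have "store_size (?s(1 := ?u @ drop 5 (s 1))) = store_size s"
      using size[of ?u] len by linarith
    ultimately show ?thesis using shift[of "?s(1 := ?u @ drop 5 (s 1))"] by simp
  next
    case (Some p)
    let ?x = "token_letter (Cl (snd p)) # drop (fst p) ?u"
    have "pstep_store s = ?s(1 := ?x @ drop 5 (s 1))"
      using Some by (simp add: pstep_store_def pstep_top_def case_prod_beta)
    moreover have "length ?x \<le> Suc (length ?u)" by (simp only: list.size length_drop)
    ultimately obtain x where x: "pstep_store s = ?s(1 := x @ drop 5 (s 1))" "length x \<le> Suc (length ?u)"
      by blast
    show ?thesis unfolding x(1) using size[of x] x(2) len by linarith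
  qed
qed

lemma pstep_store:
  assumes "s 1 = map token_letter stk" "s 2 = map token_letter inp"
  shows "pstep_store s = s(1 := map token_letter (fst (pstep (stk, inp))),
    2 := map token_letter (snd (pstep (stk, inp))))"
proof -
  have red: "reduct (map letter_token (take 5 (s 1))) = reduct stk"
    unfolding assms(1) take_map map_letter_token by (rule reduct_take)
  show ?thesis
  proof (cases stk rule: reduct_cases)
    case 1
    have "s(1 := take 5 (s 1) @ drop 5 (s 1)) = s" by (simp only: append_take_drop_id fun_upd_triv)
    then have "pstep_store s = shift_store s"
      using 1 by (simp add: pstep_store_def pstep_top_def red del: One_nat_def)
    with 1 assms show ?thesis
      by (cases inp) (auto simp: pstep_def shift_store_def fun_eq_iff)
  next
    case (2 v c r)
    have n: "length v \<le> 5" using rule_length[OF 2(2)] by simp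
    have rest: "drop (length v) (take 5 (s 1)) @ drop 5 (s 1) = map token_letter r"
    proof -
      have "drop (length v) (take 5 stk) @ drop 5 stk = r"
        using n by (simp add: 2(1))
      then show ?thesis
        unfolding assms(1) take_map drop_map map_append[symmetric] by (rule arg_cong)
    qed
    have "pstep_store s = s(1 := token_letter (Cl c) # drop (length v) (take 5 (s 1)) @ drop 5 (s 1))"
      by (simp add: pstep_store_def pstep_top_def red 2(3) del: One_nat_def token_letter.simps)
    moreover have "pstep (stk, inp) = (Cl c # r, inp)"
      using 2(1) reduct_Some[OF 2(2), of r] by (simp add: pstep_def)
    ultimately show ?thesis
      unfolding rest using assms(2) by (simp add: fun_eq_iff)
  qed
qed

lemma pstep_store_funpow:
  assumes "s 1 = map token_letter stk" "s 2 = map token_letter inp"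
  shows "(pstep_store ^^ n) s = s(1 := map token_letter (fst ((pstep ^^ n) (stk, inp))),
    2 := map token_letter (snd ((pstep ^^ n) (stk, inp))))"
proof (induction n)
  case 0
  then show ?case using assms by (simp add: fun_upd_idem)
next
  case (Suc n)
  let ?c = "(pstep ^^ n) (stk, inp)"
  have "(pstep_store ^^ Suc n) s = pstep_store (s(1 := map token_letter (fst ?c), 2 := map token_letter (snd ?c)))"
    by (simp only: funpow.simps comp_apply Suc)
  also have "\<dots> = s(1 := map token_letter (fst (pstep ?c)), 2 := map token_letter (snd (pstep ?c)))"
    by (subst pstep_store[of _ "fst ?c" "snd ?c"]) (simp_all add: fun_eq_iff)
  finally show ?case by (simp only: funpow.simps comp_apply)
qed

text \<open>Each \<open>load\<close> adds the length of the input to the loop counter: three of them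
  pay for the parser, two for the translation.\<close>

definition load :: "store \<Rightarrow> store" where
  "load s = s(9 := [], 8 := s 0 @ s 8)"

definition verdict :: "cls set \<Rightarrow> nat list \<Rightarrow> store \<Rightarrow> store" where
  "verdict A u s = (if \<exists>c\<in>A. u = [token_letter (Cl c)] then s else s(0 := []))"

text \<open>Two letters of stack 1 suffice to see whether an accepted class stands there alone.
  Rejected input is replaced by the empty stack, which no formula yields.\<close>

definition check_store :: "cls set \<Rightarrow> store \<Rightarrow> store" where
  "check_store A s =
     (let s1 = load (load (load (s(9 := [], 2 := s 0 @ s 2))));
          s2 = ((pstep_store ^^ length (s1 8)) s1)(8 := []);
          s3 = (if peek (s2 2) \<in> {0} then verdict A (take 2 (s2 1)) (s2(1 := drop 2 (s2 1))) else s2(0 := []))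
      in s3(1 := [], 2 := []))"

lemma ptime_check_store: "ptime (check_store A)"
proof -
  have load: "ptime load"
    unfolding load_def[abs_def] by (rule ptime_copy) auto
  have loop: "ptime (\<lambda>s. ((pstep_store ^^ length (s 8)) s)(8 := []))"
    by (rule ptime_for_growth[OF ptime_pstep_store _ pstep_store_indep, of 2])
      (auto intro: pstep_store_growth[unfolded add_2_eq_Suc'])
  have verdict: "ptime (verdict A u)" for u
    unfolding verdict_def[abs_def] using ptime_id ptime_clear[of 0]
    by (cases "\<exists>c\<in>A. u = [token_letter (Cl c)]") auto
  have if_empty: "ptime (\<lambda>s. if peek (s 2) \<in> {0} then verdict A (take 2 (s 1)) (s(1 := drop 2 (s 1))) else s(0 := []))"
    by (rule ptime_if[OF _ ptime_lookahead ptime_clear]) (auto intro: verdict)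
  have copy: "ptime (\<lambda>s. s(9 := [], 2 := s 0 @ s 2))"
    by (rule ptime_copy) auto
  have clear: "ptime (\<lambda>s. s(1 := [], 2 := []))"
    by (rule ptime_comp[OF ptime_clear ptime_clear]) auto
  show ?thesis
    unfolding check_store_def[abs_def] Let_def
    by (rule ptime_comp[OF ptime_comp[OF ptime_comp[OF ptime_comp[OF ptime_comp[OF ptime_comp[OF
      copy load] load] load] loop] if_empty] clear])
qed

lemma check_store:
  "check_store A (blank_store(0 := map token_letter w))
    = blank_store(0 := if accepts A w then map token_letter w else [])"
proof -
  let ?w = "map token_letter w"
  define s1 where "s1 = blank_store(0 := ?w, 2 := ?w, 8 := ?w @ ?w @ ?w)"
  have load: "load (load (load ((blank_store(0 := ?w))(9 := [], 2 := (blank_store(0 := ?w)) 0 @ (blank_store(0 := ?w)) 2)))) = s1"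
    by (auto simp: load_def s1_def fun_eq_iff)
  have "(pstep_store ^^ length (s1 8)) s1 = s1(1 := map token_letter (fst (parse w)), 2 := map token_letter (snd (parse w)))"
  proof -
    have "length (s1 8) = 3 * length w" by (simp add: s1_def)
    show ?thesis
      unfolding \<open>length (s1 8) = 3 * length w\<close>
      by (subst pstep_store_funpow[of _ "[]" w]) (auto simp: s1_def parse_def)
  qed
  then have s2: "((pstep_store ^^ length (s1 8)) s1)(8 := [])
      = blank_store(0 := ?w, 1 := map token_letter (fst (parse w)), 2 := map token_letter (snd (parse w)))"
    by (auto simp: s1_def fun_eq_iff)
  have inj: "map token_letter x = [token_letter y] \<longleftrightarrow> x = [y]" for x y
    using inj_token_letter by (auto simp: inj_def)
  have t2: "take 2 x = [a] \<longleftrightarrow> x = [a]" for a and x :: "nat list"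
    by (cases x) (auto simp: take_Cons' )
  have p: "peek (map token_letter x) = 0 \<longleftrightarrow> x = []" for x
    by (cases x) auto
  show ?thesis
    unfolding check_store_def Let_def load s2
    by (cases "parse w") (auto simp: verdict_def accepts_def p t2 inj fun_eq_iff simp del: token_letter.simps)
qed

section \<open>Output and the common form of the reductions\<close>

definition letter_bits :: "nat \<Rightarrow> nat list" where
  "letter_bits a = (case letter_token a of Sy s \<Rightarrow> map bit_letter (sym_bits s) | _ \<Rightarrow> [])"

text \<open>Draining reverses, so the word is first poured to stack 1.\<close>

definition encode_store :: "store \<Rightarrow> store" where
  "encode_store s =
     (let s1 = s(1 := []); s2 = s1(0 := [], 1 := rev (s1 0) @ s1 1)
      in s2(1 := [], 0 := concat (map letter_bits (rev (s2 1))) @ s2 0))"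

lemma ptime_encode_store: "ptime encode_store"
proof -
  have "ptime (\<lambda>s. s(1 := [], 0 := concat (map letter_bits (rev (s 1))) @ s 0))"
    by (rule ptime_drain_all) (auto simp: letter_bits_def bit_letter_def split: token.splits)
  from ptime_comp[OF ptime_comp[OF ptime_clear ptime_pour_all] this, of 1 0 1] show ?thesis
    unfolding encode_store_def[abs_def] Let_def by simp
qed

lemma encode_store: "s 0 = map token_letter (map Sy v) \<Longrightarrow>
    encode_store s 0 = map bit_letter (concat (map sym_bits v))"
  by (simp add: encode_store_def Let_def letter_bits_def map_concat o_def del: token_letter.simps)

lemma decode_no_cls: "decode w \<in> lists (- range Cl)"
  by (induction w rule: decode.induct) (auto simp: chunk_def)

lemma fm_word_neq_Nil [simp]: "fm_word \<phi> \<noteq> []"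
  by (cases \<phi>) auto

text \<open>Syntactically incorrect inputs are mapped to the empty word, which encodes no formula.\<close>

lemma polytime_transform:
  assumes G: "ptime G" and A: "\<And>c. c \<in> A \<Longrightarrow> \<not> is_trm c \<and> c \<noteq> CBad"
    and T: "\<And>\<phi>. cls_fm \<phi> \<in> A \<Longrightarrow>
      G (blank_store(0 := map token_letter (map Sy (fm_word \<phi>)))) 0 = map token_letter (map Sy (fm_word (T \<phi>)))"
  shows "\<exists>f. polytime f \<and> (\<forall>\<phi>. cls_fm \<phi> \<in> A \<longrightarrow> f (encode \<phi>) = encode (T \<phi>)) \<and>
    (\<forall>w. (\<nexists>\<phi>. cls_fm \<phi> \<in> A \<and> w = encode \<phi>) \<longrightarrow> f w = [])"
proof -
  define F where "F = (\<lambda>s. encode_store ((\<lambda>s. if peek (s 0) \<in> {0} then s else G s) (check_store A (decode_store s))))"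
  define f where "f w = (if \<exists>\<phi>. cls_fm \<phi> \<in> A \<and> w = encode \<phi>
      then encode (T (THE \<phi>. w = encode \<phi>)) else [])" for w
  have f_encode: "f (encode \<phi>) = encode (T \<phi>)" if "cls_fm \<phi> \<in> A" for \<phi>
  proof -
    have "(THE \<psi>. encode \<phi> = encode \<psi>) = \<phi>" using encode_inj by blast
    with that show ?thesis by (auto simp: f_def)
  qed
  have "ptime F"
    unfolding F_def
    by (rule ptime_comp[OF ptime_comp[OF ptime_comp[OF ptime_decode_store ptime_check_store]
      ptime_if[OF _ ptime_id G]] ptime_encode_store]) simp
  moreover have "F (word_store w) 0 = map bit_letter (f w)" for w
  proof (cases "\<exists>\<phi>. cls_fm \<phi> \<in> A \<and> w = encode \<phi>")
    case True
    then obtain \<phi> where \<phi>: "cls_fm \<phi> \<in> A" "w = encode \<phi>" by blast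
    then have "accepts A (decode w)"
      using accepts_iff[of A "decode w", OF A decode_no_cls] decode_encode by blast
    then have "check_store A (decode_store (word_store w)) = blank_store(0 := map token_letter (map Sy (fm_word \<phi>)))"
      unfolding \<phi>(2) by (simp only: decode_store check_store decode_encode if_True)
    moreover have "peek (map token_letter (map Sy (fm_word \<phi>))) \<noteq> 0"
      by (cases "fm_word \<phi>") auto
    ultimately have "F (word_store w) = encode_store (G (blank_store(0 := map token_letter (map Sy (fm_word \<phi>)))))"
      by (simp add: F_def)
    then have "F (word_store w) 0 = map bit_letter (concat (map sym_bits (fm_word (T \<phi>))))"
      by (simp only: encode_store T[OF \<phi>(1)])
    then show ?thesis using f_encode[OF \<phi>(1)] \<phi>(2) by (simp add: encode_def)
  next
    case False
    then have "\<not> accepts A (decode w)"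
      using accepts_iff[of A "decode w", OF A decode_no_cls] decode_eq_fm_word by blast
    then have "check_store A (decode_store (word_store w)) = blank_store(0 := [])"
      by (simp add: decode_store check_store)
    then have "F (word_store w) = encode_store (blank_store(0 := []))"
      by (simp add: F_def)
    then show ?thesis
      using False encode_store[of "blank_store(0 := [])" "[]"] by (auto simp: f_def)
  qed
  ultimately have "polytime f" by (rule ptime_polytime)
  with f_encode show ?thesis by (intro exI[of _ f]) (auto simp: f_def)
qed

lemma encode_neq_Nil [simp]: "encode \<phi> \<noteq> []"
proof -
  have "sym_bits s \<noteq> []" for s using length_sym_bits[of s] by (metis length_0_conv zero_neq_numeral)
  then show ?thesis by (cases "fm_word \<phi>") (auto simp: encode_def)
qed

text \<open>The reduction is the identity on words of the accepted classes and sends every other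
  word to the empty one, a NO-instance on both sides; truth itself is never examined.\<close>

lemma syntactic_restriction_reduces:
  assumes A: "\<And>c. c \<in> A \<Longrightarrow> \<not> is_trm c \<and> c \<noteq> CBad"
  shows "{encode \<phi> | \<phi>. cls_fm \<phi> \<in> A \<and> P \<phi>} \<le>\<^sub>p {encode \<phi> | \<phi>. P \<phi>}"
proof -
  obtain f where f: "polytime f" "\<And>\<phi>. cls_fm \<phi> \<in> A \<Longrightarrow> f (encode \<phi>) = encode \<phi>"
      "\<And>w. \<nexists>\<phi>. cls_fm \<phi> \<in> A \<and> w = encode \<phi> \<Longrightarrow> f w = []"
    using polytime_transform[where A = A and T = "\<lambda>\<phi>. \<phi>", OF ptime_id A] by auto
  have "w \<in> {encode \<phi> | \<phi>. cls_fm \<phi> \<in> A \<and> P \<phi>} \<longleftrightarrow> f w \<in> {encode \<phi> | \<phi>. P \<phi>}" for w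
  proof (cases "\<exists>\<phi>. cls_fm \<phi> \<in> A \<and> w = encode \<phi>")
    case True
    then have "f w = w" using f(2) by blast
    with True show ?thesis by (auto dest: encode_inj)
  next
    case False
    then show ?thesis using f(3)[OF False] encode_neq_Nil[symmetric] by auto
  qed
  with f(1) show ?thesis unfolding reduces_def by blast
qed

abbreviation etr_classes :: "cls set" where
  "etr_classes \<equiv> {CEqZ, CExEqZ, CSys, CExSys, CQf, CExQf}"

lemma FEASIBLE_eq: "FEASIBLE = {encode \<phi> | \<phi>. cls_fm \<phi> \<in> {CEqZ, CExEqZ} \<and> true_sentence \<phi>}"
  unfolding FEASIBLE_def feasible_cls by blast

lemma INEQ_eq: "INEQ = {encode \<phi> | \<phi>. cls_fm \<phi> \<in> {CEqZ, CExEqZ, CSys, CExSys} \<and> true_sentence \<phi>}"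
  unfolding INEQ_def ineq_cls by blast

lemma ETR_eq: "ETR = {encode \<phi> | \<phi>. cls_fm \<phi> \<in> etr_classes \<and> true_sentence \<phi>}"
  unfolding ETR_def etr_cls by blast

lemma FEASIBLE_reduces_ETR: "FEASIBLE \<le>\<^sub>p ETR"
proof -
  \<comment> \<open>The added membership in \<open>etr_classes\<close> follows from the smaller
    class; it gives both problems the same predicate, as the lemma on restrictions demands.\<close>
  have *: "FEASIBLE = {encode \<phi> | \<phi>. cls_fm \<phi> \<in> {CEqZ, CExEqZ} \<and>
      (cls_fm \<phi> \<in> etr_classes \<and> true_sentence \<phi>)}"
    unfolding FEASIBLE_eq by blast
  show ?thesis
    unfolding * ETR_eq by (rule syntactic_restriction_reduces) (auto simp: is_trm_def)
qed

lemma INEQ_reduces_ETR: "INEQ \<le>\<^sub>p ETR"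
proof -
  have *: "INEQ = {encode \<phi> | \<phi>. cls_fm \<phi> \<in> {CEqZ, CExEqZ, CSys, CExSys} \<and>
      (cls_fm \<phi> \<in> etr_classes \<and> true_sentence \<phi>)}"
    unfolding INEQ_eq by blast
  show ?thesis
    unfolding * ETR_eq by (rule syntactic_restriction_reduces) (auto simp: is_trm_def)
qed

section \<open>From formulas to one polynomial equation\<close>

text \<open>The first subscript bit separates the original variables from the auxiliary
  ones.\<close>

definition ov :: "var \<Rightarrow> var" where
  "ov x = True # x"

text \<open>Unary node numbers let a program form the next name with one push, at the price of a
  polynomially longer output.\<close>

definition ones :: "nat \<Rightarrow> bool list" where
  "ones j = replicate j True"

text \<open>Node \<open>j\<close> has the variables \<open>z\<^sub>j\<close> (its value), \<open>c\<^sub>j\<close>, \<open>u\<^sub>j\<close> and \<open>v\<^sub>j\<close> (used for comparisons).\<close>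

definition av :: "bool \<Rightarrow> bool \<Rightarrow> nat \<Rightarrow> var" where
  "av k l j = False # k # l # ones j"

abbreviation zv :: "nat \<Rightarrow> var" where
  "zv \<equiv> av False False"

definition node_set :: "nat \<Rightarrow> var set" where
  "node_set j = {av k l j | k l. True}"

lemma ones_inj [simp]: "ones i = ones j \<longleftrightarrow> i = j"
  by (auto simp: ones_def)

lemma av_inj [simp]: "av k l i = av k' l' j \<longleftrightarrow> k = k' \<and> l = l' \<and> i = j"
  by (auto simp: av_def)

lemma av_node_set [simp]: "av k l i \<in> node_set j \<longleftrightarrow> i = j"
  by (auto simp: node_set_def)

lemma ov_av_simps [simp]: "ov x = ov y \<longleftrightarrow> x = y" "ov x \<noteq> av k l j" "av k l j \<noteq> ov x"
  by (auto simp: ov_def av_def)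

text \<open>
  Constraints are polynomials over symbolic variables \<open>(p, r)\<close>, standing for the variable with
  subscript \<open>p @ \<rho> r\<close>, where \<open>\<rho>\<close> gives the contents of the registers 2, 3 (the operands) and
  4 (the result).
\<close>

type_synonym factor = "bool list \<times> nat"
type_synonym tpoly = "(int \<times> factor list) list"
type_synonym item = "sym \<times> (nat \<Rightarrow> bool list)"

abbreviation (input) xA :: factor where "xA \<equiv> ([True], 2)"
abbreviation (input) zA :: factor where "zA \<equiv> ([False, False, False], 2)"
abbreviation (input) zB :: factor where "zB \<equiv> ([False, False, False], 3)"
abbreviation (input) zC :: factor where "zC \<equiv> ([False, False, False], 4)"
abbreviation (input) cC :: factor where "cC \<equiv> ([False, False, True], 4)"
abbreviation (input) uC :: factor where "uC \<equiv> ([False, True, False], 4)"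
abbreviation (input) vC :: factor where "vC \<equiv> ([False, True, True], 4)"

text \<open>Twice the truth value of \<open>a r b\<close> is \<open>\<alpha> + \<beta> c\<^sup>2 + \<gamma> c\<close> for \<open>c = sgn (b - a)\<close>.\<close>

primrec rel_coeffs :: "rel \<Rightarrow> int \<times> int \<times> int" where
  "rel_coeffs Le = (2, -1, 1)"
| "rel_coeffs Lt = (0, 1, 1)"
| "rel_coeffs Ge = (2, -1, -1)"
| "rel_coeffs Gt = (0, 1, -1)"
| "rel_coeffs Eq = (2, -2, 0)"
| "rel_coeffs Ne = (0, 2, 0)"

text \<open>\<open>SClose\<close> stands for the requirement that the whole formula is true.\<close>

fun constraints :: "sym \<Rightarrow> tpoly list" where
  "constraints SZero = [[(1, [zC])]]"
| "constraints SOne = [[(1, [zC]), (-1, [])]]"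
| "constraints SVar = [[(1, [zC]), (-1, [xA])]]"
| "constraints SPlus = [[(1, [zC]), (-1, [zA]), (-1, [zB])]]"
| "constraints SMinus = [[(1, [zC]), (-1, [zA]), (1, [zB])]]"
| "constraints STimes = [[(1, [zC]), (-1, [zA, zB])]]"
| "constraints SConj = [[(1, [zC]), (-1, [zA, zB])]]"
| "constraints SDisj = [[(1, [zC]), (-1, [zA]), (-1, [zB]), (1, [zA, zB])]]"
| "constraints SNeg = [[(1, [zC]), (-1, []), (1, [zA])]]"
| "constraints SEquiv = [[(1, [zC]), (-1, []), (1, [zA]), (1, [zB]), (-2, [zA, zB])]]"
| "constraints (SRel r) = (case rel_coeffs r of (\<alpha>, \<beta>, \<gamma>) \<Rightarrow>
     [[(1, [zB]), (-1, [zA]), (-1, [cC, uC, uC])],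
      [(1, [uC, vC]), (-1, [])],
      [(1, [cC, cC, cC]), (-1, [cC])],
      [(2, [zC]), (-\<alpha>, []), (-\<beta>, [cC, cC]), (-\<gamma>, [cC])]])"
| "constraints SClose = [[(1, [zC]), (-1, [])]]"
| "constraints _ = []"

text \<open>All pairs of monomials, without collecting: no occurrence of a variable gets lost, since
  each monomial is also multiplied by itself.\<close>

definition tsquare :: "tpoly \<Rightarrow> tpoly" where
  "tsquare P = concat (map (\<lambda>(c, f). map (\<lambda>(d, g). (c * d, f @ g)) P) P)"

definition squares :: "sym \<Rightarrow> tpoly" where
  "squares k = concat (map tsquare (constraints k))"

definition fvar :: "(nat \<Rightarrow> bool list) \<Rightarrow> factor \<Rightarrow> var" where
  "fvar \<rho> f = fst f @ \<rho> (snd f)"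

definition peval :: "(var \<Rightarrow> real) \<Rightarrow> (nat \<Rightarrow> bool list) \<Rightarrow> tpoly \<Rightarrow> real" where
  "peval e \<rho> P = (\<Sum>(c, fs)\<leftarrow>P. of_int c * (\<Prod>f\<leftarrow>fs. e (fvar \<rho> f)))"

lemma sum_list_mult: "(\<Sum>x\<leftarrow>xs. \<Sum>y\<leftarrow>ys. f x * g y) = (\<Sum>x\<leftarrow>xs. f x) * (\<Sum>y\<leftarrow>ys. g y)"
  for f g :: "'a \<Rightarrow> real"
  by (induction xs) (auto simp: sum_list_const_mult algebra_simps)

lemma peval_append: "peval e \<rho> (P @ Q) = peval e \<rho> P + peval e \<rho> Q"
  by (simp add: peval_def)

lemma peval_concat: "peval e \<rho> (concat Ps) = (\<Sum>P\<leftarrow>Ps. peval e \<rho> P)"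
  by (induction Ps) (auto simp: peval_append, simp add: peval_def)

lemma peval_tsquare: "peval e \<rho> (tsquare P) = (peval e \<rho> P)\<^sup>2"
proof -
  define h where "h = (\<lambda>(c, fs). of_int c * (\<Prod>f\<leftarrow>fs. e (fvar \<rho> f)))"
  have "peval e \<rho> (map (\<lambda>(d, g). (c * d, f @ g)) P) = (\<Sum>y\<leftarrow>P. h (c, f) * h y)" for c f
    unfolding peval_def h_def by (simp add: o_def case_prod_unfold algebra_simps)
  then have "peval e \<rho> (tsquare P) = (\<Sum>x\<leftarrow>P. \<Sum>y\<leftarrow>P. h x * h y)"
    by (simp add: tsquare_def peval_concat o_def case_prod_unfold)
  then show ?thesis
    by (simp add: sum_list_mult power2_eq_square peval_def h_def)
qed

definition mon_trm :: "(nat \<Rightarrow> bool list) \<Rightarrow> int \<times> factor list \<Rightarrow> trm" where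
  "mon_trm \<rho> m = foldl (\<lambda>t f. Times t (Var (fvar \<rho> f))) (numeral_trm (nat \<bar>fst m\<bar>)) (snd m)"

definition item_mons :: "item \<Rightarrow> (int \<times> trm) list" where
  "item_mons i = map (\<lambda>m. (fst m, mon_trm (snd i) m)) (squares (fst i))"

definition poly_trm :: "(int \<times> trm) list \<Rightarrow> trm" where
  "poly_trm ms = foldl (\<lambda>p (c, t). if c < 0 then Minus p t else Plus p t) Zero ms"

section \<open>Value, variables and form of the sum of squares\<close>

lemma eval_numeral_trm: "eval e (numeral_trm n) = real n"
proof (induction n rule: less_induct)
  case (less n)
  show ?case
  proof (cases n rule: numeral_trm_cases)
    case (3 d)
    with less.IH[of d] show ?thesis by (simp add: numeral_trm_simps)
  next
    case (4 d)
    with less.IH[of d] show ?thesis by (simp add: numeral_trm_simps)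
  qed (auto simp: numeral_trm_simps)
qed

lemma trm_vars_numeral_trm: "trm_vars (numeral_trm n) = {}"
proof (induction n rule: less_induct)
  case (less n)
  show ?case
  proof (cases n rule: numeral_trm_cases)
    case (3 d)
    with less.IH[of d] show ?thesis by (simp add: numeral_trm_simps)
  next
    case (4 d)
    with less.IH[of d] show ?thesis by (simp add: numeral_trm_simps)
  qed (auto simp: numeral_trm_simps)
qed

lemma foldl_Times:
  "eval e (foldl (\<lambda>t f. Times t (Var (v f))) t fs) = eval e t * (\<Prod>f\<leftarrow>fs. e (v f))"
  "trm_vars (foldl (\<lambda>t f. Times t (Var (v f))) t fs) = trm_vars t \<union> v ` set fs"
  "monomial t \<Longrightarrow> monomial (foldl (\<lambda>t f. Times t (Var (v f))) t fs)"
  by (induction fs arbitrary: t) (simp_all add: monomial.intros)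

lemma eval_mon_trm:
  "eval e (mon_trm \<rho> m) = of_int \<bar>fst m\<bar> * (\<Prod>f\<leftarrow>snd m. e (fvar \<rho> f))"
  by (simp add: mon_trm_def foldl_Times eval_numeral_trm)

lemma trm_vars_mon_trm: "trm_vars (mon_trm \<rho> m) = fvar \<rho> ` set (snd m)"
  by (simp add: mon_trm_def foldl_Times trm_vars_numeral_trm)

lemma monomial_mon_trm: "monomial (mon_trm \<rho> m)"
  by (simp add: mon_trm_def foldl_Times monomial.intros)

lemma eval_poly_trm:
  "eval e (poly_trm ms) = (\<Sum>(c, t)\<leftarrow>ms. if c < 0 then - eval e t else eval e t)"
proof -
  have "eval e (foldl (\<lambda>p (c, t). if c < 0 then Minus p t else Plus p t) p ms)
      = eval e p + (\<Sum>(c, t)\<leftarrow>ms. if c < 0 then - eval e t else eval e t)" for p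
    by (induction ms arbitrary: p) auto
  then show ?thesis by (simp add: poly_trm_def)
qed

lemma trm_vars_poly_trm: "trm_vars (poly_trm ms) = (\<Union>(c, t)\<in>set ms. trm_vars t)"
proof -
  have "trm_vars (foldl (\<lambda>p (c, t). if c < 0 then Minus p t else Plus p t) p ms)
      = trm_vars p \<union> (\<Union>(c, t)\<in>set ms. trm_vars t)" for p
    by (induction ms arbitrary: p) (auto split: if_splits)
  then show ?thesis by (simp add: poly_trm_def)
qed

lemma standard_poly_trm:
  assumes "\<And>c t. (c, t) \<in> set ms \<Longrightarrow> monomial t"
  shows "standard_poly (poly_trm ms)"
proof -
  have "standard_poly p \<Longrightarrow> \<forall>m \<in> set ms. monomial (snd m) \<Longrightarrow>
      standard_poly (foldl (\<lambda>p (c, t). if c < 0 then Minus p t else Plus p t) p ms)" for p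
  proof (induction ms arbitrary: p)
    case (Cons m ms)
    obtain c t where m: "m = (c, t)" by fastforce
    then have "standard_poly (if c < 0 then Minus p t else Plus p t)"
      using Cons.prems by (auto intro: standard_poly.intros)
    from Cons.IH[OF this] Cons.prems(2) show ?case by (simp add: m)
  qed simp
  moreover have "\<forall>m \<in> set ms. monomial (snd m)" using assms by force
  moreover have "standard_poly Zero"
    using standard_poly.intros(1)[OF monomial.intros(1)[of 0]] by (simp add: numeral_trm_simps)
  ultimately show ?thesis by (simp add: poly_trm_def)
qed

definition items_poly :: "item list \<Rightarrow> trm" where
  "items_poly is = poly_trm (concat (map item_mons is))"

lemma standard_items_poly: "standard_poly (items_poly is)"
  unfolding items_poly_def by (rule standard_poly_trm) (auto simp: item_mons_def monomial_mon_trm)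

definition item_holds :: "(var \<Rightarrow> real) \<Rightarrow> item \<Rightarrow> bool" where
  "item_holds e i \<longleftrightarrow> (\<forall>P \<in> set (constraints (fst i)). peval e (snd i) P = 0)"

lemma sum_list_squares_eq_0: "(\<Sum>x\<leftarrow>xs. (f x)\<^sup>2) = 0 \<longleftrightarrow> (\<forall>x \<in> set xs. f x = (0 :: real))"
  by (subst sum_list_nonneg_eq_0_iff) auto

lemma sum_list_map_concat: "(\<Sum>x\<leftarrow>concat (map f is). g x) = (\<Sum>i\<leftarrow>is. \<Sum>x\<leftarrow>f i. (g x :: real))"
  by (induction "is") auto

lemma eval_items_poly:
  "eval e (items_poly is) = (\<Sum>i\<leftarrow>is. \<Sum>P\<leftarrow>constraints (fst i). (peval e (snd i) P)\<^sup>2)"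
proof -
  have "(\<Sum>(c, t)\<leftarrow>item_mons i. if c < 0 then - eval e t else eval e t)
      = (\<Sum>P\<leftarrow>constraints (fst i). (peval e (snd i) P)\<^sup>2)" for i
  proof -
    have *: "(if fst m < 0 then - eval e (mon_trm \<rho> m) else eval e (mon_trm \<rho> m))
        = of_int (fst m) * (\<Prod>f\<leftarrow>snd m. e (fvar \<rho> f))" for m \<rho>
      by (auto simp: eval_mon_trm)
    have "(\<Sum>(c, t)\<leftarrow>item_mons i. if c < 0 then - eval e t else eval e t)
        = peval e (snd i) (squares (fst i))"
      unfolding item_mons_def peval_def by (simp add: o_def * case_prod_unfold cong: if_cong)
    also have "\<dots> = (\<Sum>P\<leftarrow>constraints (fst i). (peval e (snd i) P)\<^sup>2)"
      by (simp add: squares_def peval_concat o_def peval_tsquare)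
    finally show ?thesis .
  qed
  then show ?thesis
    by (simp add: items_poly_def eval_poly_trm sum_list_map_concat)
qed

lemma eval_items_poly_eq_0: "eval e (items_poly is) = 0 \<longleftrightarrow> (\<forall>i \<in> set is. item_holds e i)"
proof -
  have "(\<Sum>i\<leftarrow>is. \<Sum>P\<leftarrow>constraints (fst i). (peval e (snd i) P)\<^sup>2) = 0
      \<longleftrightarrow> (\<forall>i \<in> set is. (\<Sum>P\<leftarrow>constraints (fst i). (peval e (snd i) P)\<^sup>2) = 0)"
    by (subst sum_list_nonneg_eq_0_iff) (auto intro!: sum_list_nonneg)
  then show ?thesis
    by (simp add: eval_items_poly item_holds_def sum_list_squares_eq_0)
qed

definition item_vars :: "item \<Rightarrow> var set" where
  "item_vars i = (\<Union>P \<in> set (constraints (fst i)). \<Union>m \<in> set P. fvar (snd i) ` set (snd m))"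

lemma trm_vars_items_poly: "trm_vars (items_poly is) = (\<Union>i \<in> set is. item_vars i)"
proof -
  have *: "(\<Union>m \<in> set (tsquare P). g ` set (snd m)) = (\<Union>m \<in> set P. g ` set (snd m))"
    for P and g :: "factor \<Rightarrow> var"
  proof (intro equalityI subsetI)
    fix x assume "x \<in> (\<Union>m \<in> set (tsquare P). g ` set (snd m))"
    then obtain c f d h where "(c, f) \<in> set P" "(d, h) \<in> set P" "x \<in> g ` set f \<or> x \<in> g ` set h"
      by (auto simp: tsquare_def)
    then show "x \<in> (\<Union>m \<in> set P. g ` set (snd m))" by force
  next
    fix x assume "x \<in> (\<Union>m \<in> set P. g ` set (snd m))"
    then obtain c f where f: "(c, f) \<in> set P" "x \<in> g ` set f" by auto
    then have "(c * c, f @ f) \<in> set (tsquare P)"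
      by (auto simp: tsquare_def intro!: bexI[of _ "(c, f)"] image_eqI[of _ _ "(c, f)"])
    with f(2) show "x \<in> (\<Union>m \<in> set (tsquare P). g ` set (snd m))" by force
  qed
  have "(\<Union>m \<in> set (squares (fst i)). fvar (snd i) ` set (snd m)) = item_vars i" for i
    by (simp add: squares_def item_vars_def *)
  then show ?thesis
    by (simp add: items_poly_def trm_vars_poly_trm item_mons_def trm_vars_mon_trm)
qed

lemma item_holds_cong:
  assumes "\<And>x. x \<in> item_vars i \<Longrightarrow> e x = e' x"
  shows "item_holds e i \<longleftrightarrow> item_holds e' i"
proof -
  have "peval e (snd i) P = peval e' (snd i) P" if "P \<in> set (constraints (fst i))" for P
    unfolding peval_def using assms that
    by (intro arg_cong[of _ _ sum_list] map_cong refl)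
      (fastforce simp: item_vars_def intro!: arg_cong2[of _ _ _ _ "(*)"] arg_cong[of _ _ prod_list] map_cong)
  then show ?thesis by (simp add: item_holds_def)
qed

section \<open>From formulas to lists of constraints\<close>

definition regs :: "bool list \<Rightarrow> bool list \<Rightarrow> bool list \<Rightarrow> nat \<Rightarrow> bool list" where
  "regs a b c r = (if r = 2 then a else if r = 3 then b else c)"

definition join :: "sym \<Rightarrow> nat \<times> item list \<Rightarrow> nat \<times> item list \<Rightarrow> nat \<times> item list" where
  "join k p q = (Suc (fst q), snd p @ snd q @ [(k, regs (ones (fst p)) (ones (fst q)) (ones (Suc (fst q))))])"

text \<open>
  Nodes are numbered in postorder, starting from \<open>n + 1\<close>, so that the root of the formula gets
  the largest number, which is the first component of the result.
\<close>

primrec compile_trm :: "trm \<Rightarrow> nat \<Rightarrow> nat \<times> item list" where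
  "compile_trm (Var x) n = (Suc n, [(SVar, regs x [] (ones (Suc n)))])"
| "compile_trm Zero n = (Suc n, [(SZero, regs [] [] (ones (Suc n)))])"
| "compile_trm One n = (Suc n, [(SOne, regs [] [] (ones (Suc n)))])"
| "compile_trm (Plus s t) n = (let p = compile_trm s n in join SPlus p (compile_trm t (fst p)))"
| "compile_trm (Minus s t) n = (let p = compile_trm s n in join SMinus p (compile_trm t (fst p)))"
| "compile_trm (Times s t) n = (let p = compile_trm s n in join STimes p (compile_trm t (fst p)))"

primrec compile :: "fm \<Rightarrow> nat \<Rightarrow> nat \<times> item list" where
  "compile (Rel r s t) n = (let p = compile_trm s n in join (SRel r) p (compile_trm t (fst p)))"
| "compile (Conj \<phi> \<psi>) n = (let p = compile \<phi> n in join SConj p (compile \<psi> (fst p)))"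
| "compile (Disj \<phi> \<psi>) n = (let p = compile \<phi> n in join SDisj p (compile \<psi> (fst p)))"
| "compile (Neg \<phi>) n = (let p = compile \<phi> n in
     (Suc (fst p), snd p @ [(SNeg, regs (ones (fst p)) [] (ones (Suc (fst p))))]))"
| "compile (Equiv \<phi> \<psi>) n = (let p = compile \<phi> n in join SEquiv p (compile \<psi> (fst p)))"
| "compile (All x \<phi>) n = (n, [])"
| "compile (Ex x \<phi>) n = (n, [])"

lemma fvar_regs [simp]:
  "fvar (regs a b c) ([True], 2) = ov a"
  "fvar (regs (ones i) b c) ([False, k, l], 2) = av k l i"
  "fvar (regs a (ones i) c) ([False, k, l], 3) = av k l i"
  "fvar (regs a b (ones i)) ([False, k, l], 4) = av k l i"
  by (auto simp: fvar_def regs_def av_def ov_def)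

text \<open>On truth values 0 and 1 these polynomials agree with the connectives;
  \<open>1 - a - b + 2 * a * b\<close> is then 1 minus the square of a - b.\<close>

definition binary_op :: "sym \<Rightarrow> real \<Rightarrow> real \<Rightarrow> real" where
  "binary_op k a b = (case k of SPlus \<Rightarrow> a + b | SMinus \<Rightarrow> a - b | STimes \<Rightarrow> a * b | SConj \<Rightarrow> a * b
     | SDisj \<Rightarrow> a + b - a * b | SEquiv \<Rightarrow> 1 - a - b + 2 * a * b | SRel r \<Rightarrow> of_bool (rel_holds r a b) | _ \<Rightarrow> 0)"

definition binary :: "sym set" where
  "binary = {SPlus, SMinus, STimes, SConj, SDisj, SEquiv} \<union> range SRel"

text \<open>As \<open>u\<close> is invertible, \<open>u * u\<close> is positive and
  \<open>b - a\<close> has the sign of \<open>c\<close>; it remains to check three values of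
  \<open>c\<close>. The factor 2 keeps the coefficients integral: the truth value of a \<le> b, for
  instance, is 1 - c^2/2 + c/2.\<close>

lemma rel_constraints:
  fixes a b c u v :: real
  assumes "b - a - c * (u * u) = 0" "u * v - 1 = 0" "c * (c * c) - c = 0"
    "rel_coeffs r = (\<alpha>, \<beta>, \<gamma>)"
  shows "of_int \<alpha> + of_int \<beta> * (c * c) + of_int \<gamma> * c = 2 * of_bool (rel_holds r a b)"
proof -
  have "u \<noteq> 0" using assms(2) by auto
  then have "u * u > 0" by (cases "u > 0") (auto simp: zero_less_mult_iff)
  have "c * (c - 1) * (c + 1) = 0" using assms(3) by (simp add: algebra_simps)
  then consider "c = 0" | "c = 1" | "c = -1" by auto
  then show ?thesis
  proof cases
    case 1
    with assms(1,4) show ?thesis by (cases r) auto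
  next
    case 2
    with assms(1) \<open>u * u > 0\<close> have "a < b" by simp
    with 2 assms(4) show ?thesis by (cases r) auto
  next
    case 3
    with assms(1) \<open>u * u > 0\<close> have "b < a" by simp
    with 3 assms(4) show ?thesis by (cases r) auto
  qed
qed

lemma item_holds_binary:
  assumes "k \<in> binary" "item_holds e (k, regs (ones i) (ones j) (ones l))"
  shows "e (zv l) = binary_op k (e (zv i)) (e (zv j))"
proof (cases "k \<in> range SRel")
  case True
  then obtain r where k: "k = SRel r" by blast
  obtain \<alpha> \<beta> \<gamma> where r: "rel_coeffs r = (\<alpha>, \<beta>, \<gamma>)" by (metis prod_cases3)
  show ?thesis
    using assms(2) rel_constraints[OF _ _ _ r, of "e (zv j)" "e (zv i)" "e (av False True l)" "e (av True False l)" "e (av True True l)"]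
    by (simp add: item_holds_def peval_def k r binary_op_def)
next
  case False
  with assms show ?thesis
    by (auto simp: binary_def item_holds_def peval_def binary_op_def)
qed

text \<open>The operands have smaller numbers than \<open>l\<close>, so new values for node
  \<open>l\<close> do not disturb them. The three forms of \<open>\<rho>\<close> belong to binary
  operators, leaves and negation.\<close>

lemma ex_item_holds:
  assumes "k \<in> binary \<union> {SZero, SOne, SVar, SNeg}" "i < l" "j < l"
    and \<rho>: "\<rho> = regs (ones i) (ones j) (ones l) \<or> \<rho> = regs a b (ones l) \<and> k \<notin> insert SNeg binary
      \<or> \<rho> = regs (ones i) b (ones l) \<and> k \<notin> binary"
  shows "\<exists>e'. (\<forall>x. x \<notin> node_set l \<longrightarrow> e' x = e x) \<and> item_holds e' (k, \<rho>)"
proof (cases "k \<in> range SRel")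
  case True
  then obtain r where k: "k = SRel r" by blast
  obtain \<alpha> \<beta> \<gamma> where r: "rel_coeffs r = (\<alpha>, \<beta>, \<gamma>)" by (metis prod_cases3)
  define d where "d = e (zv j) - e (zv i)"
  \<comment> \<open>For equal operands the sign is 0 and any invertible \<open>u\<close> will do;
    otherwise \<open>u * u\<close> has to be the absolute value of \<open>d\<close>.\<close>
  define u where "u = (if d = 0 then 1 else sqrt \<bar>d\<bar>)"
  define e' where "e' = e(av False True l := sgn d, av True False l := u, av True True l := 1 / u,
    zv l := (of_int \<alpha> + of_int \<beta> * (sgn d * sgn d) + of_int \<gamma> * sgn d) / 2)"
  have "u \<noteq> 0" "d - sgn d * (u * u) = 0"
    by (auto simp: u_def sgn_if)
  moreover have "sgn d * (sgn d * sgn d) - sgn d = 0" by (simp add: sgn_if)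
  moreover have "\<rho> = regs (ones i) (ones j) (ones l)" using \<rho> k by (auto simp: binary_def)
  ultimately have "item_holds e' (k, \<rho>)"
    using assms by (simp add: item_holds_def peval_def k r e'_def d_def add_divide_distrib)
  then show ?thesis by (intro exI[of _ e']) (auto simp: e'_def)
next
  case False
  define y where "y = (if k = SZero then 0 else if k = SOne then 1 else if k = SVar then e (fvar \<rho> ([True], 2))
    else if k = SNeg then 1 - e (zv i) else binary_op k (e (zv i)) (e (zv j)))"
  have "item_holds (e(zv l := y)) (k, \<rho>)"
    using assms False
    by (auto simp: item_holds_def peval_def y_def binary_op_def binary_def)
  then show ?thesis by (intro exI[of _ "e(zv l := y)"]) auto
qed

section \<open>Correctness of the compilation\<close>

definition aux_vars :: "nat \<Rightarrow> nat \<Rightarrow> var set" where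
  "aux_vars m n = {av k l j | k l j. m < j \<and> j \<le> n}"

text \<open>Besides the value at the root, the induction carries an exact account of the original
  variables, since a reduction must preserve being a sentence in both directions. The last clause
  starts from an arbitrary \<open>e\<close> and changes only new nodes, so that solutions for the
  operands can be extended one after the other.\<close>

definition compiles :: "var set \<Rightarrow> ((var \<Rightarrow> real) \<Rightarrow> real) \<Rightarrow> nat \<times> item list \<Rightarrow> nat \<Rightarrow> bool" where
  "compiles V f p n \<longleftrightarrow> n < fst p \<and>
     ov ` V \<subseteq> (\<Union>i \<in> set (snd p). item_vars i) \<and>
     (\<Union>i \<in> set (snd p). item_vars i) \<subseteq> ov ` V \<union> aux_vars n (fst p) \<and>
     (\<forall>e. (\<forall>i \<in> set (snd p). item_holds e i) \<longrightarrow> e (zv (fst p)) = f (\<lambda>x. e (ov x))) \<and>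
     (\<forall>e. \<exists>e'. (\<forall>x. x \<notin> aux_vars n (fst p) \<longrightarrow> e' x = e x) \<and> (\<forall>i \<in> set (snd p). item_holds e' i))"

lemma item_vars_binary:
  "k \<in> binary \<Longrightarrow> item_vars (k, regs (ones i) (ones j) (ones l)) \<subseteq> {zv i, zv j} \<union> node_set l"
proof (cases "k \<in> range SRel")
  case True
  then obtain r where "k = SRel r" by blast
  then show ?thesis by (cases r) (auto simp: item_vars_def)
qed (auto simp: binary_def item_vars_def)

lemma aux_vars_mono: "n' \<le> n \<Longrightarrow> m \<le> m' \<Longrightarrow> aux_vars n m \<subseteq> aux_vars n' m'"
  by (auto simp: aux_vars_def)

text \<open>The second extension touches only numbers above \<open>m\<close>, which the first group
  of constraints does not mention, so the first group stays satisfied.\<close>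

lemma compiles_extend:
  assumes "\<And>e. \<exists>e'. (\<forall>x. x \<notin> aux_vars n m \<longrightarrow> e' x = e x) \<and> (\<forall>i \<in> set is. item_holds e' i)"
    and "\<And>e. \<exists>e'. (\<forall>x. x \<notin> aux_vars m l \<longrightarrow> e' x = e x) \<and> (\<forall>i \<in> set js. item_holds e' i)"
    and "(\<Union>i \<in> set is. item_vars i) \<subseteq> range ov \<union> aux_vars n m" "n \<le> m" "m \<le> l"
  shows "\<exists>e'. (\<forall>x. x \<notin> aux_vars n l \<longrightarrow> e' x = e x) \<and> (\<forall>i \<in> set (is @ js). item_holds e' i)"
proof -
  obtain e1 where e1: "\<And>x. x \<notin> aux_vars n m \<Longrightarrow> e1 x = e x" "\<And>i. i \<in> set is \<Longrightarrow> item_holds e1 i"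
    using assms(1) by blast
  obtain e2 where e2: "\<And>x. x \<notin> aux_vars m l \<Longrightarrow> e2 x = e1 x" "\<And>i. i \<in> set js \<Longrightarrow> item_holds e2 i"
    using assms(2) by blast
  have disj: "x \<notin> aux_vars m l" if "x \<in> range ov \<union> aux_vars n m" for x
    using that by (auto simp: aux_vars_def)
  have "item_holds e2 i" if "i \<in> set is" for i
  proof -
    have "e2 x = e1 x" if "x \<in> item_vars i" for x
      using that \<open>i \<in> set is\<close> assms(3) by (intro e2(1) disj) blast
    then show ?thesis using item_holds_cong[of i e2 e1] e1(2) that by blast
  qed
  moreover have "e2 x = e x" if "x \<notin> aux_vars n l" for x
  proof -
    have "x \<notin> aux_vars n m" "x \<notin> aux_vars m l"
      using that assms(4,5) aux_vars_mono[of n n m l] aux_vars_mono[of n m l l] by blast+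
    with e1(1) e2(1) show ?thesis by simp
  qed
  ultimately show ?thesis using e2(2) by (intro exI[of _ e2]) auto
qed

lemma aux_vars_Suc: "aux_vars l (Suc l) = node_set (Suc l)"
  by (auto simp: aux_vars_def node_set_def le_Suc_eq)

lemma av_in_aux_vars [simp]: "av k l j \<in> aux_vars m n \<longleftrightarrow> m < j \<and> j \<le> n"
  by (auto simp: aux_vars_def)

lemma compiles_join:
  assumes p: "compiles V f p n" and q: "compiles W g q (fst p)" and k: "k \<in> binary"
    and h: "\<And>e. h e = binary_op k (f e) (g e)"
  shows "compiles (V \<union> W) h (join k p q) n"
proof -
  let ?i = "(k, regs (ones (fst p)) (ones (fst q)) (ones (Suc (fst q))))"
  have lt: "n < fst p" "fst p < fst q" using p q by (simp_all add: compiles_def)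
  have iv: "item_vars ?i \<subseteq> {zv (fst p), zv (fst q)} \<union> aux_vars (fst q) (Suc (fst q))"
    using item_vars_binary[OF k] by (simp add: aux_vars_Suc)
  then have iv': "item_vars ?i \<subseteq> aux_vars n (Suc (fst q))"
    using lt aux_vars_mono[of n "fst q" "Suc (fst q)" "Suc (fst q)"] by fastforce
  have pv: "(\<Union>i \<in> set (snd p). item_vars i) \<subseteq> ov ` V \<union> aux_vars n (fst p)"
    and qv: "(\<Union>i \<in> set (snd q). item_vars i) \<subseteq> ov ` W \<union> aux_vars (fst p) (fst q)"
    and pv': "ov ` V \<subseteq> (\<Union>i \<in> set (snd p). item_vars i)" and qv': "ov ` W \<subseteq> (\<Union>i \<in> set (snd q). item_vars i)"
    using p q by (simp_all add: compiles_def)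
  have vars: "(\<Union>i \<in> set (snd (join k p q)). item_vars i) \<subseteq> ov ` (V \<union> W) \<union> aux_vars n (Suc (fst q))"
    using pv qv iv' aux_vars_mono[of n n "fst p" "Suc (fst q)"] aux_vars_mono[of n "fst p" "fst q" "Suc (fst q)"] lt
    by (simp add: join_def image_Un) blast
  \<comment> \<open>Three extensions in a row: left operand, right operand, and the node that joins
    them.\<close>
  have sat: "\<exists>e'. (\<forall>x. x \<notin> aux_vars n (Suc (fst q)) \<longrightarrow> e' x = e x) \<and>
      (\<forall>i \<in> set ((snd p @ snd q) @ [?i]). item_holds e' i)" for e
  proof (rule compiles_extend[of n "fst q" _ "Suc (fst q)"])
    show "\<exists>e'. (\<forall>x. x \<notin> aux_vars n (fst q) \<longrightarrow> e' x = e x) \<and> (\<forall>i \<in> set (snd p @ snd q). item_holds e' i)" for e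
      by (rule compiles_extend[of n "fst p" _ "fst q"]) (use p q lt pv in \<open>auto simp: compiles_def\<close>)
    show "\<exists>e'. (\<forall>x. x \<notin> aux_vars (fst q) (Suc (fst q)) \<longrightarrow> e' x = e x) \<and> (\<forall>i \<in> set [?i]. item_holds e' i)" for e
    proof -
      have "\<exists>e'. (\<forall>x. x \<notin> node_set (Suc (fst q)) \<longrightarrow> e' x = e x) \<and> item_holds e' ?i"
        by (rule ex_item_holds[OF UnI1[OF k] _ _ disjI1[OF refl]]) (use lt in linarith)+
      then show ?thesis by (simp add: aux_vars_Suc)
    qed
    show "(\<Union>i \<in> set (snd p @ snd q). item_vars i) \<subseteq> range ov \<union> aux_vars n (fst q)"
    proof -
      have "aux_vars n (fst p) \<subseteq> aux_vars n (fst q)" "aux_vars (fst p) (fst q) \<subseteq> aux_vars n (fst q)"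
        using lt by (simp_all add: aux_vars_mono)
      moreover have "(\<Union>i \<in> set (snd p @ snd q). item_vars i)
          = (\<Union>i \<in> set (snd p). item_vars i) \<union> (\<Union>i \<in> set (snd q). item_vars i)"
        by simp
      ultimately show ?thesis using pv qv by blast
    qed
  qed (use lt in auto)
  show ?thesis
    unfolding compiles_def
  proof (intro conjI allI impI)
    show "ov ` (V \<union> W) \<subseteq> (\<Union>i \<in> set (snd (join k p q)). item_vars i)"
      using pv' qv' by (auto simp: join_def)
    show "(\<Union>i \<in> set (snd (join k p q)). item_vars i) \<subseteq> ov ` (V \<union> W) \<union> aux_vars n (fst (join k p q))"
      using vars by (simp add: join_def)
    show "e (zv (fst (join k p q))) = h (\<lambda>x. e (ov x))" if "\<forall>i \<in> set (snd (join k p q)). item_holds e i" for e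
      using that p q item_holds_binary[OF k, of e "fst p" "fst q" "Suc (fst q)"]
      by (simp add: join_def compiles_def h)
    show "\<exists>e'. (\<forall>x. x \<notin> aux_vars n (fst (join k p q)) \<longrightarrow> e' x = e x) \<and>
        (\<forall>i \<in> set (snd (join k p q)). item_holds e' i)" for e
      using sat[of e] by (simp add: join_def)
  qed (use lt in \<open>simp add: join_def\<close>)
qed

lemma compiles_leaf:
  assumes "k \<in> {SZero, SOne, SVar}" "item_vars (k, regs a b (ones (Suc n))) = ov ` V \<union> {zv (Suc n)}"
    and "\<And>e. item_holds e (k, regs a b (ones (Suc n))) \<Longrightarrow> e (zv (Suc n)) = f (\<lambda>x. e (ov x))"
  shows "compiles V f (Suc n, [(k, regs a b (ones (Suc n)))]) n"
proof -
  have "\<exists>e'. (\<forall>x. x \<notin> aux_vars n (Suc n) \<longrightarrow> e' x = e x) \<and> item_holds e' (k, regs a b (ones (Suc n)))" for e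
  proof -
    have "\<exists>e'. (\<forall>x. x \<notin> node_set (Suc n) \<longrightarrow> e' x = e x) \<and> item_holds e' (k, regs a b (ones (Suc n)))"
      by (rule ex_item_holds[where i = 0 and j = 0 and a = a and b = b])
        (use assms(1) in \<open>auto simp: binary_def\<close>)
    then show ?thesis by (simp add: aux_vars_Suc)
  qed
  then show ?thesis
    using assms by (auto simp: compiles_def)
qed

lemma compiles_trm: "compiles (trm_vars t) (\<lambda>e. eval e t) (compile_trm t n) n"
proof (induction t arbitrary: n)
  case (Var x)
  show ?case
    unfolding compile_trm.simps
    by (rule compiles_leaf) (auto simp: item_vars_def item_holds_def peval_def)
next
  case Zero
  show ?case
    unfolding compile_trm.simps
    by (rule compiles_leaf) (auto simp: item_vars_def item_holds_def peval_def)
next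
  case One
  show ?case
    unfolding compile_trm.simps
    by (rule compiles_leaf) (auto simp: item_vars_def item_holds_def peval_def)
next
  case (Plus s t)
  from compiles_join[OF Plus.IH(1) Plus.IH(2), of SPlus] show ?case
    by (simp add: binary_def binary_op_def Let_def)
next
  case (Minus s t)
  from compiles_join[OF Minus.IH(1) Minus.IH(2), of SMinus] show ?case
    by (simp add: binary_def binary_op_def Let_def)
next
  case (Times s t)
  from compiles_join[OF Times.IH(1) Times.IH(2), of STimes] show ?case
    by (simp add: binary_def binary_op_def Let_def)
qed

lemma compiles_Neg:
  assumes p: "compiles V f p n" and h: "\<And>e. h e = 1 - f e"
  shows "compiles V h (Suc (fst p), snd p @ [(SNeg, regs (ones (fst p)) [] (ones (Suc (fst p))))]) n"
proof -
  let ?i = "(SNeg, regs (ones (fst p)) [] (ones (Suc (fst p))))"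
  have lt: "n < fst p" and pv: "(\<Union>i \<in> set (snd p). item_vars i) \<subseteq> ov ` V \<union> aux_vars n (fst p)"
    using p by (simp_all add: compiles_def)
  have iv: "item_vars ?i \<subseteq> aux_vars n (Suc (fst p))"
    using lt by (auto simp: item_vars_def)
  have sat: "\<exists>e'. (\<forall>x. x \<notin> aux_vars n (Suc (fst p)) \<longrightarrow> e' x = e x) \<and>
      (\<forall>i \<in> set (snd p @ [?i]). item_holds e' i)" for e
  proof (rule compiles_extend[of n "fst p" _ "Suc (fst p)"])
    show "\<exists>e'. (\<forall>x. x \<notin> aux_vars (fst p) (Suc (fst p)) \<longrightarrow> e' x = e x) \<and> (\<forall>i \<in> set [?i]. item_holds e' i)" for e
    proof -
      have "\<exists>e'. (\<forall>x. x \<notin> node_set (Suc (fst p)) \<longrightarrow> e' x = e x) \<and> item_holds e' ?i"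
        by (rule ex_item_holds[where i = "fst p" and j = 0 and a = "[]" and b = "[]"])
          (simp_all add: binary_def image_iff)
      then show ?thesis by (simp add: aux_vars_Suc)
    qed
  qed (use p lt pv in \<open>auto simp: compiles_def\<close>)
  have val: "e (zv (Suc (fst p))) = 1 - e (zv (fst p))" if "item_holds e ?i" for e
    using that by (simp add: item_holds_def peval_def)
  have vars: "(\<Union>i \<in> set (snd p @ [?i]). item_vars i) = (\<Union>i \<in> set (snd p). item_vars i) \<union> item_vars ?i"
    by auto
  show ?thesis
    unfolding compiles_def fst_conv snd_conv
  proof (intro conjI allI impI)
    show "ov ` V \<subseteq> (\<Union>i \<in> set (snd p @ [?i]). item_vars i)"
      using p unfolding vars compiles_def by blast
    show "(\<Union>i \<in> set (snd p @ [?i]). item_vars i) \<subseteq> ov ` V \<union> aux_vars n (Suc (fst p))"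
      using pv iv aux_vars_mono[of n n "fst p" "Suc (fst p)"] unfolding vars by auto
    show "e (zv (Suc (fst p))) = h (\<lambda>x. e (ov x))" if "\<forall>i \<in> set (snd p @ [?i]). item_holds e i" for e
      using that p val[of e] by (simp add: compiles_def h)
  qed (use lt sat in simp_all)
qed

lemma compiles_fm:
  "quantifier_free \<phi> \<Longrightarrow> compiles (free_vars \<phi>) (\<lambda>e. of_bool (holds e \<phi>)) (compile \<phi> n) n"
proof (induction \<phi> arbitrary: n)
  case (Rel r s t)
  from compiles_join[OF compiles_trm compiles_trm, of "SRel r"] show ?case
    by (simp add: binary_def binary_op_def Let_def)
next
  case (Conj \<phi> \<psi>)
  have "compiles (free_vars \<phi>) (\<lambda>e. of_bool (holds e \<phi>)) (compile \<phi> n) n"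
    "compiles (free_vars \<psi>) (\<lambda>e. of_bool (holds e \<psi>)) (compile \<psi> (fst (compile \<phi> n))) (fst (compile \<phi> n))"
    using Conj by auto
  from compiles_join[OF this, of SConj] show ?case
    by (simp add: binary_def binary_op_def Let_def)
next
  case (Disj \<phi> \<psi>)
  have "compiles (free_vars \<phi>) (\<lambda>e. of_bool (holds e \<phi>)) (compile \<phi> n) n"
    "compiles (free_vars \<psi>) (\<lambda>e. of_bool (holds e \<psi>)) (compile \<psi> (fst (compile \<phi> n))) (fst (compile \<phi> n))"
    using Disj by auto
  moreover have "of_bool (holds e (Disj \<phi> \<psi>)) = binary_op SDisj (of_bool (holds e \<phi>)) (of_bool (holds e \<psi>))"
    for e
    by (auto simp: binary_op_def)
  moreover have "SDisj \<in> binary" by (simp add: binary_def)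
  ultimately have "compiles (free_vars \<phi> \<union> free_vars \<psi>) (\<lambda>e. of_bool (holds e (Disj \<phi> \<psi>)))
      (join SDisj (compile \<phi> n) (compile \<psi> (fst (compile \<phi> n)))) n"
    by (intro compiles_join)
  then show ?case by (simp add: Let_def)
next
  case (Equiv \<phi> \<psi>)
  have "compiles (free_vars \<phi>) (\<lambda>e. of_bool (holds e \<phi>)) (compile \<phi> n) n"
    "compiles (free_vars \<psi>) (\<lambda>e. of_bool (holds e \<psi>)) (compile \<psi> (fst (compile \<phi> n))) (fst (compile \<phi> n))"
    using Equiv by auto
  moreover have "of_bool (holds e (Equiv \<phi> \<psi>)) = binary_op SEquiv (of_bool (holds e \<phi>)) (of_bool (holds e \<psi>))"
    for e
    by (auto simp: binary_op_def)
  moreover have "SEquiv \<in> binary" by (simp add: binary_def)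
  ultimately have "compiles (free_vars \<phi> \<union> free_vars \<psi>) (\<lambda>e. of_bool (holds e (Equiv \<phi> \<psi>)))
      (join SEquiv (compile \<phi> n) (compile \<psi> (fst (compile \<phi> n)))) n"
    by (intro compiles_join)
  then show ?case by (simp add: Let_def)
next
  case (Neg \<phi>)
  have "compiles (free_vars \<phi>) (\<lambda>e. of_bool (holds e \<phi>)) (compile \<phi> n) n"
    using Neg by auto
  moreover have "of_bool (holds e (Neg \<phi>)) = (1 :: real) - of_bool (holds e \<phi>)" for e
    by simp
  ultimately have "compiles (free_vars \<phi>) (\<lambda>e. of_bool (holds e (Neg \<phi>))) (Suc (fst (compile \<phi> n)),
      snd (compile \<phi> n) @ [(SNeg, regs (ones (fst (compile \<phi> n))) [] (ones (Suc (fst (compile \<phi> n)))))]) n"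
    by (rule compiles_Neg)
  then show ?case by (simp add: Let_def)
qed auto

section \<open>Prefixes and the equation built from a sentence\<close>

fun strip :: "fm \<Rightarrow> var list \<times> fm" where
  "strip (Ex x \<phi>) = (x # fst (strip \<phi>), snd (strip \<phi>))"
| "strip \<phi> = ([], \<phi>)"

lemma strip_ex_prefix: "quantifier_free \<psi> \<Longrightarrow> strip (ex_prefix xs \<psi>) = (xs, \<psi>)"
  by (induction xs) (cases \<psi>; simp)+

definition node_vars :: "nat \<Rightarrow> var list" where
  "node_vars j = [av False False j, av False True j, av True False j, av True True j]"

lemma set_node_vars: "set (node_vars j) = node_set j"
proof -
  have "av k l j \<in> set (node_vars j)" for k l
    by (cases k; cases l; simp add: node_vars_def)
  then show ?thesis by (auto simp: node_set_def) (auto simp: node_vars_def)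
qed

lemma aux_vars_0: "aux_vars 0 m = (\<Union>j\<in>{1..<Suc m}. node_set j)"
  by (auto simp: aux_vars_def node_set_def less_Suc_eq_le Suc_le_eq)

definition all_items :: "fm \<Rightarrow> item list" where
  "all_items \<psi> = snd (compile \<psi> 0) @ [(SClose, regs [] [] (ones (fst (compile \<psi> 0))))]"

text \<open>Every node binds the same four variables whatever its operator, so that one fixed text
  serves all nodes.\<close>

definition to_feasible :: "fm \<Rightarrow> fm" where
  "to_feasible \<phi> = (let (xs, \<psi>) = strip \<phi> in
     ex_prefix (map ov xs @ concat (map node_vars [1..<Suc (fst (compile \<psi> 0))]))
       (Rel Eq (items_poly (all_items \<psi>)) Zero))"

lemma eval_cong: "(\<And>x. x \<in> trm_vars t \<Longrightarrow> e x = e' x) \<Longrightarrow> eval e t = eval e' t"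
  by (induction t) auto

lemma holds_cong: "(\<And>x. x \<in> free_vars \<phi> \<Longrightarrow> e x = e' x) \<Longrightarrow> holds e \<phi> = holds e' \<phi>"
proof (induction \<phi> arbitrary: e e')
  case (Rel r s t)
  then show ?case using eval_cong[of s e e'] eval_cong[of t e e'] by simp
next
  case (All x \<phi>)
  have "holds (e(x := a)) \<phi> = holds (e'(x := a)) \<phi>" for a
    by (rule All.IH) (use All.prems in auto)
  then show ?case by simp
next
  case (Ex x \<phi>)
  have "holds (e(x := a)) \<phi> = holds (e'(x := a)) \<phi>" for a
    by (rule Ex.IH) (use Ex.prems in auto)
  then show ?case by simp
next
  case (Conj \<phi> \<psi>)
  then show ?case by (metis UnCI free_vars.simps(2) holds.simps(2))
next
  case (Disj \<phi> \<psi>)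
  then show ?case by (metis UnCI free_vars.simps(3) holds.simps(3))
next
  case (Equiv \<phi> \<psi>)
  then show ?case by (metis UnCI free_vars.simps(5) holds.simps(5))
next
  case (Neg \<phi>)
  then show ?case by (metis free_vars.simps(4) holds.simps(4))
qed

lemma holds_ex_prefix:
  "holds e (ex_prefix xs \<phi>) \<longleftrightarrow> (\<exists>e'. (\<forall>x. x \<notin> set xs \<longrightarrow> e' x = e x) \<and> holds e' \<phi>)"
proof (induction xs arbitrary: e)
  case Nil
  have "(\<exists>e'. (\<forall>x. e' x = e x) \<and> holds e' \<phi>) \<longleftrightarrow> holds e \<phi>"
    by (metis ext)
  then show ?case by simp
next
  case (Cons y xs)
  have "(\<exists>a. \<exists>e'. (\<forall>x. x \<notin> set xs \<longrightarrow> e' x = (e(y := a)) x) \<and> holds e' \<phi>)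
      \<longleftrightarrow> (\<exists>e'. (\<forall>x. x \<notin> set (y # xs) \<longrightarrow> e' x = e x) \<and> holds e' \<phi>)"
  proof (intro iffI; elim exE conjE)
    fix a e' assume "\<forall>x. x \<notin> set xs \<longrightarrow> e' x = (e(y := a)) x" "holds e' \<phi>"
    then show "\<exists>e'. (\<forall>x. x \<notin> set (y # xs) \<longrightarrow> e' x = e x) \<and> holds e' \<phi>"
      by (intro exI[of _ e']) auto
  next
    fix e' assume "\<forall>x. x \<notin> set (y # xs) \<longrightarrow> e' x = e x" "holds e' \<phi>"
    then show "\<exists>a. \<exists>e'. (\<forall>x. x \<notin> set xs \<longrightarrow> e' x = (e(y := a)) x) \<and> holds e' \<phi>"
      by (intro exI[of _ "e' y"] exI[of _ e']) auto
  qed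
  then show ?case by (simp add: Cons.IH)
qed

lemma free_vars_ex_prefix: "free_vars (ex_prefix xs \<phi>) = free_vars \<phi> - set xs"
  by (induction xs) auto

text \<open>If the prefix binds all free variables, witnesses found in one environment serve in
  every other.\<close>

lemma true_sentence_ex_prefix:
  "true_sentence (ex_prefix xs \<phi>) \<longleftrightarrow> free_vars \<phi> \<subseteq> set xs \<and> (\<exists>e. holds e \<phi>)"
proof -
  have "holds e (ex_prefix xs \<phi>)" if "free_vars \<phi> \<subseteq> set xs" "holds e' \<phi>" for e e'
  proof -
    define e'' where "e'' x = (if x \<in> set xs then e' x else e x)" for x
    have "holds e' \<phi> = holds e'' \<phi>"
      by (rule holds_cong) (use that(1) in \<open>auto simp: e''_def\<close>)
    then show ?thesis
      unfolding holds_ex_prefix using that(2) by (intro exI[of _ e'']) (auto simp: e''_def)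
  qed
  then show ?thesis
    by (auto simp: true_sentence_def sentence_def free_vars_ex_prefix holds_ex_prefix)
qed

text \<open>Used with \<open>T\<close> the variables of the polynomial, \<open>A\<close> the renamed
  free variables of the formula and \<open>B\<close> the auxiliary ones: whether the prefix binds
  all of \<open>T\<close> depends on \<open>A\<close> alone.\<close>

lemma subset_Un_iff_of_between:
  "A \<subseteq> T \<Longrightarrow> T \<subseteq> A \<union> B \<Longrightarrow> T \<subseteq> C \<union> B \<longleftrightarrow> A \<subseteq> C \<union> B"
  by blast

lemma true_sentence_to_feasible:
  assumes \<psi>: "quantifier_free \<psi>"
  shows "true_sentence (to_feasible (ex_prefix xs \<psi>)) \<longleftrightarrow> true_sentence (ex_prefix xs \<psi>)"
proof -
  let ?m = "fst (compile \<psi> 0)" and ?is = "snd (compile \<psi> 0)"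
  let ?root = "(SClose, regs [] [] (ones ?m))"
  have pos: "0 < ?m"
    and lower: "ov ` free_vars \<psi> \<subseteq> (\<Union>i \<in> set ?is. item_vars i)"
    and upper: "(\<Union>i \<in> set ?is. item_vars i) \<subseteq> ov ` free_vars \<psi> \<union> aux_vars 0 ?m"
    and root_value: "\<And>e. \<forall>i \<in> set ?is. item_holds e i \<Longrightarrow> e (zv ?m) = of_bool (holds (\<lambda>x. e (ov x)) \<psi>)"
    and satisfiable: "\<And>e. \<exists>e'. (\<forall>x. x \<notin> aux_vars 0 ?m \<longrightarrow> e' x = e x) \<and> (\<forall>i \<in> set ?is. item_holds e' i)"
    using compiles_fm[OF \<psi>, of 0] by (simp_all add: compiles_def)
  have root: "item_holds e ?root \<longleftrightarrow> e (zv ?m) = 1" "item_vars ?root = {zv ?m}" for e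
    by (auto simp: item_holds_def peval_def item_vars_def)
  have aux: "set (concat (map node_vars [1..<Suc ?m])) = aux_vars 0 ?m"
    by (simp only: set_concat set_map set_upt aux_vars_0) (simp add: set_node_vars)
  have "trm_vars (items_poly (all_items \<psi>)) \<subseteq> ov ` set xs \<union> aux_vars 0 ?m \<longleftrightarrow> free_vars \<psi> \<subseteq> set xs"
  proof -
    have "ov y \<notin> aux_vars 0 ?m" for y by (auto simp: aux_vars_def)
    then have *: "ov ` free_vars \<psi> \<subseteq> ov ` set xs \<union> aux_vars 0 ?m \<longleftrightarrow> free_vars \<psi> \<subseteq> set xs" by auto
    have tv: "trm_vars (items_poly (all_items \<psi>)) = (\<Union>i \<in> set ?is. item_vars i) \<union> {zv ?m}"
      by (auto simp: trm_vars_items_poly all_items_def root)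
    have "ov ` free_vars \<psi> \<subseteq> trm_vars (items_poly (all_items \<psi>))"
      unfolding tv by (rule subset_trans[OF lower Un_upper1])
    moreover have "trm_vars (items_poly (all_items \<psi>)) \<subseteq> ov ` free_vars \<psi> \<union> aux_vars 0 ?m"
      unfolding tv by (rule Un_least[OF upper]) (rule insert_subset[THEN iffD2], rule conjI[OF UnI2 empty_subsetI], simp add: pos)
    ultimately show ?thesis using * by (simp only: subset_Un_iff_of_between)
  qed
  moreover have "(\<exists>e. eval e (items_poly (all_items \<psi>)) = 0) \<longleftrightarrow> (\<exists>e. holds e \<psi>)"
  proof
    assume "\<exists>e. eval e (items_poly (all_items \<psi>)) = 0"
    then obtain e where "\<forall>i \<in> set ?is. item_holds e i" "item_holds e ?root"
      by (auto simp: eval_items_poly_eq_0 all_items_def)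
    then have "of_bool (holds (\<lambda>x. e (ov x)) \<psi>) = (1 :: real)" using root_value[of e] root(1)[of e] by simp
    then show "\<exists>e. holds e \<psi>" by (auto simp: of_bool_def split: if_splits)
  next
    assume "\<exists>e. holds e \<psi>"
    then obtain e0 where e0: "holds e0 \<psi>" by blast
    \<comment> \<open>\<open>tl\<close> undoes \<open>ov\<close>, so this environment gives
      \<open>ov y\<close> the value of \<open>y\<close> under \<open>e0\<close>.\<close>
    obtain e where e: "\<forall>x. x \<notin> aux_vars 0 ?m \<longrightarrow> e x = e0 (tl x)" "\<forall>i \<in> set ?is. item_holds e i"
      using satisfiable[of "\<lambda>x. e0 (tl x)"] by blast
    have "(\<lambda>x. e (ov x)) = e0"
      using e(1) by (auto simp: aux_vars_def ov_def av_def)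
    with root_value[OF e(2)] e0 have "e (zv ?m) = 1" by simp
    with e(2) show "\<exists>e. eval e (items_poly (all_items \<psi>)) = 0"
      by (auto simp: eval_items_poly_eq_0 all_items_def root)
  qed
  ultimately show ?thesis
    unfolding to_feasible_def strip_ex_prefix[OF \<psi>] Let_def prod.case true_sentence_ex_prefix
      set_append set_map aux
    by simp
qed

section \<open>The translation in polynomial time\<close>

text \<open>The text produced for an operator is fixed up to the subscripts in the registers; such a
  template is a constant of the program.\<close>

datatype elem = Tok sym | Reg nat

fun expand :: "(nat \<Rightarrow> bool list) \<Rightarrow> elem \<Rightarrow> sym list" where
  "expand \<rho> (Tok s) = [s]"
| "expand \<rho> (Reg r) = map SSub (\<rho> r)"

definition expands_to :: "(nat \<Rightarrow> bool list) \<Rightarrow> elem list \<Rightarrow> sym list" where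
  "expands_to \<rho> es = concat (map (expand \<rho>) es)"

lemma expands_to_simps [simp]:
  "expands_to \<rho> [] = []" "expands_to \<rho> (x # es) = expand \<rho> x @ expands_to \<rho> es"
  "expands_to \<rho> (es @ fs) = expands_to \<rho> es @ expands_to \<rho> fs"
  "expands_to \<rho> (map Tok u) = u" "expands_to \<rho> (replicate n (Tok s)) = replicate n s"
  "expands_to \<rho> (map (\<lambda>b. Tok (SSub b)) p) = map SSub p"
  by (induction u; induction n; induction p; simp add: expands_to_def)+

definition factor_elems :: "factor \<Rightarrow> elem list" where
  "factor_elems f = Tok STimes # Tok SVar # map (\<lambda>b. Tok (SSub b)) (fst f) @ [Reg (snd f), Tok SClose]"

definition mon_elems :: "int \<times> factor list \<Rightarrow> elem list" where
  "mon_elems m = replicate (length (snd m)) (Tok SOpen) @ map Tok (trm_word (numeral_trm (nat \<bar>fst m\<bar>)))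
     @ concat (map factor_elems (snd m))"

definition sign_sym :: "int \<Rightarrow> sym" where
  "sign_sym c = (if c < 0 then SMinus else SPlus)"

definition item_elems :: "sym \<Rightarrow> elem list" where
  "item_elems k = concat (map (\<lambda>m. Tok (sign_sym (fst m)) # mon_elems m @ [Tok SClose]) (squares k))"

definition item_text :: "item \<Rightarrow> sym list" where
  "item_text i = expands_to (snd i) (item_elems (fst i))"

lemma replicate_Cons_append: "replicate n x @ x # ys = x # replicate n x @ ys"
  by (induction n) auto

text \<open>Bracketing to the left puts all opening parentheses in front, so each factor contributes
  a separate piece of text at the end.\<close>

lemma trm_word_foldl_Times:
  "trm_word (foldl (\<lambda>t f. Times t (Var (fvar \<rho> f))) t fs)
    = replicate (length fs) SOpen @ trm_word t @ expands_to \<rho> (concat (map factor_elems fs))"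
  by (induction fs arbitrary: t)
    (auto simp: factor_elems_def var_word_def fvar_def replicate_Cons_append)

lemma trm_word_mon_trm: "trm_word (mon_trm \<rho> m) = expands_to \<rho> (mon_elems m)"
  by (simp add: mon_trm_def mon_elems_def trm_word_foldl_Times)

text \<open>For the same reason the sum can be written item by item during the traversal; only the
  number of opening parentheses is known last.\<close>

lemma trm_word_poly_trm:
  "trm_word (poly_trm ms) = replicate (length ms) SOpen @ SZero
    # concat (map (\<lambda>(c, t). sign_sym c # trm_word t @ [SClose]) ms)"
proof -
  have "trm_word (foldl (\<lambda>p (c, t). if c < 0 then Minus p t else Plus p t) p ms)
      = replicate (length ms) SOpen @ trm_word p
        @ concat (map (\<lambda>(c, t). sign_sym c # trm_word t @ [SClose]) ms)" for p
    by (induction ms arbitrary: p) (auto simp: sign_sym_def replicate_Cons_append)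
  then show ?thesis by (simp add: poly_trm_def)
qed

definition num_mons :: "item list \<Rightarrow> nat" where
  "num_mons is = (\<Sum>i\<leftarrow>is. length (squares (fst i)))"

lemma trm_word_items_poly:
  "trm_word (items_poly is) = replicate (num_mons is) SOpen @ SZero # concat (map item_text is)"
proof -
  have "concat (map (\<lambda>(c, t). sign_sym c # trm_word t @ [SClose]) (item_mons i)) = item_text i" for i
  proof -
    have "expands_to \<rho> (concat (map (\<lambda>m. Tok (sign_sym (fst m)) # mon_elems m @ [Tok SClose]) ms))
        = concat (map (\<lambda>m. sign_sym (fst m) # trm_word (mon_trm \<rho> m) @ [SClose]) ms)" for \<rho> ms
      by (induction ms) (auto simp: trm_word_mon_trm)
    then show ?thesis
      by (simp add: item_text_def item_elems_def item_mons_def o_def)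
  qed
  then have "concat (map (\<lambda>(c, t). sign_sym c # trm_word t @ [SClose]) (concat (map item_mons is)))
      = concat (map item_text is)"
    by (induction "is") auto
  moreover have "length (concat (map item_mons is)) = num_mons is"
    by (induction "is") (auto simp: num_mons_def item_mons_def)
  ultimately show ?thesis by (simp add: items_poly_def trm_word_poly_trm)
qed

definition node_elems :: "elem list" where
  "node_elems = concat (map (\<lambda>(k, l). [Tok SEx, Tok SVar, Tok (SSub False), Tok (SSub k), Tok (SSub l), Reg 4])
     [(False, False), (False, True), (True, False), (True, True)])"

definition quants :: "var list \<Rightarrow> sym list" where
  "quants xs = concat (map (\<lambda>x. SEx # var_word x) xs)"

lemma quants_simps [simp]: "quants [] = []" "quants (x # xs) = SEx # var_word x @ quants xs"
    "quants (xs @ ys) = quants xs @ quants ys"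
  by (simp_all add: quants_def)

lemma node_elems: "expands_to (regs a b (ones j)) node_elems = quants (node_vars j)"
  by (simp add: node_elems_def node_vars_def av_def var_word_def regs_def)

subsection \<open>The program\<close>

text \<open>
  Stack 0 holds the unread input, 1 the pending operators and operands, 2 to 4 the registers,
  5 the sum, 6 the quantifiers, 7 the opening parentheses of the sum, 8 a loop counter and 9 is
  scratch space. Stacks 5 and 6 are in reverse. The letter \<open>Done\<close> is put back into the input when a
  node is finished, so that the step function can look for a preceding negation.
\<close>

definition sl :: "sym \<Rightarrow> nat" where
  "sl s = token_letter (Sy s)"

lemma sl_range: "sl s \<in> {1..40}" "1 \<le> sl s" "Suc 0 \<le> sl s" "sl s \<le> 40" "sl s \<noteq> 0"
  using token_letter_range[of "Sy s"] by (auto simp: sl_def)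

lemma sl_inj [simp]: "sl s = sl s' \<longleftrightarrow> s = s'"
  by (auto simp: sl_def dest: sym_number_inj)

lemma letter_token_sl [simp]: "letter_token (sl s) = Sy s"
  by (simp only: sl_def letter_token)

fun emit1 :: "nat \<Rightarrow> elem \<Rightarrow> store \<Rightarrow> store" where
  "emit1 j (Tok x) s = s(j := sl x # s j)"
| "emit1 j (Reg r) s = s(9 := [], j := s r @ s j)"

definition emit :: "nat \<Rightarrow> elem list \<Rightarrow> store \<Rightarrow> store" where
  "emit j es = fold (emit1 j) es"

definition ok_elems :: "elem list \<Rightarrow> bool" where
  "ok_elems es \<longleftrightarrow> (\<forall>r. Reg r \<in> set es \<longrightarrow> r \<in> {2, 3, 4})"

lemma ptime_emit: "j \<in> {5, 6} \<Longrightarrow> ok_elems es \<Longrightarrow> ptime (emit j es)"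
proof (induction es)
  case Nil
  then show ?case by (simp add: emit_def ptime_id id_def)
next
  case (Cons x es)
  have 1: "ptime (emit1 j x)"
  proof (cases x)
    case (Tok y)
    then have "emit1 j x = (\<lambda>s. s(j := sl y # s j))" by (simp add: fun_eq_iff)
    moreover have "ptime (\<lambda>s. s(j := sl y # s j))"
      using Cons.prems(1) sl_range[of y] by (intro ptime_push) auto
    ultimately show ?thesis by simp
  next
    case (Reg r)
    then have "r \<in> {2, 3, 4}" using Cons.prems(2) by (auto simp: ok_elems_def)
    then have "ptime (\<lambda>s. s(9 := [], j := s r @ s j))"
      using Cons.prems(1) by (intro ptime_copy) auto
    moreover have "emit1 j x = (\<lambda>s. s(9 := [], j := s r @ s j))" using Reg by (simp add: fun_eq_iff)
    ultimately show ?thesis by simp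
  qed
  have "ptime (emit j es)"
    using Cons by (auto simp: ok_elems_def)
  from ptime_comp[OF 1 this] show ?case by (simp add: emit_def o_def)
qed

lemma emit_indep: "j \<in> {5, 6} \<Longrightarrow> ok_elems es \<Longrightarrow> emit j es (s(8 := x)) = (emit j es s)(8 := x)"
proof (induction es arbitrary: s)
  case (Cons e es)
  have "emit1 j e (s(8 := x)) = (emit1 j e s)(8 := x)"
  proof (cases e)
    case (Tok y)
    then show ?thesis using Cons.prems(1) by (simp add: fun_eq_iff) linarith
  next
    case (Reg r)
    then have "r \<noteq> 8" using Cons.prems(2) by (auto simp: ok_elems_def)
    then show ?thesis using Reg Cons.prems(1) by (simp add: fun_eq_iff) linarith
  qed
  moreover have "emit j es ((emit1 j e s)(8 := x)) = (emit j es (emit1 j e s))(8 := x)"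
    by (rule Cons.IH) (use Cons.prems in \<open>auto simp: ok_elems_def\<close>)
  ultimately show ?case by (simp only: emit_def fold_simps)
qed (simp add: emit_def)

lemma emit_lengths:
  assumes "j \<in> {5, 6}" "ok_elems es"
  shows "\<exists>u t. emit j es s = s(9 := t, j := u @ s j) \<and> length t \<le> length (s 9) \<and>
    length u \<le> length es * (1 + length (s 2) + length (s 3) + length (s 4))"
  using assms(2)
proof (induction es arbitrary: s)
  case Nil
  have "emit j [] s = s(9 := s 9, j := [] @ s j)" by (simp add: emit_def)
  then show ?case by fastforce
next
  case (Cons e es)
  let ?m = "1 + length (s 2) + length (s 3) + length (s 4)"
  have "\<exists>u t. emit1 j e s = s(9 := t, j := u @ s j) \<and> length t \<le> length (s 9) \<and> length u \<le> ?m"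
  proof (cases e)
    case (Tok x)
    then have "emit1 j e s = s(9 := s 9, j := [sl x] @ s j)" by simp
    then show ?thesis by fastforce
  next
    case (Reg r)
    then have "emit1 j e s = s(9 := [], j := s r @ s j)" by simp
    moreover have "length (s r) \<le> ?m" using Reg Cons.prems by (auto simp: ok_elems_def)
    ultimately show ?thesis by (intro exI[of _ "s r"] exI[of _ "[]"]) auto
  qed
  then obtain u t where ut: "emit1 j e s = s(9 := t, j := u @ s j)" "length t \<le> length (s 9)" "length u \<le> ?m"
    by blast
  let ?s = "s(9 := t, j := u @ s j)"
  have m: "1 + length (?s 2) + length (?s 3) + length (?s 4) = ?m" using assms(1) by auto
  have "ok_elems es" using Cons.prems by (auto simp: ok_elems_def)
  from Cons.IH[OF this, of ?s] obtain v t' where vt: "emit j es ?s = ?s(9 := t', j := v @ ?s j)"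
      "length t' \<le> length (?s 9)" "length v \<le> length es * ?m"
    unfolding m by blast
  have "emit j (e # es) s = emit j es ?s" by (simp add: emit_def ut(1))
  also have "\<dots> = s(9 := t', j := (v @ u) @ s j)" unfolding vt(1) using assms(1) by (auto simp: fun_eq_iff)
  finally show ?case
    using ut(2,3) vt(2,3) assms(1) by (intro exI[of _ "v @ u"] exI[of _ t']) auto
qed

text \<open>Registers hold their subscripts in reverse, as stacks 5 and 6 hold the output, so a
  register can be copied onto the output without turning it round.\<close>

lemma emit_eq:
  assumes "j \<in> {5, 6}" "ok_elems es" "s 9 = []"
    and "\<And>r. r \<in> {2, 3, 4} \<Longrightarrow> s r = map sl (rev (map SSub (\<rho> r)))"
  shows "emit j es s = s(j := rev (map sl (expands_to \<rho> es)) @ s j)"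
  using assms(2-)
proof (induction es arbitrary: s)
  case Nil
  then show ?case by (simp add: emit_def)
next
  case (Cons e es)
  let ?s = "s(j := rev (map sl (expand \<rho> e)) @ s j)"
  have 1: "emit1 j e s = ?s"
  proof (cases e)
    case (Reg r)
    then have "s r = map sl (rev (map SSub (\<rho> r)))" using Cons.prems by (auto simp: ok_elems_def)
    with Reg Cons.prems(2) show ?thesis by (simp add: rev_map fun_eq_iff)
  qed simp
  have "emit j es ?s = ?s(j := rev (map sl (expands_to \<rho> es)) @ ?s j)"
    by (rule Cons.IH) (use Cons.prems assms(1) in \<open>auto simp: ok_elems_def\<close>)
  then show ?case by (simp add: emit_def 1)
qed

lemma ok_item_elems: "ok_elems (item_elems k)"
proof -
  have "snd f \<in> {2, 3, 4}" if "P \<in> set (constraints k)" "m \<in> set P" "f \<in> set (snd m)" for P m f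
    using that by (cases k) (auto split: prod.splits)
  then have "\<And>m f. m \<in> set (squares k) \<Longrightarrow> f \<in> set (snd m) \<Longrightarrow> snd f \<in> {2, 3, 4}"
    unfolding squares_def tsquare_def by fastforce
  then show ?thesis
    by (auto simp: ok_elems_def item_elems_def mon_elems_def factor_elems_def)
qed

lemma ok_node_elems: "ok_elems node_elems"
  by (auto simp: ok_elems_def node_elems_def)

definition emit_item :: "sym \<Rightarrow> store \<Rightarrow> store" where
  "emit_item k s = (let s1 = emit 5 (item_elems k) s in
     s1(7 := replicate (length (squares k)) (sl SOpen) @ s1 7))"

text \<open>The number on stack 4 is raised before anything is written, because both the quantifiers
  and the constraints of the new node use it as the result register.\<close>

definition new_node :: "sym \<Rightarrow> store \<Rightarrow> store" where
  "new_node k s = (let s1 = emit_item k (emit 6 node_elems (s(4 := sl (SSub True) # s 4))) in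
     s1(0 := token_letter Done # s1 0))"

definition clear_AB :: "store \<Rightarrow> store" where
  "clear_AB s = s(2 := [], 3 := [])"

definition pour :: "nat \<Rightarrow> nat \<Rightarrow> nat set \<Rightarrow> store \<Rightarrow> store" where
  "pour i j A s = s(i := dropWhile (\<lambda>a. a \<in> A) (s i), j := rev (takeWhile (\<lambda>a. a \<in> A) (s i)) @ s j)"

definition subs :: "nat set" where
  "subs = {sl (SSub False), sl (SSub True)}"

text \<open>\<open>tl\<close> skips the symbol \<open>SVar\<close>, and the extra subscript turns
  the variable \<open>x\<close> into \<open>ov x\<close>.\<close>

definition bind_var :: "store \<Rightarrow> store" where
  "bind_var s = emit 6 [Tok SEx, Tok SVar, Tok (SSub True), Reg 2] (pour 0 2 subs (clear_AB (s(0 := tl (s 0)))))"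

definition reduce_op :: "nat \<Rightarrow> store \<Rightarrow> store" where
  "reduce_op a s = (let s1 = pour 1 2 {sl (SSub True)} (s(1 := tl (s 1))); s2 = s1(1 := tl (s1 1)) in
     case letter_token a of Sy k \<Rightarrow> new_node k s2 | _ \<Rightarrow> s2)"

text \<open>At a closing parenthesis stack 1 reads from the top: number of the right operand,
  operator, number of the left operand, \<open>SOpen\<close>. A unary number ends at the first other
  letter.\<close>

definition close_node :: "store \<Rightarrow> store" where
  "close_node s = (let s1 = pour 1 3 {sl (SSub True)} (clear_AB s) in reduce_op (peek (s1 1)) s1)"

text \<open>The finished node is always the latest, so stack 4 still holds its number. A pending
  negation creates another node and hence another \<open>Done\<close>, so that repeated negations
  are worked off one per step.\<close>

definition finish_node :: "store \<Rightarrow> store" where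
  "finish_node s = (if peek (s 1) \<in> {sl SNeg}
     then (let s1 = clear_AB (s(1 := tl (s 1))) in new_node SNeg (s1(9 := [], 2 := s1 4 @ s1 2)))
     else s(9 := [], 1 := s 4 @ s 1))"

definition read_letter :: "nat \<Rightarrow> store \<Rightarrow> store" where
  "read_letter a s = (case letter_token a of
     Done \<Rightarrow> finish_node s
   | Sy k \<Rightarrow>
      (if k = SEx then bind_var s
       else if k = SZero \<or> k = SOne then new_node k (clear_AB s)
       else if k = SVar then new_node k (pour 0 2 subs (clear_AB s))
       else if k = SClose then close_node s
       else s(1 := sl k # s 1))
   | _ \<Rightarrow> s)"

definition tstep :: "store \<Rightarrow> store" where
  "tstep s = (if peek (s 0) = 0 then s else read_letter (peek (s 0)) (s(0 := tl (s 0))))"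

section \<open>The steps of the translation in polynomial time\<close>

lemma ptime_emit_item: "ptime (emit_item k)"
proof -
  have "ptime (\<lambda>s. s(7 := replicate (length (squares k)) (sl SOpen) @ s 7))"
    using sl_range[of SOpen] by (intro ptime_push_list) auto
  from ptime_comp[OF ptime_emit[OF _ ok_item_elems] this, of 5] show ?thesis
    unfolding emit_item_def[abs_def] Let_def by simp
qed

lemma ptime_new_node: "ptime (new_node k)"
proof -
  have 1: "ptime (\<lambda>s. s(4 := sl (SSub True) # s 4))" "ptime (\<lambda>s. s(0 := token_letter Done # s 0))"
    using sl_range by (auto intro!: ptime_push)
  show ?thesis
    unfolding new_node_def[abs_def] Let_def
    by (rule ptime_comp[OF ptime_comp[OF ptime_comp[OF 1(1) ptime_emit[OF _ ok_node_elems]] ptime_emit_item] 1(2)])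
      simp
qed

lemma ptime_clear_AB: "ptime clear_AB"
  unfolding clear_AB_def[abs_def] by (rule ptime_comp[OF ptime_clear ptime_clear]) auto

lemma ptime_pour_AB: "i < 10 \<Longrightarrow> j < 10 \<Longrightarrow> i \<noteq> j \<Longrightarrow> 0 \<notin> A \<Longrightarrow> ptime (pour i j A)"
  unfolding pour_def[abs_def] by (rule ptime_pour) auto

lemma subs_0: "0 \<notin> subs" "0 \<notin> {sl (SSub True)}"
  using sl_range by (auto simp: subs_def)

lemma ptime_bind_var: "ptime bind_var"
proof -
  have 1: "ptime (emit 6 [Tok SEx, Tok SVar, Tok (SSub True), Reg 2])"
    by (rule ptime_emit) (auto simp: ok_elems_def)
  show ?thesis
    unfolding bind_var_def[abs_def]
    by (rule ptime_comp[OF ptime_comp[OF ptime_comp[OF ptime_pop ptime_clear_AB] ptime_pour_AB] 1])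
      (auto simp: subs_0)
qed

lemma ptime_reduce_op: "ptime (reduce_op a)"
proof -
  have "ptime (\<lambda>s. (\<lambda>s1. s1(1 := tl (s1 1))) (pour 1 2 {sl (SSub True)} (s(1 := tl (s 1)))))"
    by (rule ptime_comp[OF ptime_comp[OF ptime_pop ptime_pour_AB] ptime_pop]) (use subs_0 in auto)
  from ptime_comp[OF this ptime_new_node] this show ?thesis
    unfolding reduce_op_def[abs_def] Let_def by (cases "letter_token a") auto
qed

lemma ptime_close_node: "ptime close_node"
proof -
  have 1: "ptime (\<lambda>s. reduce_op (peek (s 1)) s)"
    by (rule ptime_switch) (auto intro: ptime_reduce_op)
  show ?thesis
    unfolding close_node_def[abs_def] Let_def
    by (rule ptime_comp[OF ptime_comp[OF ptime_clear_AB ptime_pour_AB] 1]) (use subs_0 in auto)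
qed

lemma ptime_finish_node: "ptime finish_node"
proof -
  have 1: "ptime (\<lambda>s. s(9 := [], 2 := s 4 @ s 2))" "ptime (\<lambda>s. s(9 := [], 1 := s 4 @ s 1))"
    by (rule ptime_copy; simp)+
  have "ptime (\<lambda>s. let s1 = clear_AB (s(1 := tl (s 1))) in new_node SNeg (s1(9 := [], 2 := s1 4 @ s1 2)))"
    unfolding Let_def
    by (rule ptime_comp[OF ptime_comp[OF ptime_comp[OF ptime_pop ptime_clear_AB] 1(1)] ptime_new_node]) simp
  then show ?thesis
    unfolding finish_node_def[abs_def] by (intro ptime_if 1(2)) simp
qed

lemma ptime_read_letter: "ptime (read_letter a)"
proof (cases "letter_token a")
  case (Sy k)
  have "ptime (\<lambda>s. new_node k (clear_AB s))" "ptime (\<lambda>s. new_node k (pour 0 2 subs (clear_AB s)))"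
      "ptime (\<lambda>s. s(1 := sl k # s 1))"
    using ptime_comp[OF ptime_clear_AB ptime_new_node]
      ptime_comp[OF ptime_comp[OF ptime_clear_AB ptime_pour_AB] ptime_new_node, of 0 2 subs k]
      ptime_push[of 1 "sl k"] sl_range[of k] subs_0 by auto
  with Sy ptime_bind_var ptime_close_node show ?thesis
    unfolding read_letter_def[abs_def] by (cases k) auto
qed (auto simp: read_letter_def[abs_def] ptime_finish_node ptime_id)

lemma ptime_tstep: "ptime tstep"
proof -
  have "ptime (\<lambda>s. (\<lambda>a s. if a = 0 then s else read_letter a (s(0 := tl (s 0)))) (peek (s 0)) s)"
  proof (rule ptime_switch)
    show "ptime (\<lambda>s. if a = 0 then s else read_letter a (s(0 := tl (s 0))))" for a
      using ptime_comp[OF ptime_pop ptime_read_letter, of 0 a] by (cases "a = 0") (auto simp: ptime_id)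
  qed simp
  then show ?thesis by (simp add: tstep_def[abs_def])
qed

section \<open>Independence of the steps from the loop counter\<close>

lemma upd_8: "k \<noteq> 8 \<Longrightarrow> s(8 := x, k := y) = s(k := y, 8 := x)" for s :: store
  by (rule fun_upd_twist) simp

lemma emit_item_indep: "emit_item k (s(8 := x)) = (emit_item k s)(8 := x)"
  using emit_indep[OF _ ok_item_elems, of 5] by (simp add: emit_item_def Let_def upd_8)

lemma new_node_indep: "new_node k (s(8 := x)) = (new_node k s)(8 := x)"
  using emit_indep[OF _ ok_node_elems, of 6] by (simp add: new_node_def Let_def upd_8 emit_item_indep)

lemma clear_AB_indep: "clear_AB (s(8 := x)) = (clear_AB s)(8 := x)"
  by (simp add: clear_AB_def upd_8)

lemma pour_indep: "i \<noteq> 8 \<Longrightarrow> j \<noteq> 8 \<Longrightarrow> pour i j A (s(8 := x)) = (pour i j A s)(8 := x)"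
  by (simp add: pour_def upd_8)

lemma bind_var_indep: "bind_var (s(8 := x)) = (bind_var s)(8 := x)"
  using emit_indep[of 6 "[Tok SEx, Tok SVar, Tok (SSub True), Reg 2]"]
  by (simp add: bind_var_def upd_8 clear_AB_indep pour_indep ok_elems_def)

lemma reduce_op_indep: "reduce_op a (s(8 := x)) = (reduce_op a s)(8 := x)"
  by (simp add: reduce_op_def Let_def upd_8 pour_indep new_node_indep split: token.split)

lemma close_node_indep: "close_node (s(8 := x)) = (close_node s)(8 := x)"
  by (simp add: close_node_def Let_def clear_AB_indep pour_indep reduce_op_indep)

lemma finish_node_indep: "finish_node (s(8 := x)) = (finish_node s)(8 := x)"
  by (simp add: finish_node_def Let_def upd_8 clear_AB_indep new_node_indep)

lemma read_letter_indep: "read_letter a (s(8 := x)) = (read_letter a s)(8 := x)"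
proof (cases "letter_token a")
  case (Sy k)
  then show ?thesis
    by (simp add: read_letter_def upd_8 bind_var_indep new_node_indep clear_AB_indep pour_indep close_node_indep)
qed (simp_all add: read_letter_def finish_node_indep)

lemma tstep_indep: "tstep (s(8 := x)) = (tstep s)(8 := x)"
  by (simp add: tstep_def upd_8 read_letter_indep)

subsection \<open>Running time of the translation\<close>

lemma finite_sym: "finite (UNIV :: sym set)"
proof (rule finite_imageD)
  show "finite (sym_number ` UNIV)"
    by (rule finite_subset[of _ "{..21}"]) (use sym_number_le in auto)
  show "inj sym_number" by (auto intro: injI dest: sym_number_inj)
qed

text \<open>24 is the length of \<open>node_elems\<close>: four quantifiers of six elements. It also
  covers the short text of \<open>bind_var\<close>.\<close>

definition text_bound :: nat where
  "text_bound = 24 + (\<Sum>k\<in>UNIV. length (item_elems k) + length (squares k))"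

lemma text_bound: "length (item_elems k) \<le> text_bound" "length (squares k) \<le> text_bound"
    "length node_elems \<le> text_bound" "24 \<le> text_bound"
proof -
  have "length (item_elems k) + length (squares k) \<le> (\<Sum>k\<in>UNIV. length (item_elems k) + length (squares k))"
    by (rule member_le_sum) (auto simp: finite_sym)
  then show "length (item_elems k) \<le> text_bound" "length (squares k) \<le> text_bound"
    by (auto simp: text_bound_def)
qed (auto simp: text_bound_def node_elems_def)

text \<open>These stacks feed what a step writes. The output stacks are left out on purpose: growth
  measured against the whole store would only give an exponential bound.\<close>

definition material :: "store \<Rightarrow> nat" where
  "material s = length (s 0) + length (s 1) + length (s 2) + length (s 3)"

lemma store_size_material:
  "store_size s = material s + length (s 4) + length (s 5) + length (s 6) + length (s 7) + length (s 8) + length (s 9)"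
proof -
  have "{..<10 :: nat} = {0, 1, 2, 3, 4, 5, 6, 7, 8, 9}" by auto
  then show ?thesis by (simp add: store_size_def material_def)
qed

text \<open>Before writing, a step only discards or moves material, or copies one node number; the
  copy accounts for \<open>length (s 4)\<close>.\<close>

definition prepares :: "store \<Rightarrow> store \<Rightarrow> bool" where
  "prepares s t \<longleftrightarrow> t 4 = s 4 \<and> material t \<le> material s + length (s 4) \<and>
     t 5 = s 5 \<and> t 6 = s 6 \<and> t 7 = s 7 \<and> t 8 = s 8 \<and> length (t 9) \<le> length (s 9)"

text \<open>The bounds are used in this order: stack 4 gains at most one letter per step and stays
  linear, so material is at most quadratic and the whole store at most cubic.\<close>

definition grows :: "store \<Rightarrow> store \<Rightarrow> bool" where
  "grows s t \<longleftrightarrow> length (t 4) \<le> length (s 4) + 1 \<and> material t \<le> material s + length (s 4) + 2 \<and>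
     store_size t \<le> store_size s + (1 + 3 * text_bound) * (2 + material s + 2 * length (s 4))"

lemma grows_prepares: "prepares s t \<Longrightarrow> grows s t"
  by (auto simp: prepares_def grows_def store_size_material)

lemma grows_emit:
  assumes "prepares s t" "ok_elems es" "length es \<le> text_bound"
  shows "grows s (emit 6 es t)"
proof -
  obtain u v where e: "emit 6 es t = t(9 := v, 6 := u @ t 6)" "length v \<le> length (t 9)"
      "length u \<le> length es * (1 + length (t 2) + length (t 3) + length (t 4))"
    using emit_lengths[OF _ assms(2), of 6 t] by auto
  have "length es * (1 + length (t 2) + length (t 3) + length (t 4))
      \<le> text_bound * (2 + material s + 2 * length (s 4))"
    using assms(1,3) by (intro mult_le_mono) (auto simp: prepares_def material_def)
  with e assms(1) show ?thesis
    by (auto simp: prepares_def grows_def store_size_material material_def algebra_simps)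
qed

lemma grows_new_node:
  assumes "prepares s t"
  shows "grows s (new_node k t)"
proof -
  let ?m = "2 + material s + 2 * length (s 4)"
  let ?t = "t(4 := sl (SSub True) # t 4)"
  have le: "1 + length (t 2) + length (t 3) + Suc (length (t 4)) \<le> ?m"
    using assms by (auto simp: prepares_def material_def)
  obtain u v where e: "emit 6 node_elems ?t = ?t(9 := v, 6 := u @ t 6)" "length v \<le> length (t 9)"
      "length u \<le> length node_elems * (1 + length (t 2) + length (t 3) + Suc (length (t 4)))"
    using emit_lengths[OF _ ok_node_elems, of 6 ?t] by auto
  let ?t2 = "?t(9 := v, 6 := u @ t 6)"
  obtain x y where e2: "emit 5 (item_elems k) ?t2 = ?t2(9 := y, 5 := x @ t 5)" "length y \<le> length v"
      "length x \<le> length (item_elems k) * (1 + length (t 2) + length (t 3) + Suc (length (t 4)))"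
    using emit_lengths[of 5 "item_elems k" ?t2, OF _ ok_item_elems] by auto
  have u: "length u \<le> text_bound * ?m"
    using e(3) mult_le_mono[OF text_bound(3) le] by linarith
  have x: "length x \<le> text_bound * ?m"
    using e2(3) mult_le_mono[OF text_bound(1) le] by (rule le_trans)
  have "text_bound * 1 \<le> text_bound * ?m" by (intro mult_le_mono) auto
  then have q: "length (squares k) \<le> text_bound * ?m" using text_bound(2)[of k] by linarith
  have nn: "new_node k t = ?t2(9 := y, 5 := x @ t 5, 7 := replicate (length (squares k)) (sl SOpen) @ t 7,
      0 := token_letter Done # t 0)"
    by (simp add: new_node_def emit_item_def Let_def e(1) e2(1) del: token_letter.simps)
  have "store_size (new_node k t) = store_size t + 2 + length u + length x + length (squares k) + length y - length (t 9)"
    unfolding nn using e(2) e2(2) by (simp add: store_size_material material_def)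
  then have "store_size (new_node k t) \<le> store_size t + 2 + 3 * (text_bound * ?m)"
    using u x q e(2) e2(2) by linarith
  moreover have "store_size t \<le> store_size s + length (s 4)"
    using assms by (auto simp: prepares_def store_size_material)
  moreover have "(1 + 3 * text_bound) * ?m = ?m + 3 * (text_bound * ?m)"
    by (simp add: algebra_simps)
  ultimately have "store_size (new_node k t) \<le> store_size s + (1 + 3 * text_bound) * ?m" by linarith
  moreover have "length (new_node k t 4) = Suc (length (s 4))" "material (new_node k t) = Suc (material t)"
    unfolding nn using assms by (simp_all add: material_def prepares_def)
  ultimately show ?thesis
    using assms by (auto simp: grows_def prepares_def)
qed

lemma length_takeWhile_dropWhile: "length (takeWhile P xs) + length (dropWhile P xs) = length xs"
  by (metis length_append takeWhile_dropWhile_id)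

lemma prepares_clear_AB: "prepares s t \<Longrightarrow> prepares s (clear_AB t)"
  by (auto simp: prepares_def clear_AB_def material_def)

lemma material_pour:
  assumes "(i, j) \<in> {(0, 2), (1, 2), (1, 3)}"
  shows "material (pour i j A t) = material t"
proof -
  define x where "x = takeWhile (\<lambda>a. a \<in> A) (t i)"
  define y where "y = dropWhile (\<lambda>a. a \<in> A) (t i)"
  have "pour i j A t = t(i := y, j := rev x @ t j)" "length (t i) = length x + length y"
    using length_takeWhile_dropWhile[of "\<lambda>a. a \<in> A" "t i"] by (simp_all add: pour_def x_def y_def)
  then show ?thesis using assms by (elim insertE) (simp_all add: material_def)
qed

lemma prepares_pour:
  assumes "(i, j) \<in> {(0, 2), (1, 2), (1, 3)}" "prepares s t"
  shows "prepares s (pour i j A t)"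
proof -
  have "pour i j A t k = t k" if "k \<ge> 4" for k
    using assms(1) that by (elim insertE) (simp_all add: pour_def)
  with material_pour[OF assms(1), of A t] assms(2) show ?thesis by (simp add: prepares_def)
qed

lemma prepares_tl: "i \<in> {0, 1} \<Longrightarrow> prepares s t \<Longrightarrow> prepares s (t(i := tl (t i)))"
  by (auto simp: prepares_def material_def)

lemma grows_reduce_op: "prepares s t \<Longrightarrow> grows s (reduce_op a t)"
proof -
  assume "prepares s t"
  then have "prepares s (t(1 := tl (t 1)))" by (rule prepares_tl[rotated]) simp
  then have "prepares s (pour 1 2 {sl (SSub True)} (t(1 := tl (t 1))))" by (rule prepares_pour[rotated]) simp
  then have "prepares s ((pour 1 2 {sl (SSub True)} (t(1 := tl (t 1))))(1 := tl (pour 1 2 {sl (SSub True)} (t(1 := tl (t 1))) 1)))"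
    by (rule prepares_tl[rotated]) simp
  with grows_new_node grows_prepares show ?thesis
    unfolding reduce_op_def Let_def by (cases "letter_token a") auto
qed

lemma grows_tstep: "grows s (tstep s)"
proof (cases "s 0")
  case Nil
  have "prepares s s" by (simp add: prepares_def)
  with Nil grows_prepares show ?thesis by (simp add: tstep_def)
next
  case (Cons a r)
  let ?s = "s(0 := r)"
  have p: "prepares s ?s" using Cons by (simp add: prepares_def material_def)
  have "grows s (read_letter a ?s)"
  proof (cases "letter_token a")
    case (Sy k)
    have "prepares s (?s(1 := sl k # ?s 1))"
      using Cons by (simp add: prepares_def material_def)
    moreover have "grows s (bind_var ?s)"
      unfolding bind_var_def
      by (rule grows_emit[OF prepares_pour[OF _ prepares_clear_AB[OF prepares_tl[OF _ p]]]])
        (use text_bound(4) in \<open>auto simp: ok_elems_def\<close>)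
    moreover have "grows s (close_node ?s)"
      unfolding close_node_def Let_def
      by (rule grows_reduce_op[OF prepares_pour[OF _ prepares_clear_AB[OF p]]]) simp
    moreover have "grows s (new_node k (clear_AB ?s))"
      by (rule grows_new_node[OF prepares_clear_AB[OF p]])
    moreover have "grows s (new_node k (pour 0 2 subs (clear_AB ?s)))"
      by (rule grows_new_node[OF prepares_pour[OF _ prepares_clear_AB[OF p]]]) simp
    ultimately show ?thesis
      using grows_prepares by (auto simp: read_letter_def Sy)
  next
    case Done
    have "prepares s ((clear_AB (?s(1 := tl (?s 1))))(9 := [], 2 := clear_AB (?s(1 := tl (?s 1))) 4 @ clear_AB (?s(1 := tl (?s 1))) 2))"
      using Cons by (auto simp: prepares_def material_def clear_AB_def)
    then have "grows s (new_node SNeg ((clear_AB (?s(1 := tl (?s 1))))(9 := [], 2 := clear_AB (?s(1 := tl (?s 1))) 4 @ clear_AB (?s(1 := tl (?s 1))) 2)))"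
      by (rule grows_new_node)
    moreover have "prepares s (?s(9 := [], 1 := ?s 4 @ ?s 1))"
      using Cons by (auto simp: prepares_def material_def)
    ultimately show ?thesis
      using grows_prepares by (simp add: read_letter_def Done finish_node_def Let_def)
  qed (use p grows_prepares in \<open>simp_all add: read_letter_def\<close>)
  moreover have "tstep s = s \<or> tstep s = read_letter a ?s"
    using Cons by (auto simp: tstep_def)
  moreover have "grows s s" by (rule grows_prepares) (simp add: prepares_def)
  ultimately show ?thesis by metis
qed

lemma ptime_translate_loop: "ptime (\<lambda>s. ((tstep ^^ length (s 8)) s)(8 := []))"
proof (rule ptime_for[OF ptime_tstep])
  let ?C = "1 + 3 * text_bound"
  define q where "q = [:0, 1:] + [:0, 1:] * smult ?C ([:2:] + ([:0, 1:] + [:0, 1:] * [:2, 2:]) + smult 4 [:0, 1:])"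
  fix s :: store and i assume "i \<le> length (s 8)"
  define M where "M = store_size s"
  have i: "i \<le> M" using \<open>i \<le> length (s 8)\<close> length_le_store_size[of 8 s] by (simp add: M_def)
  \<comment> \<open>Bounds the growth in any single step: as at most M steps are made, material
    stays within M + M(2M + 2) and stack 4 within 2M.\<close>
  define B where "B = ?C * (2 + (M + M * (2 * M + 2)) + 4 * M)"
  have "j \<le> M \<Longrightarrow> length ((tstep ^^ j) s 4) \<le> M + j \<and> material ((tstep ^^ j) s) \<le> M + j * (2 * M + 2) \<and>
      store_size ((tstep ^^ j) s) \<le> M + j * B" for j
  proof (induction j)
    case 0
    then show ?case by (simp add: M_def store_size_material)
  next
    case (Suc j)
    let ?t = "(tstep ^^ j) s"
    have IH: "length (?t 4) \<le> M + j" "material ?t \<le> M + j * (2 * M + 2)" "store_size ?t \<le> M + j * B"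
      using Suc by simp_all
    note g = grows_tstep[of ?t, unfolded grows_def]
    have c: "length (?t 4) \<le> 2 * M" using IH(1) Suc.prems by simp
    have "j * (2 * M + 2) \<le> M * (2 * M + 2)" using Suc.prems by (intro mult_le_mono) auto
    then have "2 + material ?t + 2 * length (?t 4) \<le> 2 + (M + M * (2 * M + 2)) + 4 * M"
      using IH(2) c by linarith
    then have "?C * (2 + material ?t + 2 * length (?t 4)) \<le> B"
      unfolding B_def by (rule mult_le_mono2)
    then have "store_size (tstep ?t) \<le> M + Suc j * B"
      using g IH(3) by simp
    moreover have "material (tstep ?t) \<le> M + Suc j * (2 * M + 2)"
      using g IH(2) c by simp
    moreover have "length (tstep ?t 4) \<le> M + Suc j" using g IH(1) by simp
    ultimately show ?case by simp
  qed
  then have "store_size ((tstep ^^ i) s) \<le> M + i * B" using i by blast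
  also have "\<dots> \<le> M + M * B" using i by simp
  also have "\<dots> = poly q M" by (simp add: q_def B_def algebra_simps)
  finally show "store_size ((tstep ^^ i) s) \<le> poly q (store_size s)" by (simp add: M_def)
qed (auto simp: tstep_indep)

text \<open>Two steps per symbol of the input suffice, one for reading it and one for a possible
  \<open>Done\<close>. The output is assembled from its end, since stack 0 grows to the left;
  \<open>emit_item SClose\<close> adds the constraint on the root, whose number is still on stack
  4.\<close>

definition translate :: "store \<Rightarrow> store" where
  "translate s =
     (let s1 = load (load s);
          s2 = ((tstep ^^ length (s1 8)) s1)(8 := []);
          s3 = emit 5 [Tok (SRel Eq), Tok SZero, Tok SClose] (emit_item SClose (clear_AB s2));
          s4 = s3(0 := []);
          s5 = s4(5 := [], 0 := rev (s4 5) @ s4 0);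
          s6 = s5(0 := sl SZero # s5 0);
          s7 = s6(7 := [], 0 := rev (s6 7) @ s6 0);
          s8 = s7(0 := sl SOpen # s7 0)
      in s8(6 := [], 0 := rev (s8 6) @ s8 0))"

lemma ptime_translate: "ptime translate"
proof -
  have load: "ptime load"
    unfolding load_def[abs_def] by (rule ptime_copy) auto
  have out: "ptime (emit 5 [Tok (SRel Eq), Tok SZero, Tok SClose])"
    by (rule ptime_emit) (auto simp: ok_elems_def)
  have push: "ptime (\<lambda>s. s(0 := sl k # s 0))" for k
    using sl_range by (intro ptime_push) auto
  have pour: "ptime (\<lambda>s. s(5 := [], 0 := rev (s 5) @ s 0))" "ptime (\<lambda>s. s(7 := [], 0 := rev (s 7) @ s 0))"
      "ptime (\<lambda>s. s(6 := [], 0 := rev (s 6) @ s 0))"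
    by (rule ptime_pour_all; simp)+
  have clear: "ptime (\<lambda>s. s(0 := []))"
    by (rule ptime_clear) simp
  note ptime_comp[OF load load, THEN ptime_comp, OF ptime_translate_loop, THEN ptime_comp, OF ptime_clear_AB,
      THEN ptime_comp, OF ptime_emit_item, THEN ptime_comp, OF out, THEN ptime_comp, OF clear,
      THEN ptime_comp, OF pour(1), THEN ptime_comp, OF push, THEN ptime_comp, OF pour(2),
      THEN ptime_comp, OF push, THEN ptime_comp, OF pour(3)]
  then show ?thesis
    unfolding translate_def[abs_def] Let_def .
qed

subsection \<open>Correctness of the translation\<close>

declare token_letter.simps [simp del]

definition ol :: "nat \<Rightarrow> nat list" where
  "ol n = replicate n (sl (SSub True))"

lemma map_ones [simp]: "map sl (map SSub (ones n)) = ol n" "rev (ol n) = ol n"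
    "map sl (rev (map SSub (ones n))) = ol n" "rev (map sl (map SSub (ones n))) = ol n"
  by (simp_all add: ones_def ol_def)

lemma ol_Suc: "ol (Suc n) = sl (SSub True) # ol n"
  by (simp add: ol_def)

text \<open>Ties the store to a partial run of \<open>compile\<close>: \<open>n\<close> nodes
  numbered, constraints \<open>is\<close> written, prefix \<open>xs\<close> read. The operand
  registers and the counter are left open.\<close>

definition in_state :: "store \<Rightarrow> token list \<Rightarrow> nat list \<Rightarrow> nat \<Rightarrow> item list \<Rightarrow> var list \<Rightarrow> bool" where
  "in_state s inp stk n is xs \<longleftrightarrow> s 0 = map token_letter inp \<and> s 1 = stk \<and> s 4 = ol n \<and>
     s 5 = rev (map sl (concat (map item_text is))) \<and>
     s 6 = rev (map sl (quants (map ov xs @ concat (map node_vars [1..<Suc n])))) \<and>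
     s 7 = replicate (num_mons is) (sl SOpen) \<and> s 9 = []"

lemma emit_item_eq:
  assumes "s 9 = []" "\<And>r. r \<in> {2, 3, 4} \<Longrightarrow> s r = map sl (rev (map SSub (\<rho> r)))"
  shows "emit_item k s = s(5 := rev (map sl (item_text (k, \<rho>))) @ s 5,
    7 := replicate (length (squares k)) (sl SOpen) @ s 7)"
  using emit_eq[of 5 "item_elems k" s \<rho>, OF _ ok_item_elems assms] by (simp add: emit_item_def item_text_def Let_def)

lemma in_state_new_node:
  assumes s: "in_state s inp stk n is xs"
    and a: "s 2 = map sl (rev (map SSub a))" and b: "s 3 = map sl (rev (map SSub b))"
  shows "in_state (new_node k s) (Done # inp) stk (Suc n) (is @ [(k, regs a b (ones (Suc n)))]) xs"
proof -
  let ?\<rho> = "regs a b (ones (Suc n))"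
  define t where "t = s(4 := sl (SSub True) # s 4)"
  have t: "t r = map sl (rev (map SSub (?\<rho> r)))" if "r \<in> {2, 3, 4}" for r
    using that s a b by (auto simp: t_def regs_def in_state_def ol_Suc simp del: map_map)
  have t9: "t 9 = []" using s by (simp add: t_def in_state_def)
  define u where "u = t(6 := rev (map sl (quants (node_vars (Suc n)))) @ t 6)"
  have 1: "emit 6 node_elems t = u"
    using emit_eq[of 6 node_elems t ?\<rho>, OF _ ok_node_elems t9 t] by (simp add: u_def node_elems)
  have u9: "u 9 = []" using t9 by (simp add: u_def)
  have ur: "u r = map sl (rev (map SSub (?\<rho> r)))" if "r \<in> {2, 3, 4}" for r
    using t[OF that] that by (auto simp: u_def)
  have "new_node k s = u(5 := rev (map sl (item_text (k, ?\<rho>))) @ u 5,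
      7 := replicate (length (squares k)) (sl SOpen) @ u 7, 0 := token_letter Done # u 0)"
  proof -
    have "emit_item k u = u(5 := rev (map sl (item_text (k, ?\<rho>))) @ u 5,
        7 := replicate (length (squares k)) (sl SOpen) @ u 7)"
      by (rule emit_item_eq) (use u9 ur in auto)
    then show ?thesis
      unfolding new_node_def t_def[symmetric] 1 by (simp)
  qed
  moreover have "replicate (length (squares k)) x @ replicate (num_mons is) x
      = replicate (num_mons (is @ [(k, ?\<rho>)])) x" for x :: nat
    by (simp add: num_mons_def add.commute flip: replicate_add)
  ultimately show ?thesis
    using s by (simp add: in_state_def u_def t_def ol_Suc del: map_map)
qed

lemma in_state_upd [simp]:
  "k \<in> {2, 3, 8} \<Longrightarrow> in_state (s(k := x)) inp stk n is xs = in_state s inp stk n is xs"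
  by (auto simp: in_state_def)

lemma in_state_clear_AB [simp]: "in_state (clear_AB s) inp stk n is xs = in_state s inp stk n is xs"
  by (simp add: clear_AB_def)

lemma clear_AB_apply [simp]: "clear_AB s 2 = []" "clear_AB s 3 = []"
    "r \<notin> {2, 3} \<Longrightarrow> clear_AB s r = s r"
  by (auto simp: clear_AB_def)

lemma tstep_eq:
  assumes "in_state s (x # inp) stk n is xs"
  shows "tstep s = read_letter (token_letter x) (s(0 := map token_letter inp))"
    and "in_state (s(0 := map token_letter inp)) inp stk n is xs"
  using assms by (auto simp: tstep_def in_state_def)

lemma read_letter_simps:
  "read_letter (token_letter Done) s = finish_node s"
  "read_letter (token_letter (Sy k)) s =
      (if k = SEx then bind_var s
       else if k = SZero \<or> k = SOne then new_node k (clear_AB s)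
       else if k = SVar then new_node k (pour 0 2 subs (clear_AB s))
       else if k = SClose then close_node s
       else s(1 := sl k # s 1))"
  unfolding read_letter_def letter_token by simp_all

lemma tstep_push:
  assumes "in_state s (Sy k # inp) stk n is xs" "k \<notin> {SEx, SZero, SOne, SVar, SClose}"
  shows "in_state (tstep s) inp (sl k # stk) n is xs"
  using tstep_eq[OF assms(1)] assms(2) by (simp add: read_letter_simps in_state_def)

lemma tstep_const:
  assumes "in_state s (Sy k # inp) stk n is xs" "k \<in> {SZero, SOne}"
  shows "in_state (tstep s) (Done # inp) stk (Suc n) (is @ [(k, regs [] [] (ones (Suc n)))]) xs"
proof -
  let ?s = "s(0 := map token_letter inp)"
  have "in_state (new_node k (clear_AB ?s)) (Done # inp) stk (Suc n) (is @ [(k, regs [] [] (ones (Suc n)))]) xs"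
    by (rule in_state_new_node) (use tstep_eq(2)[OF assms(1)] in simp_all)
  then show ?thesis using tstep_eq(1)[OF assms(1)] assms(2) by (auto simp: read_letter_simps)
qed

definition no_sub_tok :: "token list \<Rightarrow> bool" where
  "no_sub_tok u \<longleftrightarrow> (\<forall>b v. u \<noteq> Sy (SSub b) # v)"

lemma pour_subs:
  assumes "no_sub_tok inp"
  shows "takeWhile (\<lambda>a. a \<in> subs) (map token_letter (map Sy (map SSub x) @ inp)) = map sl (map SSub x)"
    and "dropWhile (\<lambda>a. a \<in> subs) (map token_letter (map Sy (map SSub x) @ inp)) = map token_letter inp"
proof -
  have inp: "takeWhile (\<lambda>a. a \<in> subs) (map token_letter inp) = []
      \<and> dropWhile (\<lambda>a. a \<in> subs) (map token_letter inp) = map token_letter inp"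
  proof (cases inp)
    case (Cons y v)
    have "token_letter y = sl (SSub b) \<longleftrightarrow> y = Sy (SSub b)" for b
      using inj_token_letter by (simp only: sl_def inj_eq)
    with Cons assms show ?thesis by (auto simp: no_sub_tok_def subs_def)
  qed simp
  have "sl (SSub b) \<in> subs" for b by (cases b) (auto simp: subs_def)
  then have x: "takeWhile (\<lambda>a. a \<in> subs) (map sl (map SSub x) @ u) = map sl (map SSub x) @ takeWhile (\<lambda>a. a \<in> subs) u"
      "dropWhile (\<lambda>a. a \<in> subs) (map sl (map SSub x) @ u) = dropWhile (\<lambda>a. a \<in> subs) u" for u
    by (induction x) auto
  have e: "map token_letter (map Sy (map SSub x) @ inp) = map sl (map SSub x) @ map token_letter inp"
    by (simp add: sl_def)
  show "takeWhile (\<lambda>a. a \<in> subs) (map token_letter (map Sy (map SSub x) @ inp)) = map sl (map SSub x)"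
    and "dropWhile (\<lambda>a. a \<in> subs) (map token_letter (map Sy (map SSub x) @ inp)) = map token_letter inp"
    unfolding e x using inp by simp_all
qed

lemma in_state_pour_subs:
  assumes "in_state s (map Sy (map SSub x) @ inp) stk n is xs" "no_sub_tok inp"
  shows "in_state (pour 0 2 subs (clear_AB s)) inp stk n is xs"
    and "pour 0 2 subs (clear_AB s) 2 = map sl (rev (map SSub x))" "pour 0 2 subs (clear_AB s) 3 = []"
proof -
  have s0: "s 0 = map token_letter (map Sy (map SSub x) @ inp)" using assms(1) by (simp only: in_state_def)
  have c0: "clear_AB s 0 = s 0" by simp
  have "pour 0 2 subs (clear_AB s) = (clear_AB s)(0 := map token_letter inp, 2 := map sl (rev (map SSub x)))"
    unfolding pour_def c0 s0 pour_subs[OF assms(2)] by (simp add: rev_map)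
  then show "in_state (pour 0 2 subs (clear_AB s)) inp stk n is xs"
    and "pour 0 2 subs (clear_AB s) 2 = map sl (rev (map SSub x))" "pour 0 2 subs (clear_AB s) 3 = []"
    using assms(1) by (auto simp: in_state_def)
qed

lemma tstep_var:
  assumes "in_state s (map Sy (var_word x) @ inp) stk n is xs" "no_sub_tok inp"
  shows "in_state (tstep s) (Done # inp) stk (Suc n) (is @ [(SVar, regs x [] (ones (Suc n)))]) xs"
proof -
  have 1: "in_state s (Sy SVar # map Sy (map SSub x) @ inp) stk n is xs"
    using assms(1) by (simp add: var_word_def)
  note p = in_state_pour_subs[OF tstep_eq(2)[OF 1] assms(2)]
  have "in_state (new_node SVar (pour 0 2 subs (clear_AB (s(0 := map token_letter (map Sy (map SSub x) @ inp))))))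
      (Done # inp) stk (Suc n) (is @ [(SVar, regs x [] (ones (Suc n)))]) xs"
    by (rule in_state_new_node[OF p(1,2)]) (simp only: p(3) list.map rev.simps)
  then show ?thesis
    unfolding tstep_eq(1)[OF 1] read_letter_simps by simp
qed

lemma in_state_quant:
  "in_state s inp stk 0 is xs \<Longrightarrow> in_state (s(6 := rev (map sl (quants [ov x])) @ s 6)) inp stk 0 is (xs @ [x])"
  by (simp add: in_state_def)

text \<open>The prefix is read while no node exists yet, so the original quantifiers come before
  those of the nodes.\<close>

lemma tstep_bind:
  assumes "in_state s (Sy SEx # map Sy (var_word x) @ inp) stk 0 is xs" "no_sub_tok inp"
  shows "in_state (tstep s) inp stk 0 is (xs @ [x])"
proof -
  let ?s = "s(0 := map token_letter (map Sy (var_word x) @ inp))"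
  have "in_state ?s (Sy SVar # map Sy (map SSub x) @ inp) stk 0 is xs"
    using tstep_eq(2)[OF assms(1)] by (simp add: var_word_def)
  then have "in_state (?s(0 := tl (?s 0))) (map Sy (map SSub x) @ inp) stk 0 is xs"
    by (simp add: in_state_def)
  note p = in_state_pour_subs[OF this assms(2)]
  let ?t = "pour 0 2 subs (clear_AB (?s(0 := tl (?s 0))))"
  let ?es = "[Tok SEx, Tok SVar, Tok (SSub True), Reg 2]"
  have "?t r = map sl (rev (map SSub (regs x [] (ones 0) r)))" if "r \<in> {2, 3, 4}" for r
    using that p(1,2,3) by (auto simp: regs_def in_state_def)
  then have "emit 6 ?es ?t = ?t(6 := rev (map sl (expands_to (regs x [] (ones 0)) ?es)) @ ?t 6)"
    using p(1) by (intro emit_eq) (auto simp: ok_elems_def in_state_def)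
  moreover have "tstep s = emit 6 ?es ?t"
    unfolding tstep_eq(1)[OF assms(1)] read_letter_simps bind_var_def by simp
  ultimately have "tstep s = ?t(6 := rev (map sl (expands_to (regs x [] (ones 0)) ?es)) @ ?t 6)" by simp
  moreover have "expands_to (regs x [] (ones 0)) ?es = quants [ov x]"
    by (simp add: regs_def ov_def var_word_def)
  ultimately show ?thesis
    using in_state_quant[OF p(1)] by (simp only:)
qed

lemma tstep_done:
  assumes "in_state s (Done # inp) stk n is xs" "peek stk \<noteq> sl SNeg"
  shows "in_state (tstep s) inp (ol n @ stk) n is xs"
  using tstep_eq[OF assms(1)] assms(2)
  by (simp add: read_letter_simps finish_node_def in_state_def)

lemma tstep_neg:
  assumes "in_state s (Done # inp) (sl SNeg # stk) n is xs"
  shows "in_state (tstep s) (Done # inp) stk (Suc n) (is @ [(SNeg, regs (ones n) [] (ones (Suc n)))]) xs"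
proof -
  let ?s = "s(0 := map token_letter inp)"
  let ?t = "(clear_AB (?s(1 := tl (?s 1))))(9 := [], 2 := ol n)"
  have s: "in_state ?s inp (sl SNeg # stk) n is xs" by (rule tstep_eq(2)[OF assms])
  have "in_state (new_node SNeg ?t) (Done # inp) stk (Suc n) (is @ [(SNeg, regs (ones n) [] (ones (Suc n)))]) xs"
    by (rule in_state_new_node) (use s in \<open>auto simp: in_state_def\<close>)
  moreover have "tstep s = new_node SNeg ?t"
    using s tstep_eq(1)[OF assms]
    by (simp add: read_letter_simps finish_node_def in_state_def Let_def)
  ultimately show ?thesis by simp
qed

lemma takeWhile_ol:
  "k \<noteq> SSub True \<Longrightarrow> takeWhile (\<lambda>a. a \<in> {sl (SSub True)}) (ol n @ sl k # u) = ol n"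
  "k \<noteq> SSub True \<Longrightarrow> dropWhile (\<lambda>a. a \<in> {sl (SSub True)}) (ol n @ sl k # u) = sl k # u"
  by (induction n) (auto simp: ol_def)

lemma tstep_close:
  assumes "in_state s (Sy SClose # inp) (ol b @ sl k # ol a @ sl SOpen # stk) n is xs" "k \<noteq> SSub True"
  shows "in_state (tstep s) (Done # inp) stk (Suc n) (is @ [(k, regs (ones a) (ones b) (ones (Suc n)))]) xs"
proof -
  let ?s = "s(0 := map token_letter inp)"
  have s: "in_state ?s inp (ol b @ sl k # ol a @ sl SOpen # stk) n is xs" by (rule tstep_eq(2)[OF assms(1)])
  then have s1: "?s 1 = ol b @ sl k # ol a @ sl SOpen # stk" by (simp only: in_state_def)
  let ?t = "?s(1 := stk, 2 := ol a, 3 := ol b)"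
  have p1: "pour 1 3 {sl (SSub True)} (clear_AB ?s) = ?s(1 := sl k # ol a @ sl SOpen # stk, 2 := [], 3 := ol b)"
    unfolding pour_def using s1 takeWhile_ol[OF assms(2)] by (simp add: fun_eq_iff clear_AB_def)
  have p2: "pour 1 2 {sl (SSub True)} (?s(1 := ol a @ sl SOpen # stk, 2 := [], 3 := ol b))
      = ?s(1 := sl SOpen # stk, 2 := ol a, 3 := ol b)"
    unfolding pour_def using takeWhile_ol[of SOpen] by (simp add: fun_eq_iff)
  let ?X = "?s(1 := sl k # ol a @ sl SOpen # stk, 2 := [], 3 := ol b)"
  let ?Y = "?s(1 := sl SOpen # stk, 2 := ol a, 3 := ol b)"
  have X: "peek (?X 1) = sl k" "?X(1 := tl (?X 1)) = ?s(1 := ol a @ sl SOpen # stk, 2 := [], 3 := ol b)"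
    by (simp_all add: fun_eq_iff)
  have Y: "?Y(1 := tl (?Y 1)) = ?t" by (simp add: fun_eq_iff)
  have "close_node ?s = new_node k ?t"
    unfolding close_node_def Let_def p1 X(1) reduce_op_def X(2) p2 letter_token_sl token.case Y ..
  then have "tstep s = new_node k ?t"
    using tstep_eq(1)[OF assms(1)] by (simp add: read_letter_simps)
  moreover have "in_state (new_node k ?t) (Done # inp) stk (Suc n) (is @ [(k, regs (ones a) (ones b) (ones (Suc n)))]) xs"
    by (rule in_state_new_node) (use s in \<open>auto simp: in_state_def\<close>)
  ultimately show ?thesis by simp
qed

section \<open>Counting the steps of the translation\<close>

definition runs :: "nat \<Rightarrow> store \<Rightarrow> (store \<Rightarrow> bool) \<Rightarrow> bool" where
  "runs k s P \<longleftrightarrow> (\<exists>j \<le> k. P ((tstep ^^ j) s))"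

lemma runs_step: "P (tstep s) \<Longrightarrow> runs 1 s P"
  unfolding runs_def by (intro exI[of _ 1]) simp

lemma runs_mono: "runs a s P \<Longrightarrow> a \<le> b \<Longrightarrow> runs b s P"
  unfolding runs_def by (meson le_trans)

lemma runs_trans:
  assumes "runs a s P" "\<And>t. P t \<Longrightarrow> runs b t Q" "a + b \<le> c"
  shows "runs c s Q"
proof -
  obtain i where i: "i \<le> a" "P ((tstep ^^ i) s)" using assms(1) by (auto simp: runs_def)
  obtain j where j: "j \<le> b" "Q ((tstep ^^ j) ((tstep ^^ i) s))" using assms(2)[OF i(2)] by (auto simp: runs_def)
  then have "Q ((tstep ^^ (j + i)) s)" by (simp add: funpow_add)
  then show ?thesis using i(1) j(1) assms(3) unfolding runs_def by (intro exI[of _ "j + i"]) simp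
qed

text \<open>The claim stops with \<open>Done\<close> unread, because the next step depends on
  whether \<open>stk\<close> has a negation pending. This unread letter is the 1 subtracted from two
  steps per symbol, and negation uses that bound up exactly.\<close>

definition processes :: "sym list \<Rightarrow> (nat \<Rightarrow> nat \<times> item list) \<Rightarrow> bool" where
  "processes u f \<longleftrightarrow> u \<noteq> [] \<and> (\<forall>s inp stk n is xs. no_sub_tok inp \<longrightarrow> in_state s (map Sy u @ inp) stk n is xs \<longrightarrow>
     runs (2 * length u - 1) s (\<lambda>t. in_state t (Done # inp) stk (fst (f n)) (is @ snd (f n)) xs))"

lemma processesD:
  "processes u f \<Longrightarrow> no_sub_tok inp \<Longrightarrow> in_state s (map Sy u @ inp) stk n is xs \<Longrightarrow>
    runs (2 * length u - 1) s (\<lambda>t. in_state t (Done # inp) stk (fst (f n)) (is @ snd (f n)) xs)"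
  unfolding processes_def by blast

lemma no_sub_tok_Sy [simp]: "no_sub_tok (Sy k # u) \<longleftrightarrow> no_sub [k]"
  by (auto simp: no_sub_tok_def)

text \<open>When an operand is finished, the top of the pending stack is \<open>SOpen\<close> or the
  operator, never \<open>SNeg\<close>, so its number is pushed there.\<close>

lemma processes_op:
  assumes u: "processes u f" and v: "processes v g"
    and k: "k \<notin> {SEx, SZero, SOne, SVar, SClose, SNeg}" "no_sub [k]"
  shows "processes (SOpen # u @ k # v @ [SClose]) (\<lambda>n. join k (f n) (g (fst (f n))))"
  unfolding processes_def
proof (intro conjI allI impI)
  fix s inp stk n "is" xs
  assume "in_state s (map Sy (SOpen # u @ k # v @ [SClose]) @ inp) stk n is xs"
  then have s: "in_state s (Sy SOpen # map Sy u @ Sy k # map Sy v @ Sy SClose # inp) stk n is xs" by simp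
  let ?p = "f n" and ?q = "g (fst (f n))"
  have k': "k \<noteq> SSub True" using k(2) by auto
  have ne: "length u \<ge> 1" "length v \<ge> 1"
    using u v by (auto simp: processes_def Suc_le_eq)
  have 1: "runs 1 s (\<lambda>t. in_state t (map Sy u @ Sy k # map Sy v @ Sy SClose # inp) (sl SOpen # stk) n is xs)"
    by (rule runs_step) (use tstep_push[OF s] in simp)
  have 2: "runs (2 * length u - 1) t (\<lambda>t. in_state t (Done # Sy k # map Sy v @ Sy SClose # inp)
      (sl SOpen # stk) (fst ?p) (is @ snd ?p) xs)"
    if "in_state t (map Sy u @ Sy k # map Sy v @ Sy SClose # inp) (sl SOpen # stk) n is xs" for t
    by (rule processesD[OF u _ that]) (use k(2) in simp)
  have 3: "runs 1 t (\<lambda>t. in_state t (Sy k # map Sy v @ Sy SClose # inp)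
      (ol (fst ?p) @ sl SOpen # stk) (fst ?p) (is @ snd ?p) xs)"
    if "in_state t (Done # Sy k # map Sy v @ Sy SClose # inp) (sl SOpen # stk) (fst ?p) (is @ snd ?p) xs" for t
    by (rule runs_step) (rule tstep_done[OF that], simp)
  have 4: "runs 1 t (\<lambda>t. in_state t (map Sy v @ Sy SClose # inp)
      (sl k # ol (fst ?p) @ sl SOpen # stk) (fst ?p) (is @ snd ?p) xs)"
    if "in_state t (Sy k # map Sy v @ Sy SClose # inp) (ol (fst ?p) @ sl SOpen # stk) (fst ?p) (is @ snd ?p) xs" for t
    by (rule runs_step) (rule tstep_push[OF that], use k in simp)
  have 5: "runs (2 * length v - 1) t (\<lambda>t. in_state t (Done # Sy SClose # inp)
      (sl k # ol (fst ?p) @ sl SOpen # stk) (fst ?q) ((is @ snd ?p) @ snd ?q) xs)"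
    if "in_state t (map Sy v @ Sy SClose # inp) (sl k # ol (fst ?p) @ sl SOpen # stk) (fst ?p) (is @ snd ?p) xs" for t
    by (rule processesD[OF v _ that]) simp
  have 6: "runs 1 t (\<lambda>t. in_state t (Sy SClose # inp)
      (ol (fst ?q) @ sl k # ol (fst ?p) @ sl SOpen # stk) (fst ?q) ((is @ snd ?p) @ snd ?q) xs)"
    if "in_state t (Done # Sy SClose # inp) (sl k # ol (fst ?p) @ sl SOpen # stk) (fst ?q) ((is @ snd ?p) @ snd ?q) xs" for t
    by (rule runs_step) (rule tstep_done[OF that], use k in simp)
  have 7: "runs 1 t (\<lambda>t. in_state t (Done # inp) stk (fst (join k ?p ?q)) (is @ snd (join k ?p ?q)) xs)"
    if "in_state t (Sy SClose # inp) (ol (fst ?q) @ sl k # ol (fst ?p) @ sl SOpen # stk) (fst ?q) ((is @ snd ?p) @ snd ?q) xs" for t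
    by (rule runs_step) (use tstep_close[OF that k'] in \<open>simp add: join_def\<close>)
  show "runs (2 * length (SOpen # u @ k # v @ [SClose]) - 1) s
      (\<lambda>t. in_state t (Done # inp) stk (fst (join k ?p ?q)) (is @ snd (join k ?p ?q)) xs)"
    by (rule runs_trans[OF runs_trans[OF runs_trans[OF runs_trans[OF runs_trans[OF runs_trans[OF
      1 2 order_refl] 3 order_refl] 4 order_refl] 5 order_refl] 6 order_refl] 7]) (use ne in auto)
qed simp

lemma processes_trm: "processes (trm_word t) (compile_trm t)"
proof (induction t)
  case (Var x)
  show ?case
    unfolding processes_def
  proof (intro conjI allI impI)
    fix s inp stk n "is" xs
    assume "no_sub_tok inp" "in_state s (map Sy (trm_word (Var x)) @ inp) stk n is xs"
    then have "runs 1 s (\<lambda>t. in_state t (Done # inp) stk (fst (compile_trm (Var x) n)) (is @ snd (compile_trm (Var x) n)) xs)"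
      using tstep_var[of s x inp stk n "is" xs] by (intro runs_step) simp
    then show "runs (2 * length (trm_word (Var x)) - 1) s
        (\<lambda>t. in_state t (Done # inp) stk (fst (compile_trm (Var x) n)) (is @ snd (compile_trm (Var x) n)) xs)"
      by (rule runs_mono) (simp add: var_word_def)
  qed (simp add: var_word_def)
next
  case Zero
  show ?case
    unfolding processes_def using tstep_const[of _ SZero] by (auto intro!: runs_step[unfolded One_nat_def])
next
  case One
  show ?case
    unfolding processes_def using tstep_const[of _ SOne] by (auto intro!: runs_step[unfolded One_nat_def])
next
  case (Plus s t)
  from processes_op[OF Plus.IH, of SPlus] show ?case by (simp add: Let_def processes_def)
next
  case (Minus s t)
  from processes_op[OF Minus.IH, of SMinus] show ?case by (simp add: Let_def processes_def)
next
  case (Times s t)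
  from processes_op[OF Times.IH, of STimes] show ?case by (simp add: Let_def processes_def)
qed

lemma processes_fm: "quantifier_free \<phi> \<Longrightarrow> processes (fm_word \<phi>) (compile \<phi>)"
proof (induction \<phi>)
  case (Rel r s t)
  from processes_op[OF processes_trm processes_trm, of "SRel r"] show ?case by (simp add: Let_def processes_def)
next
  case (Conj \<phi> \<psi>)
  then have "processes (fm_word \<phi>) (compile \<phi>)" "processes (fm_word \<psi>) (compile \<psi>)" by simp_all
  from processes_op[OF this, of SConj] show ?case by (simp add: Let_def processes_def)
next
  case (Disj \<phi> \<psi>)
  then have "processes (fm_word \<phi>) (compile \<phi>)" "processes (fm_word \<psi>) (compile \<psi>)" by simp_all
  from processes_op[OF this, of SDisj] show ?case by (simp add: Let_def processes_def)
next
  case (Equiv \<phi> \<psi>)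
  then have "processes (fm_word \<phi>) (compile \<phi>)" "processes (fm_word \<psi>) (compile \<psi>)" by simp_all
  from processes_op[OF this, of SEquiv] show ?case by (simp add: Let_def processes_def)
next
  case (Neg \<phi>)
  then have \<phi>: "processes (fm_word \<phi>) (compile \<phi>)" by simp
  have ne: "length (fm_word \<phi>) \<ge> 1" by (simp add: Suc_le_eq)
  show ?case
    unfolding processes_def
  proof (intro conjI allI impI)
    fix s inp stk n "is" xs
    assume inp: "no_sub_tok inp" and "in_state s (map Sy (fm_word (Neg \<phi>)) @ inp) stk n is xs"
    then have s: "in_state s (Sy SNeg # map Sy (fm_word \<phi>) @ inp) stk n is xs" by simp
    let ?p = "compile \<phi> n"
    have 1: "runs 1 s (\<lambda>t. in_state t (map Sy (fm_word \<phi>) @ inp) (sl SNeg # stk) n is xs)"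
      by (rule runs_step) (use tstep_push[OF s] in simp)
    have 2: "runs (2 * length (fm_word \<phi>) - 1) t
        (\<lambda>t. in_state t (Done # inp) (sl SNeg # stk) (fst ?p) (is @ snd ?p) xs)"
      if "in_state t (map Sy (fm_word \<phi>) @ inp) (sl SNeg # stk) n is xs" for t
      by (rule processesD[OF \<phi> inp that])
    have 3: "runs 1 t (\<lambda>t. in_state t (Done # inp) stk (fst (compile (Neg \<phi>) n)) (is @ snd (compile (Neg \<phi>) n)) xs)"
      if "in_state t (Done # inp) (sl SNeg # stk) (fst ?p) (is @ snd ?p) xs" for t
      by (rule runs_step) (use tstep_neg[OF that] in \<open>simp add: Let_def\<close>)
    show "runs (2 * length (fm_word (Neg \<phi>)) - 1) s
        (\<lambda>t. in_state t (Done # inp) stk (fst (compile (Neg \<phi>) n)) (is @ snd (compile (Neg \<phi>) n)) xs)"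
      by (rule runs_trans[OF runs_trans[OF 1 2 order_refl] 3]) (use ne in auto)
  qed simp
qed simp_all

lemma no_sub_tok_fm_word [simp]: "no_sub_tok (map Sy (fm_word \<phi>))"
  by (cases \<phi>) (auto simp: no_sub_tok_def)

text \<open>Here the last \<open>Done\<close> is read as well, so nothing is subtracted from two
  steps per symbol; the number of the root remains on stack 1.\<close>

lemma runs_ex_prefix:
  assumes \<psi>: "quantifier_free \<psi>"
  shows "in_state s (map Sy (fm_word (ex_prefix ys \<psi>))) [] 0 [] xs \<Longrightarrow>
    runs (2 * length (fm_word (ex_prefix ys \<psi>))) s (\<lambda>t. in_state t [] (ol (fst (compile \<psi> 0)))
      (fst (compile \<psi> 0)) (snd (compile \<psi> 0)) (xs @ ys))"
proof (induction ys arbitrary: s xs)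
  case Nil
  have ne: "length (fm_word \<psi>) \<ge> 1" by (simp add: Suc_le_eq)
  have 1: "runs (2 * length (fm_word \<psi>) - 1) s (\<lambda>t. in_state t [Done] []
      (fst (compile \<psi> 0)) (snd (compile \<psi> 0)) xs)"
  proof -
    have "no_sub_tok []" by (simp add: no_sub_tok_def)
    moreover have "in_state s (map Sy (fm_word \<psi>) @ []) [] 0 [] xs" using Nil by simp
    ultimately show ?thesis
      using processesD[OF processes_fm[OF \<psi>]] by fastforce
  qed
  have 2: "runs 1 t (\<lambda>t. in_state t [] (ol (fst (compile \<psi> 0))) (fst (compile \<psi> 0)) (snd (compile \<psi> 0)) xs)"
    if "in_state t [Done] [] (fst (compile \<psi> 0)) (snd (compile \<psi> 0)) xs" for t
    by (rule runs_step) (use tstep_done[OF that] sl_range(5)[of SNeg] in simp)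
  show ?case
    using runs_trans[OF 1 2, of "2 * length (fm_word \<psi>)"] ne by simp
next
  case (Cons y ys)
  let ?w = "fm_word (ex_prefix ys \<psi>)"
  have s: "in_state s (Sy SEx # map Sy (var_word y) @ map Sy ?w) [] 0 [] xs" using Cons.prems by simp
  have 1: "runs 1 s (\<lambda>t. in_state t (map Sy ?w) [] 0 [] (xs @ [y]))"
    by (rule runs_step) (rule tstep_bind[OF s], simp)
  have "runs (1 + 2 * length ?w) s (\<lambda>t. in_state t [] (ol (fst (compile \<psi> 0)))
      (fst (compile \<psi> 0)) (snd (compile \<psi> 0)) ((xs @ [y]) @ ys))"
    by (rule runs_trans[OF 1 Cons.IH order_refl])
  then have "runs (1 + 2 * length ?w) s (\<lambda>t. in_state t [] (ol (fst (compile \<psi> 0)))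
      (fst (compile \<psi> 0)) (snd (compile \<psi> 0)) (xs @ y # ys))"
    by (simp only: append_assoc append_Cons append_Nil)
  then show ?case by (rule runs_mono) simp
qed

lemma tstep_idle: "s 0 = [] \<Longrightarrow> tstep s = s"
  by (simp add: tstep_def)

lemma fm_word_to_feasible:
  assumes "quantifier_free \<psi>"
  shows "fm_word (to_feasible (ex_prefix xs \<psi>))
    = quants (map ov xs @ concat (map node_vars [1..<Suc (fst (compile \<psi> 0))]))
      @ SOpen # replicate (num_mons (all_items \<psi>)) SOpen @ SZero # concat (map item_text (all_items \<psi>))
      @ [SRel Eq, SZero, SClose]"
  unfolding to_feasible_def strip_ex_prefix[OF assms] Let_def prod.case fm_word_ex_prefix
  by (simp only: quants_def[symmetric] fm_word.simps trm_word_items_poly trm_word.simps) simp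

lemma translate:
  assumes \<psi>: "quantifier_free \<psi>"
  shows "translate (blank_store(0 := map token_letter (map Sy (fm_word (ex_prefix xs \<psi>))))) 0
    = map token_letter (map Sy (fm_word (to_feasible (ex_prefix xs \<psi>))))"
proof -
  let ?w = "map token_letter (map Sy (fm_word (ex_prefix xs \<psi>)))"
  let ?m = "fst (compile \<psi> 0)" and ?is = "snd (compile \<psi> 0)"
  let ?root = "(SClose, regs [] [] (ones ?m))"
  define s1 where "s1 = load (load (blank_store(0 := ?w)))"
  have "in_state s1 (map Sy (fm_word (ex_prefix xs \<psi>))) [] 0 [] []"
    by (simp add: in_state_def s1_def load_def num_mons_def ol_def)
  from runs_ex_prefix[OF \<psi> this] obtain j where j: "j \<le> 2 * length ?w"
      "in_state ((tstep ^^ j) s1) [] (ol ?m) ?m ?is xs"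
    by (auto simp: runs_def)
  have "length (s1 8) = 2 * length ?w" by (simp add: s1_def load_def)
  moreover have "(tstep ^^ i) t = t" if "t 0 = []" for i t
    using that by (induction i) (auto simp: tstep_idle)
  \<comment> \<open>The input may be used up before the counter; the steps left over are
    idle.\<close>
  ultimately have "(tstep ^^ length (s1 8)) s1 = (tstep ^^ j) s1"
    using j funpow_add[of "length (s1 8) - j" j tstep] by (simp add: in_state_def)
  with j(2) have s2: "in_state (((tstep ^^ length (s1 8)) s1)(8 := [])) [] (ol ?m) ?m ?is xs"
    by simp
  define t where "t = clear_AB (((tstep ^^ length (s1 8)) s1)(8 := []))"
  have t: "in_state t [] (ol ?m) ?m ?is xs" "t 2 = []" "t 3 = []"
    using s2 by (simp_all add: t_def)
  have r: "t r = map sl (rev (map SSub (regs [] [] (ones ?m) r)))" if "r \<in> {2, 3, 4}" for r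
    using that t by (auto simp: regs_def in_state_def)
  have t9: "t 9 = []" using t(1) by (simp add: in_state_def)
  define u where "u = t(5 := rev (map sl (item_text ?root)) @ t 5,
      7 := replicate (length (squares SClose)) (sl SOpen) @ t 7)"
  have emit1: "emit_item SClose t = u"
    unfolding u_def by (rule emit_item_eq) (use t9 r in auto)
  define v where "v = u(5 := rev (map sl [SRel Eq, SZero, SClose]) @ u 5)"
  have emit2: "emit 5 [Tok (SRel Eq), Tok SZero, Tok SClose] u = v"
    by (simp add: emit_def v_def)
  have v5: "rev (v 5) = map sl (concat (map item_text (all_items \<psi>)) @ [SRel Eq, SZero, SClose])"
    using t(1) by (simp add: v_def u_def in_state_def all_items_def)
  have v7: "rev (v 7) = map sl (replicate (num_mons (all_items \<psi>)) SOpen)"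
  proof -
    have "v 7 = replicate (length (squares SClose) + num_mons ?is) (sl SOpen)"
      using t(1) by (simp add: v_def u_def in_state_def replicate_add)
    then show ?thesis by (simp add: num_mons_def all_items_def add.commute)
  qed
  have v6: "rev (v 6) = map sl (quants (map ov xs @ concat (map node_vars [1..<Suc ?m])))"
    using t(1) by (simp add: v_def u_def in_state_def)
  have "translate (blank_store(0 := ?w)) 0 = rev (v 6) @ sl SOpen # rev (v 7) @ sl SZero # rev (v 5)"
    unfolding translate_def Let_def s1_def[symmetric] t_def[symmetric] emit1 emit2 by simp
  also have "\<dots> = map sl (fm_word (to_feasible (ex_prefix xs \<psi>)))"
    unfolding v5 v6 v7 fm_word_to_feasible[OF \<psi>] by simp
  also have "\<dots> = map token_letter (map Sy (fm_word (to_feasible (ex_prefix xs \<psi>))))"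
    by (simp add: sl_def)
  finally show ?thesis .
qed

section \<open>Completeness\<close>

lemma to_feasible_cls: "cls_fm (to_feasible \<phi>) \<in> {CEqZ, CExEqZ}"
  unfolding feasible_cls to_feasible_def case_prod_beta Let_def using standard_items_poly by blast

text \<open>One map serves both targets, because a single equation p = 0 is also a system.\<close>

lemma ETR_reduces:
  assumes "B = {encode \<phi> | \<phi>. cls_fm \<phi> \<in> C \<and> true_sentence \<phi>}" "{CEqZ, CExEqZ} \<subseteq> C"
  shows "ETR \<le>\<^sub>p B"
proof -
  have T: "translate (blank_store(0 := map token_letter (map Sy (fm_word \<phi>)))) 0
      = map token_letter (map Sy (fm_word (to_feasible \<phi>)))" if "cls_fm \<phi> \<in> etr_classes" for \<phi>
    using that translate unfolding etr_cls by blast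
  have A: "\<not> is_trm c \<and> c \<noteq> CBad" if "c \<in> etr_classes" for c
    using that by (auto simp: is_trm_def)
  obtain f where f: "polytime f" "\<And>\<phi>. cls_fm \<phi> \<in> etr_classes \<Longrightarrow> f (encode \<phi>) = encode (to_feasible \<phi>)"
      "\<And>w. \<nexists>\<phi>. cls_fm \<phi> \<in> etr_classes \<and> w = encode \<phi> \<Longrightarrow> f w = []"
    using polytime_transform[OF ptime_translate A T] by blast
  have "w \<in> ETR \<longleftrightarrow> f w \<in> B" for w
  proof (cases "\<exists>\<phi>. cls_fm \<phi> \<in> etr_classes \<and> w = encode \<phi>")
    case True
    then obtain \<phi> where \<phi>: "cls_fm \<phi> \<in> etr_classes" "w = encode \<phi>" by blast
    then obtain xs \<psi> where "\<phi> = ex_prefix xs \<psi>" "quantifier_free \<psi>" unfolding etr_cls by blast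
    then have "true_sentence (to_feasible \<phi>) \<longleftrightarrow> true_sentence \<phi>"
      using true_sentence_to_feasible by simp
    moreover have "f w = encode (to_feasible \<phi>)" using f(2) \<phi> by simp
    moreover have "cls_fm (to_feasible \<phi>) \<in> C" using to_feasible_cls assms(2) by blast
    moreover have "w \<in> ETR \<longleftrightarrow> true_sentence \<phi>"
      unfolding ETR_eq using \<phi> encode_inj by blast
    moreover have "encode (to_feasible \<phi>) \<in> B \<longleftrightarrow> cls_fm (to_feasible \<phi>) \<in> C \<and> true_sentence (to_feasible \<phi>)"
      unfolding assms(1) using encode_inj by blast
    ultimately show ?thesis by simp
  next
    case False
    then have "w \<notin> ETR" unfolding ETR_eq by blast
    moreover have "f w \<notin> B"
      using f(3)[OF False] encode_neq_Nil[symmetric] unfolding assms(1) by auto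
    ultimately show ?thesis by simp
  qed
  with f(1) show ?thesis unfolding reduces_def by blast
qed

lemma ER_complete_if:
  assumes "B \<le>\<^sub>p ETR" "ETR \<le>\<^sub>p B"
  shows "ER_complete B"
  using assms reduces_trans unfolding ER_complete_def ER_def by blast

theorem proposition3p2:
  "ER_complete FEASIBLE \<and> ER_complete INEQ \<and> INEQ \<le>\<^sub>p FEASIBLE"
proof -
  have "ETR \<le>\<^sub>p FEASIBLE"
    by (rule ETR_reduces[OF FEASIBLE_eq]) simp
  moreover have "ETR \<le>\<^sub>p INEQ"
    by (rule ETR_reduces[OF INEQ_eq]) simp
  \<comment> \<open>The reduction of \<open>INEQ\<close> to \<open>FEASIBLE\<close> goes through
    \<open>ETR\<close>.\<close>
  ultimately show ?thesis
    using FEASIBLE_reduces_ETR INEQ_reduces_ETR ER_complete_if reduces_trans by blast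
qed

end
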